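(* Fix a Latin colored triple system $H$ and a real number $\alpha$ such that $H$ is $\alpha$-stable, and let $\mathbf L$ be a uniformly random order-$n$ Latin square, viewed as a colored triple system. Then with probability $1-o(1)$ as $n\to\infty$, \[X_H(\mathbf L)\le\mathbb E X_H(\mathbf B_n)+o(n^\alpha).\]
   Context: A colored triple system is a 3-uniform hypergraph whose vertex set is partitioned into three color classes labeled $R,C,S$, every hyperedge containing exactly one vertex of each class. It is Latin if no two hyperedges share more than one vertex. For order $n$ the color classes are $R=\{1,\dots,n\}$, $C=\{n+1,\dots,2n\}$, $S=\{2n+1,\dots,3n\}$; an order-$n$ Latin square $L$ (an $n\times n$ array on symbols $1,\dots,n$ with each symbol exactly once in each row and column) is identified with the Latin colored triple system with hyperedges $\{r,n+c,2n+s\}$ for $L_{r,c}=s$. For colored triple systems $H,Q$, $X_H(Q)$ is the number of labeled copies of $H$ in $Q$, i.e., injective color-preserving maps $V(H)\to V(Q)$ sending hyperedges to hyperedges. $\mathbf B_{n,p}$ is the random colored triple system on color classes $R,C,S$ (of size $n$) in which each of the $n^3$ possible hyperedges is present independently with probability $p$, and $\mathbf B_n=\mathbf B_{n,1/n}$; for a colored triple system $Q$ on the same vertex set, $Q\subseteq\mathbf B_n$ means all hyperedges of $Q$ are present. $H$ is $\alpha$-stable if $\mathbb E X_H(\mathbf B_n)=O(n^\alpha)$ and there is a function $t=t(n)=\omega(n(\log n)^2)$ such that $\mathbb E[X_H(\mathbf B_n)\mid Q\subseteq\mathbf B_n]-\mathbb E X_H(\mathbf B_n)=o(n^\alpha)$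 uniformly over all Latin colored triple systems $Q$ (on the color classes $R,C,S$ of size $n$) with at most $t$ hyperedges. *)

theory Defs
  imports "HOL-Probability.Probability" "HOL-Probability.Product_PMF" "HOL-Library.Landau_Symbols"
begin

record 'a triple_system =
  Rcl :: "'a set"
  Ccl :: "'a set"
  Scl :: "'a set"
  hedges :: "'a set set"

definition verts :: "'a triple_system \<Rightarrow> 'a set" where
  "verts H = Rcl H \<union> Ccl H \<union> Scl H"

definition colored_triple_system :: "'a triple_system \<Rightarrow> bool" where
  "colored_triple_system H \<longleftrightarrow>
     finite (verts H) \<and>
     Rcl H \<inter> Ccl H = {} \<and> Rcl H \<inter> Scl H = {} \<and> Ccl H \<inter> Scl H = {} \<and>
     (\<forall>e\<in>hedges H. e \<subseteq> verts H \<and> card e = 3 \<and>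
        card (e \<inter> Rcl H) = 1 \<and> card (e \<inter> Ccl H) = 1 \<and> card (e \<inter> Scl H) = 1)"

definition latin :: "'a triple_system \<Rightarrow> bool" where
  "latin H \<longleftrightarrow> (\<forall>e\<in>hedges H. \<forall>e'\<in>hedges H. e \<noteq> e' \<longrightarrow> card (e \<inter> e') \<le> 1)"

text \<open>Labeled copies are maps on \<^term>\<open>verts H\<close> only; extensionality
  (\<open>\<rightarrow>\<^sub>E\<close>) makes each of them a single HOL function, so that the count is finite.\<close>

definition copies :: "'a triple_system \<Rightarrow> 'b triple_system \<Rightarrow> ('a \<Rightarrow> 'b) set" where
  "copies H Q = {f \<in> verts H \<rightarrow>\<^sub>E verts Q. inj_on f (verts H) \<and>
     f ` Rcl H \<subseteq> Rcl Q \<and> f ` Ccl H \<subseteq> Ccl Q \<and> f ` Scl H \<subseteq> Scl Q \<and>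
     (\<forall>e\<in>hedges H. f ` e \<in> hedges Q)}"

definition num_copies :: "'a triple_system \<Rightarrow> 'b triple_system \<Rightarrow> nat" where
  "num_copies H Q = card (copies H Q)"

definition order_system :: "nat \<Rightarrow> nat set set \<Rightarrow> nat triple_system" where
  "order_system n E = \<lparr>Rcl = {1..n}, Ccl = {n+1..2*n}, Scl = {2*n+1..3*n}, hedges = E\<rparr>"

definition all_hedges :: "nat \<Rightarrow> nat set set" where
  "all_hedges n = {{r, n + c, 2*n + s} | r c s. r \<in> {1..n} \<and> c \<in> {1..n} \<and> s \<in> {1..n}}"

definition random_system_p :: "nat \<Rightarrow> real \<Rightarrow> nat triple_system pmf" where
  "random_system_p n p =
     map_pmf (\<lambda>\<omega>. order_system n {e \<in> all_hedges n. \<omega> e})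
       (Pi_pmf (all_hedges n) False (\<lambda>_. bernoulli_pmf p))"

definition random_system :: "nat \<Rightarrow> nat triple_system pmf" where
  "random_system n = random_system_p n (1 / real n)"

definition exp_copies :: "'a triple_system \<Rightarrow> nat \<Rightarrow> real" where
  "exp_copies H n = measure_pmf.expectation (random_system n) (\<lambda>G. real (num_copies H G))"

definition cond_exp_copies :: "'a triple_system \<Rightarrow> nat \<Rightarrow> nat triple_system \<Rightarrow> real" where
  "cond_exp_copies H n Q =
     measure_pmf.expectation (cond_pmf (random_system n) {G. hedges Q \<subseteq> hedges G})
       (\<lambda>G. real (num_copies H G))"

text \<open>The threshold \<open>t\<close> is natural-valued because \<open>\<omega>\<close> only constrains absolute values: with
  a negative real \<open>t\<close> the uniform condition would be vacuous.\<close>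

definition alpha_stable :: "real \<Rightarrow> 'a triple_system \<Rightarrow> bool" where
  "alpha_stable \<alpha> H \<longleftrightarrow>
     exp_copies H \<in> O(\<lambda>n. real n powr \<alpha>) \<and>
     (\<exists>t :: nat \<Rightarrow> nat.
        (\<lambda>n. real (t n)) \<in> \<omega>(\<lambda>n. real n * (ln (real n))\<^sup>2) \<and>
        (\<forall>\<epsilon>>0. \<forall>\<^sub>F n in sequentially. \<forall>E.
           colored_triple_system (order_system n E) \<and> latin (order_system n E) \<and> card E \<le> t n \<longrightarrow>
           \<bar>cond_exp_copies H n (order_system n E) - exp_copies H n\<bar> \<le> \<epsilon> * real n powr \<alpha>))"

definition latin_squares :: "nat \<Rightarrow> (nat \<times> nat \<Rightarrow> nat) set" where
  "latin_squares n = {L \<in> {1..n} \<times> {1..n} \<rightarrow>\<^sub>E {1..n}.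
     (\<forall>r\<in>{1..n}. \<forall>s\<in>{1..n}. \<exists>!c. c \<in> {1..n} \<and> L (r, c) = s) \<and>
     (\<forall>c\<in>{1..n}. \<forall>s\<in>{1..n}. \<exists>!r. r \<in> {1..n} \<and> L (r, c) = s)}"

definition latin_square_system :: "nat \<Rightarrow> (nat \<times> nat \<Rightarrow> nat) \<Rightarrow> nat triple_system" where
  "latin_square_system n L =
     order_system n {{r, n + c, 2*n + s} | r c s. r \<in> {1..n} \<and> c \<in> {1..n} \<and> L (r, c) = s}"

definition random_latin_square :: "nat \<Rightarrow> nat triple_system pmf" where
  "random_latin_square n = map_pmf (latin_square_system n) (pmf_of_set (latin_squares n))"

text \<open>\<^const>\<open>pmf_of_set\<close> needs a finite nonempty set and \<^const>\<open>cond_pmf\<close> an event of positive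
  probability; the lemmas below show that both are used properly above.\<close>

lemma finite_latin_squares: "finite (latin_squares n)"
  unfolding latin_squares_def
  by (rule finite_subset[of _ "{1..n} \<times> {1..n} \<rightarrow>\<^sub>E {1..n}"]) (auto intro!: finite_PiE)

lemma ex1_shift_mod:
  fixes n a s :: nat
  assumes "n > 0" "s \<in> {1..n}"
  shows "\<exists>!c. c \<in> {1..n} \<and> (a + c) mod n + 1 = s"
proof -
  have inj: "inj_on (\<lambda>c. (a + c) mod n + 1) {1..n}"
  proof (rule inj_onI)
    fix x y assume xy: "x \<in> {1..n}" "y \<in> {1..n}" "(a + x) mod n + 1 = (a + y) mod n + 1"
    hence eq: "(a + x) mod n = (a + y) mod n" by simp
    have "n dvd x - y" if "y \<le> x" using eq mod_eq_dvd_iff_nat[of "a + y" "a + x" n] that by simp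
    moreover have "n dvd y - x" if "x \<le> y" using eq mod_eq_dvd_iff_nat[of "a + x" "a + y" n] that by simp
    moreover have "x - y < n" "y - x < n" using xy(1,2) by auto
    ultimately show "x = y" by (metis diff_is_0_eq dvd_imp_le le_antisym nat_le_linear neq0_conv not_le)
  qed
  have "(\<lambda>c. (a + c) mod n + 1) ` {1..n} = {1..n}"
  proof (rule card_subset_eq)
    show "card ((\<lambda>c. (a + c) mod n + 1) ` {1..n}) = card {1..n}" by (rule card_image[OF inj])
  qed (use assms(1) in \<open>auto simp: Suc_le_eq\<close>)
  hence "s \<in> (\<lambda>c. (a + c) mod n + 1) ` {1..n}" using assms(2) by simp
  then obtain c where "c \<in> {1..n}" "(a + c) mod n + 1 = s" by auto
  thus ?thesis using inj by (intro ex1I[of _ c]) (auto dest: inj_onD)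
qed

lemma latin_squares_nonempty: "latin_squares n \<noteq> {}"
proof (cases "n = 0")
  case True
  thus ?thesis by (auto simp: latin_squares_def)
next
  case False
  define L where "L = restrict (\<lambda>(r, c). (r + c) mod n + 1) ({1..n} \<times> {1..n})"
  have "L \<in> {1..n} \<times> {1..n} \<rightarrow>\<^sub>E {1..n}" using False by (auto simp: L_def Suc_le_eq)
  moreover have "\<exists>!c. c \<in> {1..n} \<and> L (r, c) = s" if "r \<in> {1..n}" "s \<in> {1..n}" for r s
    using ex1_shift_mod[of n s r] False that by (simp add: L_def conj_ac cong: conj_cong)
  moreover have "\<exists>!r. r \<in> {1..n} \<and> L (r, c) = s" if "c \<in> {1..n}" "s \<in> {1..n}" for c s
    using ex1_shift_mod[of n s c] False that
    by (simp add: L_def add.commute[of _ c] cong: conj_cong)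
  ultimately have "L \<in> latin_squares n" by (auto simp: latin_squares_def)
  thus ?thesis by blast
qed

lemma finite_all_hedges: "finite (all_hedges n)"
proof -
  have "all_hedges n = (\<lambda>(r, c, s). {r, n + c, 2*n + s}) ` ({1..n} \<times> {1..n} \<times> {1..n})"
    unfolding all_hedges_def by (auto simp: image_iff) blast
  thus ?thesis by simp
qed

lemma hedges_subset_all_hedges:
  assumes "colored_triple_system (order_system n E)"
  shows "E \<subseteq> all_hedges n"
proof
  fix e assume e: "e \<in> E"
  have sub: "e \<subseteq> {1..n} \<union> {n+1..2*n} \<union> {2*n+1..3*n}"
    and "card (e \<inter> {1..n}) = 1" "card (e \<inter> {n+1..2*n}) = 1" "card (e \<inter> {2*n+1..3*n}) = 1"
    using assms e by (auto simp: colored_triple_system_def order_system_def verts_def)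
  then obtain r c s where rcs: "e \<inter> {1..n} = {r}" "e \<inter> {n+1..2*n} = {c}" "e \<inter> {2*n+1..3*n} = {s}"
    by (metis card_1_singletonE)
  have "e = (e \<inter> {1..n}) \<union> (e \<inter> {n+1..2*n}) \<union> (e \<inter> {2*n+1..3*n})" using sub by blast
  hence "e = {r, c, s}" unfolding rcs by auto
  moreover have "r \<in> {1..n}" "c \<in> {n+1..2*n}" "s \<in> {2*n+1..3*n}" using rcs by blast+
  ultimately have "e = {r, n + (c - n), 2*n + (s - 2*n)} \<and> r \<in> {1..n} \<and> c - n \<in> {1..n} \<and> s - 2*n \<in> {1..n}"
    by auto
  thus "e \<in> all_hedges n" unfolding all_hedges_def by blast
qed

lemma conditioning_event_possible:
  assumes "colored_triple_system (order_system n E)"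
  shows "set_pmf (random_system n) \<inter> {G. hedges (order_system n E) \<subseteq> hedges G} \<noteq> {}"
proof (cases "n = 0")
  case True
  hence "E = {}" using hedges_subset_all_hedges[OF assms] by (auto simp: all_hedges_def)
  thus ?thesis by (auto simp: order_system_def set_pmf_not_empty)
next
  case False
  define \<omega> where "\<omega> = (\<lambda>e. e \<in> all_hedges n)"
  have "pmf (Pi_pmf (all_hedges n) False (\<lambda>_. bernoulli_pmf (1 / real n))) \<omega> = (\<Prod>e\<in>all_hedges n. 1 / real n)"
    using False by (subst pmf_Pi'[OF finite_all_hedges]) (auto simp: \<omega>_def intro!: prod.cong)
  also have "\<dots> > 0" using False by (simp add: prod_pos)
  finally have "\<omega> \<in> set_pmf (Pi_pmf (all_hedges n) False (\<lambda>_. bernoulli_pmf (1 / real n)))"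
    by (simp add: set_pmf_iff)
  hence "order_system n {e \<in> all_hedges n. \<omega> e} \<in> set_pmf (random_system n)"
    unfolding random_system_def random_system_p_def by auto
  moreover have "hedges (order_system n E) \<subseteq> hedges (order_system n {e \<in> all_hedges n. \<omega> e})"
    using hedges_subset_all_hedges[OF assms] by (auto simp: order_system_def \<omega>_def)
  ultimately show ?thesis by blast
qed

end

theory Submission
  imports Defs "HOL-Computational_Algebra.Fundamental_Theorem_Algebra" "HOL-Real_Asymp.Real_Asymp"
begin

text \<open>
  Markov's inequality is applied to a \<open>k\<close>-th moment with \<open>k\<close> of order \<open>t n\<close>. It needs
  \<open>P (Q \<subseteq> L) \<le> exp (O (n (ln n)\<^sup>2) + \<delta> |Q|) n ^ (- |Q|)\<close> for sets \<open>Q\<close> of hyperedges, which fails if the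
  degrees of \<open>Q\<close> are comparable to \<open>n\<close>. So only copies with rows in \<open>A\<close> and columns in \<open>B\<close> are counted,
  where \<open>|A| = |B| = \<gamma> n\<close> with a small constant \<open>\<gamma>\<close>. There the estimate follows by building the
  square row by row: Bregman's theorem bounds the number of extensions that contain \<open>Q\<close> from above, and
  a weak form of the van der Waerden bound, \<open>(m / e) ^ n\<close> matchings in an \<open>m\<close>-regular bipartite graph, bounds
  the number of all extensions from below. In the expansion of the moment the copies are summed out one at a time,
  and stability bounds each of these sums, as the union of the previous copies is Latin and has at most \<open>t n\<close>
  hyperedges. Finally, by convexity of \<open>x ^ k\<close> the \<open>k\<close>-th power of the number of all copies is at most the
  average over all corners \<open>A \<times> B\<close> of the \<open>k\<close>-th powers of the suitably rescaled numbers of copies in a corner.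
\<close>

section \<open>Bregman's bound\<close>

text \<open>The growth of \<open>t\<close> in the definition of stability is matched to the counting
  error. For one row with \<open>m\<close> symbols available per column, the upper and the lower
  bound have the same main term \<open>(m / e) ^ n\<close> and differ by a factor
  \<open>exp (O (n * ln n / m))\<close>; summing \<open>1 / m\<close> over the rows produces the
  second logarithm. The weak permanent bound loses only a polynomial factor per row against
  \<open>n! / n ^ n\<close>, which disappears in this error. An excess of
  \<open>\<epsilon> * n powr \<alpha>\<close> over the mean gains a factor \<open>\<rho> ^ k\<close>
  with a constant \<open>\<rho> < 1\<close>, and this beats the error once \<open>k\<close> is a
  large multiple of \<open>n * (ln n)^2\<close>. The other loss, \<open>exp (\<delta> |Q|)\<close>
  with \<open>|Q|\<close> up to \<open>k * card (hedges H)\<close>, has the same order as the gain;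
  it is beaten because \<open>\<gamma>\<close> is chosen after \<open>\<rho>\<close>. On the other
  hand \<open>\<gamma>\<close> must not depend on \<open>n\<close>: the fraction of copies in a
  corner then stays bounded below, so that the stability error, which is not rescaled, remains small
  against the rescaled excess. All this is done for fixed \<open>\<epsilon>\<close>; a diagonal
  choice produces the single error term.\<close>

definition matchings :: "'c set \<Rightarrow> ('c \<Rightarrow> 's set) \<Rightarrow> ('c \<Rightarrow> 's) set" where
  "matchings C A = {f \<in> PiE C A. inj_on f C}"

lemma finite_matchings: "finite C \<Longrightarrow> (\<And>c. c \<in> C \<Longrightarrow> finite (A c)) \<Longrightarrow> finite (matchings C A)"
  unfolding matchings_def by (rule finite_subset[of _ "PiE C A"]) (auto intro: finite_PiE)

text \<open>The inequality \<open>ln x <= x - 1\<close> at \<open>x = p / (card K * q k)\<close>,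
  weighted by \<open>q k\<close>, has right-hand sides that sum to zero. In other words the
  distribution \<open>q k / p\<close> has entropy at most \<open>ln (card K)\<close>, with
  \<open>0 * ln 0 = 0\<close>.\<close>

lemma entropy_split:
  fixes q :: "'k \<Rightarrow> real"
  assumes "finite K" "\<And>k. k \<in> K \<Longrightarrow> q k \<ge> 0" "p = (\<Sum>k\<in>K. q k)" "p > 0"
  shows "p * ln p \<le> p * ln (card K) + (\<Sum>k\<in>K. q k * ln (q k))"
proof -
  let ?r = "real (card K)"
  have "K \<noteq> {}" using assms by auto
  hence r: "?r > 0" using assms(1) by (simp add: card_gt_0_iff)
  have "q k * (ln p - ln ?r - ln (q k)) \<le> p / ?r - q k" if "k \<in> K" for k
  proof (cases "q k = 0")
    case True thus ?thesis using assms(4) r by simp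
  next
    case False
    hence q: "q k > 0" using assms(2)[OF that] by simp
    have "ln p - ln ?r - ln (q k) = ln (p / (?r * q k))"
      using assms(4) r q by (simp add: ln_div ln_mult)
    also have "\<dots> \<le> p / (?r * q k) - 1"
      using assms(4) r q by (intro ln_le_minus_one) simp
    finally have "q k * (ln p - ln ?r - ln (q k)) \<le> q k * (p / (?r * q k) - 1)"
      using q by (intro mult_left_mono) auto
    also have "\<dots> = p / ?r - q k" using q r by (simp add: field_simps)
    finally show ?thesis .
  qed
  hence "(\<Sum>k\<in>K. q k * (ln p - ln ?r - ln (q k))) \<le> (\<Sum>k\<in>K. p / ?r - q k)"
    by (rule sum_mono)
  also have "\<dots> = 0" using r assms(3) by (simp add: sum_subtractf)
  finally show ?thesis
    by (simp add: algebra_simps sum_subtractf sum.distrib assms(3) sum_distrib_left sum_distrib_right)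
qed

text \<open>One term of the expansion of a permanent along row \<open>i\<close>; deleting
  \<open>i\<close> and \<open>k\<close> leaves a smaller instance for the induction in Bregman's
  theorem.\<close>

lemma card_matchings_fixed:
  assumes "i \<in> C" "k \<in> A i"
  shows "card {f \<in> matchings C A. f i = k} = card (matchings (C - {i}) (\<lambda>j. A j - {k}))"
proof (rule bij_betw_same_card)
  show "bij_betw (\<lambda>f. restrict f (C - {i})) {f \<in> matchings C A. f i = k}
          (matchings (C - {i}) (\<lambda>j. A j - {k}))"
  proof (rule bij_betwI[where g = "\<lambda>g. g(i := k)"])
    show "(\<lambda>f. restrict f (C - {i})) \<in> {f \<in> matchings C A. f i = k} \<rightarrow> matchings (C - {i}) (\<lambda>j. A j - {k})"
      using assms by (auto simp: matchings_def PiE_def Pi_def inj_on_def)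
    show "(\<lambda>g. g(i := k)) \<in> matchings (C - {i}) (\<lambda>j. A j - {k}) \<rightarrow> {f \<in> matchings C A. f i = k}"
      using assms by (auto simp: matchings_def PiE_def Pi_def inj_on_def extensional_def)
    show "(restrict f (C - {i}))(i := k) = f" if "f \<in> {f \<in> matchings C A. f i = k}" for f
      using that assms by (auto simp: matchings_def PiE_def extensional_def fun_eq_iff)
    show "restrict (g(i := k)) (C - {i}) = g" if "g \<in> matchings (C - {i}) (\<lambda>j. A j - {k})" for g
      using that assms by (auto simp: matchings_def PiE_def extensional_def fun_eq_iff)
  qed
qed

text \<open>Schrijver's proof: expand \<open>n p ln p\<close> along each row (\<open>p\<close> being the number of matchings), bound
  the minors by induction and interchange the sums over matchings and rows.\<close>

lemma bregman:
  fixes A :: "'c \<Rightarrow> 's set"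
  assumes "finite C" "finite S" "card S = card C" "\<And>c. c \<in> C \<Longrightarrow> A c \<subseteq> S"
  shows "real (card (matchings C A)) \<le> exp (\<Sum>c\<in>C. ln (fact (card (A c))) / card (A c))"
  using assms
proof (induction "card C" arbitrary: C S A)
  case 0
  hence "C = {}" by simp
  thus ?case by (simp add: matchings_def)
next
  case (Suc n')
  define b where "b = (\<lambda>r::nat. ln (fact r) / real r)"
  define n where "n = card C"
  have n: "n = Suc n'" "n > 0" using Suc.hyps by (auto simp: n_def)
  let ?M = "matchings C A"
  define p where "p = real (card ?M)"
  have finA: "finite (A c)" if "c \<in> C" for c using that Suc.prems finite_subset by metis
  have finM: "finite ?M" using finA Suc.prems by (intro finite_matchings)
  define q where "q = (\<lambda>i k. real (card {f \<in> ?M. f i = k}))"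
  show ?case
  proof (cases "p = 0")
    case True thus ?thesis by (simp add: p_def)
  next
    case False
    hence p: "p > 0" by (simp add: p_def)
    have psum: "p = (\<Sum>k\<in>A i. q i k)" if i: "i \<in> C" for i
    proof -
      have "?M = (\<Union>k\<in>A i. {f \<in> ?M. f i = k})" using i by (auto simp: matchings_def)
      hence "card ?M = card (\<Union>k\<in>A i. {f \<in> ?M. f i = k})" by simp
      also have "\<dots> = (\<Sum>k\<in>A i. card {f \<in> ?M. f i = k})"
        using finA[OF i] finM by (intro card_UN_disjoint) auto
      finally show ?thesis by (simp add: p_def q_def)
    qed
    have qsum: "(\<Sum>k\<in>A i. q i k * ln (q i k)) = (\<Sum>f\<in>?M. ln (q i (f i)))" if i: "i \<in> C" for i
    proof -
      have "(\<Sum>f\<in>?M. ln (q i (f i))) = (\<Sum>k\<in>A i. \<Sum>f\<in>{f \<in> ?M. f i = k}. ln (q i (f i)))"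
        using finA[OF i] finM i by (intro sum.group[symmetric]) (auto simp: matchings_def)
      also have "\<dots> = (\<Sum>k\<in>A i. q i k * ln (q i k))" by (intro sum.cong) (auto simp: q_def)
      finally show ?thesis ..
    qed
    have IH: "ln (q i (f i)) \<le> (\<Sum>j\<in>C-{i}. b (card (A j - {f i})))" if i: "i \<in> C" and f: "f \<in> ?M" for i f
    proof -
      have fi: "f i \<in> A i" using i f by (auto simp: matchings_def)
      have "real (card (matchings (C - {i}) (\<lambda>j. A j - {f i})))
              \<le> exp (\<Sum>j\<in>C-{i}. ln (fact (card (A j - {f i}))) / card (A j - {f i}))"
        using i fi Suc.prems Suc.hyps(2)
        by (intro Suc.hyps(1)[of _ "S - {f i}"]) (auto simp: card_Diff_singleton_if)
      hence "q i (f i) \<le> exp (\<Sum>j\<in>C-{i}. b (card (A j - {f i})))"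
        unfolding q_def using card_matchings_fixed[of i C "f i" A] i fi by (simp add: b_def)
      moreover have "q i (f i) > 0"
        unfolding q_def using finM f by (auto simp: card_gt_0_iff)
      ultimately show ?thesis by (metis ln_le_cancel_iff exp_gt_zero ln_exp)
    qed
    \<comment> \<open>For fixed \<open>j\<close> the values \<open>f i\<close>,
      \<open>i \<noteq> j\<close>, run exactly once through \<open>S - {f j}\<close>. With
      \<open>r = card (A j)\<close>, the \<open>r - 1\<close> values inside \<open>A j\<close>
      shrink it to size \<open>r - 1\<close> and together give
      \<open>(r - 1) * b (r - 1) = ln (fact (r - 1))\<close>; the \<open>n - r\<close> values
      outside give \<open>b r\<close> each.\<close>
    have swap: "(\<Sum>i\<in>C. \<Sum>j\<in>C-{i}. b (card (A j - {f i}))) = (\<Sum>j\<in>C. ln (fact (card (A j) - 1)) + (n - card (A j)) * b (card (A j)))"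
      if f: "f \<in> ?M" for f
    proof -
      have inj: "inj_on f C" and fA: "\<And>c. c \<in> C \<Longrightarrow> f c \<in> A c" using f by (auto simp: matchings_def)
      have im: "f ` C = S"
        using fA Suc.prems inj by (intro card_subset_eq) (auto simp: card_image)
      have "(\<Sum>i\<in>C. \<Sum>j\<in>C-{i}. b (card (A j - {f i}))) = (\<Sum>j\<in>C. \<Sum>i\<in>C-{j}. b (card (A j - {f i})))"
      proof -
        have "(\<Sum>i\<in>C. \<Sum>j\<in>C-{i}. b (card (A j - {f i}))) = (\<Sum>i\<in>C. \<Sum>j\<in>C. if j \<noteq> i then b (card (A j - {f i})) else 0)"
          using Suc.prems(1) by (intro sum.cong refl sum.mono_neutral_cong_left) auto
        also have "\<dots> = (\<Sum>j\<in>C. \<Sum>i\<in>C. if j \<noteq> i then b (card (A j - {f i})) else 0)"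
          by (rule sum.swap)
        also have "\<dots> = (\<Sum>j\<in>C. \<Sum>i\<in>C-{j}. b (card (A j - {f i})))"
          using Suc.prems(1) by (intro sum.cong refl sum.mono_neutral_cong_right) auto
        finally show ?thesis .
      qed
      also have "\<dots> = (\<Sum>j\<in>C. ln (fact (card (A j) - 1)) + (n - card (A j)) * b (card (A j)))"
      proof (rule sum.cong[OF refl])
        fix j assume j: "j \<in> C"
        let ?r = "card (A j)"
        have r: "?r > 0" using fA[OF j] finA[OF j] by (auto simp: card_gt_0_iff)
        have "(\<Sum>i\<in>C-{j}. b (card (A j - {f i}))) = (\<Sum>s\<in>f ` (C - {j}). b (card (A j - {s})))"
          using inj by (subst sum.reindex) (auto intro: inj_on_subset)
        also have "f ` (C - {j}) = S - {f j}" using im inj j by (auto simp: inj_on_def)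
        also have "(\<Sum>s\<in>S-{f j}. b (card (A j - {s}))) = (\<Sum>s\<in>A j-{f j}. b (card (A j - {s}))) + (\<Sum>s\<in>S-A j. b (card (A j - {s})))"
          using Suc.prems(2,4) fA[OF j] j by (subst sum.union_disjoint[symmetric]) (auto intro!: sum.cong finite_subset[of _ S])
        also have "(\<Sum>s\<in>A j-{f j}. b (card (A j - {s}))) = real (?r - 1) * b (?r - 1)"
          using finA[OF j] fA[OF j] by simp
        also have "\<dots> = ln (fact (?r - 1))" by (simp add: b_def)
        also have "(\<Sum>s\<in>S-A j. b (card (A j - {s}))) = (\<Sum>s\<in>S-A j. b ?r)"
          by (intro sum.cong) auto
        also have "\<dots> = (n - ?r) * b ?r"
          using Suc.prems finA[OF j] j by (simp add: card_Diff_subset n_def)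
        finally show "(\<Sum>i\<in>C-{j}. b (card (A j - {f i}))) = ln (fact (?r - 1)) + (n - ?r) * b ?r" .
      qed
      finally show ?thesis .
    qed
    \<comment> \<open>One copy of \<open>p * ln p\<close> for each row along which the permanent is
      expanded.\<close>
    have "n * (p * ln p) = (\<Sum>i\<in>C. p * ln p)" by (simp add: n_def)
    also have "\<dots> \<le> (\<Sum>i\<in>C. p * ln (card (A i)) + (\<Sum>k\<in>A i. q i k * ln (q i k)))"
      using finA p psum by (intro sum_mono entropy_split) (auto simp: q_def)
    also have "\<dots> = (\<Sum>i\<in>C. p * ln (card (A i)) + (\<Sum>f\<in>?M. ln (q i (f i))))"
      using qsum by simp
    also have "\<dots> \<le> (\<Sum>i\<in>C. p * ln (card (A i)) + (\<Sum>f\<in>?M. \<Sum>j\<in>C-{i}. b (card (A j - {f i}))))"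
      using IH by (intro sum_mono add_left_mono) auto
    also have "\<dots> = p * (\<Sum>i\<in>C. ln (card (A i))) + (\<Sum>f\<in>?M. \<Sum>i\<in>C. \<Sum>j\<in>C-{i}. b (card (A j - {f i})))"
      by (simp add: sum.distrib sum_distrib_left sum.swap[of _ ?M C])
    also have "\<dots> = p * (\<Sum>i\<in>C. ln (card (A i))) + p * (\<Sum>j\<in>C. ln (fact (card (A j) - 1)) + (n - card (A j)) * b (card (A j)))"
      using swap by (simp add: p_def)
    also have "\<dots> = p * (\<Sum>j\<in>C. n * b (card (A j)))"
    proof -
      \<comment> \<open>The entropy term \<open>ln r\<close> completes
        \<open>ln (fact (r - 1))\<close> to \<open>ln (fact r) = r * b r\<close>. With the other
        \<open>n - r\<close> copies of \<open>b r\<close> every \<open>j\<close> gets weight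
        \<open>n\<close>, which cancels the \<open>n\<close> on the left.\<close>
      have "ln (card (A j)) + (ln (fact (card (A j) - 1)) + (n - card (A j)) * b (card (A j))) = n * b (card (A j))" if j: "j \<in> C" for j
      proof -
        obtain f where f: "f \<in> ?M" using False finM by (auto simp: p_def card_eq_0_iff)
        have "f j \<in> A j" using f j by (auto simp: matchings_def)
        then obtain r where r: "card (A j) = Suc r"
          using finA[OF j] by (cases "card (A j)") auto
        have le: "Suc r \<le> n" using card_mono[of S "A j"] Suc.prems j r by (simp add: n_def)
        have "ln (real (Suc r)) + ln (fact r) = ln (fact (Suc r))"
          by (simp add: ln_mult del: of_nat_Suc)
        also have "\<dots> = Suc r * b (Suc r)" by (simp add: b_def del: of_nat_Suc)
        finally show ?thesis using r le by (simp add: algebra_simps of_nat_diff del: of_nat_Suc)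
      qed
      thus ?thesis by (simp add: distrib_left[symmetric] sum.distrib[symmetric])
    qed
    finally have "(n * p) * ln p \<le> (n * p) * (\<Sum>j\<in>C. b (card (A j)))"
      by (simp add: sum_distrib_left algebra_simps)
    hence "ln p \<le> (\<Sum>j\<in>C. b (card (A j)))" using n p by simp
    hence "p \<le> exp (\<Sum>j\<in>C. b (card (A j)))" using p by (metis exp_le_cancel_iff exp_ln)
    thus ?thesis by (simp add: p_def b_def)
  qed
qed

section \<open>A lower bound for permanents\<close>

text \<open>The Gauss--Lucas argument at the origin: the logarithmic derivative at \<open>0\<close> is the sum of
  \<open>- 1 / z\<close> over the roots \<open>z\<close>.\<close>

lemma gauss_lucas_at_0:
  fixes p :: "complex poly"
  assumes "p \<noteq> 0" "\<And>z. poly p z = 0 \<Longrightarrow> Re z < 0"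
  shows "Re (coeff p 1 / coeff p 0) \<ge> 0 \<and> (degree p > 0 \<longrightarrow> Re (coeff p 1 / coeff p 0) > 0)"
  using assms
proof (induction "degree p" arbitrary: p)
  case 0
  thus ?case by (simp add: coeff_eq_0)
next
  case (Suc d)
  have "\<not> constant (poly p)" using Suc.hyps(2) by (simp add: constant_degree)
  then obtain w where w: "poly p w = 0" using fundamental_theorem_of_algebra by blast
  then obtain q where q: "p = [:-w, 1:] * q" by (auto simp: poly_eq_0_iff_dvd)
  have q0: "q \<noteq> 0" using Suc.prems q by auto
  have dq: "d = degree q" using Suc.hyps(2) q0 unfolding q by (subst (asm) degree_mult_eq) auto
  have roots: "Re z < 0" if "poly q z = 0" for z using Suc.prems(2)[of z] that by (simp add: q)
  have IH: "Re (coeff q 1 / coeff q 0) \<ge> 0" using Suc.hyps(1)[OF dq q0 roots] by blast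
  have wn: "Re w < 0" using Suc.prems(2) w by blast
  hence w0: "w \<noteq> 0" by auto
  have "coeff q 0 \<noteq> 0" using roots[of 0] by (auto simp: poly_0_coeff_0)
  hence "coeff p 1 / coeff p 0 = - 1 / w + coeff q 1 / coeff q 0"
    using w0 by (simp add: q field_simps)
  moreover have "Re (- 1 / w) > 0" using wn w0
    by (simp add: Re_divide divide_neg_pos power2_eq_square[symmetric] add_pos_nonneg)
  ultimately show ?case using IH by simp
qed

text \<open>Such a polynomial is \<open>p(0)\<close> times a product of factors
  \<open>1 + t / v\<close> with \<open>v > 0\<close>. Here \<open>r\<close> is the sum of the
  \<open>1 / v\<close>, \<open>s\<close> is the ratio \<open>p(t) / p(0)\<close>, and each factor is
  at most \<open>exp (t / v)\<close>. The coefficients are complex so that the fundamental theorem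
  of algebra can split off one root at a time.\<close>

lemma real_rooted_exp_bound:
  fixes p :: "complex poly"
  assumes "p \<noteq> 0" "\<And>z. poly p z = 0 \<Longrightarrow> Im z = 0 \<and> Re z < 0"
  shows "\<exists>r\<ge>0. coeff p 1 = coeff p 0 * of_real r \<and>
     (\<forall>t\<ge>0. \<exists>s. 0 \<le> s \<and> s \<le> exp (r * t) \<and> poly p (of_real t) = coeff p 0 * of_real s)"
  using assms
proof (induction "degree p" arbitrary: p)
  case 0
  then obtain c where "p = [:c:]" by (metis degree_eq_zeroE)
  thus ?case by (intro exI[of _ 0]) (auto intro!: exI[of _ 1])
next
  case (Suc d)
  have "\<not> constant (poly p)" using Suc.hyps(2) by (simp add: constant_degree)
  then obtain w where w: "poly p w = 0" using fundamental_theorem_of_algebra by blast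
  then obtain q where q: "p = [:-w, 1:] * q" by (auto simp: poly_eq_0_iff_dvd)
  have q0: "q \<noteq> 0" using Suc.prems q by auto
  have dq: "d = degree q" using Suc.hyps(2) q0 unfolding q by (subst (asm) degree_mult_eq) auto
  have roots: "Im z = 0 \<and> Re z < 0" if "poly q z = 0" for z using Suc.prems(2)[of z] that by (simp add: q)
  obtain r where r: "r \<ge> 0" "coeff q 1 = coeff q 0 * of_real r"
    "\<And>t. t \<ge> 0 \<Longrightarrow> \<exists>s. 0 \<le> s \<and> s \<le> exp (r * t) \<and> poly q (of_real t) = coeff q 0 * of_real s"
    using Suc.hyps(1)[OF dq q0 roots] by blast
  define v where "v = - Re w"
  have v: "v > 0" "w = - of_real v" using Suc.prems(2)[OF w] by (auto simp: v_def complex_eq_iff)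
  show ?case
  proof (rule exI[of _ "1 / v + r"], intro conjI allI impI)
    show "0 \<le> 1 / v + r" using v r by simp
    show "coeff p 1 = coeff p 0 * of_real (1 / v + r)" using v r by (simp add: q field_simps)
    fix t :: real assume t: "t \<ge> 0"
    obtain s where s: "0 \<le> s" "s \<le> exp (r * t)" "poly q (of_real t) = coeff q 0 * of_real s"
      using r(3)[OF t] by blast
    have "(1 + t / v) * s \<le> exp (t / v) * exp (r * t)"
      using s v t by (intro mult_mono) auto
    also have "\<dots> = exp ((1 / v + r) * t)" by (simp add: exp_add[symmetric] algebra_simps)
    finally show "\<exists>s. 0 \<le> s \<and> s \<le> exp ((1 / v + r) * t) \<and> poly p (of_real t) = coeff p 0 * of_real s"
      using s v t by (intro exI[of _ "(1 + t / v) * s"]) (auto simp: q field_simps)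
  qed
qed

section \<open>Permanents as mixed derivatives of products of linear forms\<close>

text \<open>The permanent of the submatrix with rows \<open>T\<close> and columns \<open>js\<close>,
  expanded along one column after the other. The base case makes it vanish unless there are as many
  rows as columns.\<close>

fun wmatch :: "('i \<Rightarrow> 'j \<Rightarrow> real) \<Rightarrow> 'j list \<Rightarrow> 'i set \<Rightarrow> real" where
  "wmatch a [] T = (if T = {} then 1 else 0)"
| "wmatch a (j # js) T = (\<Sum>i\<in>T. a i j * wmatch a js (T - {i}))"

lemma wmatch_eq_0: "finite T \<Longrightarrow> card T \<noteq> length js \<Longrightarrow> wmatch a js T = 0"
proof (induction js arbitrary: T)
  case (Cons j js)
  have "wmatch a js (T - {i}) = 0" if "i \<in> T" for i
  proof (rule Cons.IH)
    show "card (T - {i}) \<noteq> length js" using Cons.prems that by (cases "card T") auto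
  qed (use Cons.prems in auto)
  thus ?case by simp
qed auto

lemma wmatch_nonneg: "(\<And>i j. a i j \<ge> 0) \<Longrightarrow> wmatch a js T \<ge> 0"
  by (induction js arbitrary: T) (auto intro!: sum_nonneg)

lemma wmatch_pos: "(\<And>i j. a i j > 0) \<Longrightarrow> finite T \<Longrightarrow> card T = length js \<Longrightarrow> wmatch a js T > 0"
proof (induction js arbitrary: T)
  case (Cons j js)
  hence "T \<noteq> {}" by auto
  have "wmatch a js (T - {i}) > 0" if "i \<in> T" for i
    using Cons.prems that by (intro Cons.IH) auto
  thus ?case using Cons.prems \<open>T \<noteq> {}\<close> by (auto intro!: sum_pos)
qed auto

text \<open>\<open>mixed a I js y\<close> is the derivative of \<open>\<Prod>i\<in>I. (y i + (\<Sum>j\<in>set js. z j * a i j))\<close> in all the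
  variables \<open>z j\<close>, taken at \<open>z = 0\<close>; its coefficients \<^const>\<open>wmatch\<close> are permanents of minors.\<close>

definition mixed :: "('i \<Rightarrow> 'j \<Rightarrow> real) \<Rightarrow> 'i set \<Rightarrow> 'j list \<Rightarrow> ('i \<Rightarrow> 'a :: real_normed_field) \<Rightarrow> 'a" where
  "mixed a I js y = (\<Sum>T\<in>Pow I. of_real (wmatch a js T) * (\<Prod>i\<in>I-T. y i))"

lemma mixed_Nil:
  assumes "finite I"
  shows "mixed a I [] y = (\<Prod>i\<in>I. y i)"
proof -
  have "mixed a I [] y = (\<Sum>T\<in>Pow I. if T = {} then \<Prod>i\<in>I. y i else 0)"
    unfolding mixed_def by (intro sum.cong) auto
  also have "\<dots> = (\<Prod>i\<in>I. y i)" using assms by (subst sum.delta) auto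
  finally show ?thesis .
qed

text \<open>\<open>mixed\<close> as a polynomial in the one variable that moves \<open>y\<close>
  along column \<open>j\<close>. Its roots carry the stability argument, and its linear coefficient
  is the next derivative.\<close>

definition mixed_poly :: "('i \<Rightarrow> 'j \<Rightarrow> real) \<Rightarrow> 'i set \<Rightarrow> 'j list \<Rightarrow> 'j \<Rightarrow> ('i \<Rightarrow> 'a :: real_normed_field) \<Rightarrow> 'a poly" where
  "mixed_poly a I js j y =
     (\<Sum>T\<in>Pow I. smult (of_real (wmatch a js T)) (\<Prod>i\<in>I-T. [:y i, of_real (a i j):]))"

lemma poly_mixed_poly: "poly (mixed_poly a I js j y) w = mixed a I js (\<lambda>i. y i + w * of_real (a i j))"
  by (simp add: mixed_poly_def mixed_def poly_sum poly_prod)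

lemma coeff_0_mixed_poly: "coeff (mixed_poly a I js j y) 0 = mixed a I js y"
  using poly_mixed_poly[of a I js j y 0] by (simp add: poly_0_coeff_0)

lemma coeff_1_prod_linear:
  fixes y b :: "'i \<Rightarrow> 'a :: field"
  assumes "finite U"
  shows "coeff (\<Prod>i\<in>U. [:y i, b i:]) 1 = (\<Sum>i\<in>U. b i * (\<Prod>k\<in>U-{i}. y k))"
  using assms
proof (induction U)
  case (insert u U)
  have c0: "coeff (\<Prod>i\<in>U. [:y i, b i:]) 0 = (\<Prod>k\<in>U. y k)"
    by (simp add: poly_0_coeff_0[symmetric] poly_prod)
  have "(\<Sum>i\<in>U. b i * (\<Prod>k\<in>insert u U-{i}. y k)) = (\<Sum>i\<in>U. y u * (b i * (\<Prod>k\<in>U-{i}. y k)))"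
  proof (rule sum.cong[OF refl])
    fix i assume "i \<in> U"
    hence "insert u U - {i} = insert u (U - {i})" using insert by auto
    thus "b i * (\<Prod>k\<in>insert u U-{i}. y k) = y u * (b i * (\<Prod>k\<in>U-{i}. y k))"
      using insert by simp
  qed
  moreover have "insert u U - {u} = U" using insert by auto
  ultimately show ?case using insert c0 by (simp add: sum_distrib_left)
qed auto

text \<open>The product rule sums over pairs of a set \<open>T\<close> and an \<open>i\<close>
  outside \<open>T\<close>. Replacing \<open>T\<close> by \<open>insert i T\<close> turns this into
  the expansion of \<open>wmatch\<close> along the new column.\<close>

lemma coeff_1_mixed_poly:
  assumes "finite I"
  shows "coeff (mixed_poly a I js j y) 1 = mixed a I (j # js) y"
proof -
  let ?g = "\<lambda>T. of_real (wmatch a js T)"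
  have "coeff (mixed_poly a I js j y) 1 =
      (\<Sum>T\<in>Pow I. \<Sum>i\<in>I-T. ?g T * (of_real (a i j) * (\<Prod>k\<in>I-insert i T. y k)))"
    unfolding mixed_poly_def coeff_sum coeff_smult using assms
    by (intro sum.cong refl) (subst coeff_1_prod_linear, auto simp: sum_distrib_left Diff_insert[symmetric])
  also have "\<dots> = (\<Sum>(T,i)\<in>Sigma (Pow I) (\<lambda>T. I - T). ?g T * (of_real (a i j) * (\<Prod>k\<in>I-insert i T. y k)))"
    using assms by (subst sum.Sigma) auto
  also have "\<dots> = (\<Sum>(T,i)\<in>Sigma (Pow I) (\<lambda>T. T). ?g (T - {i}) * (of_real (a i j) * (\<Prod>k\<in>I-T. y k)))"
    by (rule sum.reindex_bij_witness[where i = "\<lambda>(T,i). (T - {i}, i)" and j = "\<lambda>(T,i). (insert i T, i)"])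
       (auto simp: insert_absorb)
  also have "\<dots> = (\<Sum>T\<in>Pow I. \<Sum>i\<in>T. ?g (T - {i}) * (of_real (a i j) * (\<Prod>k\<in>I-T. y k)))"
    using assms by (subst sum.Sigma) (auto intro: finite_subset)
  also have "\<dots> = mixed a I (j # js) y"
    unfolding mixed_def by (intro sum.cong refl) (simp add: sum_distrib_right, simp add: mult_ac)
  finally show ?thesis .
qed

text \<open>Only sets \<open>T\<close> of size \<open>length js\<close> have nonzero weight, and for
  these the product has exactly this degree. Positive entries exclude cancellation of the leading
  coefficients. Hence the polynomial is nonzero and not constant.\<close>

lemma coeff_top_mixed_poly:
  assumes "finite I" "\<And>i j. a i j > 0" "length js < card I"
  shows "coeff (mixed_poly a I js j y) (card I - length js) \<noteq> (0 :: 'a :: real_normed_field)"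
proof -
  let ?k = "card I - length js"
  have "coeff (mixed_poly a I js j y) ?k =
      (\<Sum>T\<in>Pow I. of_real (wmatch a js T) * coeff (\<Prod>i\<in>I-T. [:y i, of_real (a i j):]) ?k)"
    by (simp add: mixed_poly_def coeff_sum)
  also have "\<dots> = (\<Sum>T\<in>Pow I. of_real (wmatch a js T * (\<Prod>i\<in>I-T. a i j)))"
  proof (rule sum.cong[OF refl])
    fix T assume T: "T \<in> Pow I"
    hence fT: "finite T" using assms finite_subset by auto
    show "of_real (wmatch a js T) * coeff (\<Prod>i\<in>I-T. [:y i, of_real (a i j):]) ?k =
        (of_real (wmatch a js T * (\<Prod>i\<in>I-T. a i j)) :: 'a)"
    proof (cases "card T = length js")
      case True
      have nz: "[:y i, of_real (a i j):] \<noteq> 0" "degree [:y i, of_real (a i j) :: 'a:] = 1" for i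
        using assms(2)[of i j] by auto
      have "degree (\<Prod>i\<in>I-T. [:y i, of_real (a i j) :: 'a:]) = (\<Sum>i\<in>I-T. 1)"
        by (subst degree_prod_sum_eq) (use nz in auto)
      also have "\<dots> = ?k" using T fT True assms(1) by (simp add: card_Diff_subset)
      finally have "coeff (\<Prod>i\<in>I-T. [:y i, of_real (a i j) :: 'a:]) ?k = lead_coeff (\<Prod>i\<in>I-T. [:y i, of_real (a i j):])"
        by simp
      also have "\<dots> = (\<Prod>i\<in>I-T. of_real (a i j))"
        unfolding lead_coeff_prod using assms(2) by (intro prod.cong) (auto simp: less_imp_neq[symmetric])
      finally show ?thesis by simp
    next
      case False
      have "wmatch a js T = 0" using fT False by (rule wmatch_eq_0)
      thus ?thesis by simp
    qed
  qed
  also have "\<dots> = of_real (\<Sum>T\<in>Pow I. wmatch a js T * (\<Prod>i\<in>I-T. a i j))" by simp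
  also have "\<dots> \<noteq> 0"
  proof -
    obtain T0 where T0: "T0 \<subseteq> I" "card T0 = length js"
      using assms(3) by (meson less_imp_le obtain_subset_with_card_n)
    have "0 < wmatch a js T0 * (\<Prod>i\<in>I-T0. a i j)"
      using assms T0 by (intro mult_pos_pos prod_pos wmatch_pos) (auto intro: finite_subset)
    also have "\<dots> \<le> (\<Sum>T\<in>Pow I. wmatch a js T * (\<Prod>i\<in>I-T. a i j))"
      using assms(1) T0 less_imp_le[OF assms(2)]
      by (intro member_le_sum mult_nonneg_nonneg wmatch_nonneg prod_nonneg) auto
    finally show ?thesis by (simp only: of_real_eq_0_iff)
  qed
  finally show ?thesis .
qed

text \<open>Differentiation preserves the absence of zeros in the right half-plane. Adding
  \<open>z\<close> times a positive column with \<open>Re z \<ge> 0\<close> keeps \<open>y\<close>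
  in the half-plane, so by induction all roots of \<open>mixed_poly\<close> have negative real part;
  \<open>gauss_lucas_at_0\<close> then shows that its linear coefficient, the next derivative, is
  not zero.\<close>

lemma mixed_nonzero:
  fixes y :: "'i \<Rightarrow> complex"
  assumes "finite I" "\<And>i j. a i j > 0" "length js \<le> card I" "\<And>i. i \<in> I \<Longrightarrow> Re (y i) > 0"
  shows "mixed a I js y \<noteq> 0"
  using assms(3,4)
proof (induction js arbitrary: y)
  case Nil
  thus ?case using assms(1) by (auto simp: mixed_Nil prod_zero_iff) (metis less_irrefl zero_complex.sel(1))
next
  case (Cons j js)
  let ?P = "mixed_poly a I js j y"
  have roots: "Re z < 0" if "poly ?P z = 0" for z
  proof (rule ccontr)
    assume z: "\<not> Re z < 0"
    have "mixed a I js (\<lambda>i. y i + z * of_real (a i j)) \<noteq> 0"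
      using Cons.prems z less_imp_le[OF assms(2)] by (intro Cons.IH) (auto intro!: add_pos_nonneg)
    thus False using that by (simp add: poly_mixed_poly)
  qed
  have top: "coeff ?P (card I - length js) \<noteq> 0"
    using coeff_top_mixed_poly[of I a js j y] assms(1,2) Cons.prems(1) by auto
  hence "?P \<noteq> 0" by auto
  moreover have "degree ?P > 0" using le_degree[OF top] Cons.prems by auto
  ultimately have "Re (coeff ?P 1 / coeff ?P 0) > 0" using gauss_lucas_at_0[OF _ roots] by blast
  hence "coeff ?P 1 \<noteq> 0" by auto
  thus ?case using coeff_1_mixed_poly[OF assms(1)] by metis
qed

lemma mixed_of_real: "mixed a I js (\<lambda>i. of_real (y i)) = of_real (mixed a I js y)"
  by (simp add: mixed_def)

text \<open>Homogeneity: it allows the right half-plane to be rotated, which excludes roots off the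
  real axis.\<close>

lemma mixed_smult:
  assumes "finite I"
  shows "mixed a I js (\<lambda>i. c * y i) = c ^ (card I - length js) * mixed a I js y"
proof -
  have "of_real (wmatch a js T) * (\<Prod>i\<in>I-T. c * y i) =
     c ^ (card I - length js) * (of_real (wmatch a js T) * (\<Prod>i\<in>I-T. y i))" if "T \<in> Pow I" for T
  proof (cases "card T = length js")
    case True
    have fT: "finite T" using that assms finite_subset by auto
    have "card (I - T) = card I - length js" using that fT True by (simp add: card_Diff_subset)
    thus ?thesis by (simp add: prod.distrib)
  next
    case False
    have fT: "finite T" using that assms finite_subset by auto
    show ?thesis using wmatch_eq_0[OF fT False] by simp
  qed
  thus ?thesis unfolding mixed_def sum_distrib_left by (rule sum.cong[OF refl])
qed

lemma mixed_pos:
  fixes y :: "'i \<Rightarrow> real"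
  assumes "finite I" "\<And>i j. a i j > 0" "\<And>i. i \<in> I \<Longrightarrow> y i > 0" "length js \<le> card I"
  shows "mixed a I js y > 0"
proof -
  have "mixed a I js y \<ge> 0"
    unfolding mixed_def using assms
    by (intro sum_nonneg mult_nonneg_nonneg prod_nonneg) (auto intro!: wmatch_nonneg simp: less_imp_le)
  moreover have "mixed a I js (\<lambda>i. complex_of_real (y i)) \<noteq> 0"
    using assms by (intro mixed_nonzero) auto
  hence "mixed a I js y \<noteq> 0" by (metis mixed_of_real of_real_eq_0_iff)
  ultimately show ?thesis by simp
qed

text \<open>Along column \<open>j\<close> the function is a polynomial with only negative real
  roots, so it grows at most exponentially, at a rate equal to its logarithmic derivative at 0. That
  derivative is the quotient of two consecutive mixed derivatives.\<close>

lemma mixed_exp_bound: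
  fixes y :: "'i \<Rightarrow> real"
  assumes "finite I" "\<And>i j. a i j > 0" "\<And>i. i \<in> I \<Longrightarrow> y i > 0" "length js < card I" "t \<ge> 0"
  shows "mixed a I js (\<lambda>i. y i + t * a i j) \<le> mixed a I js y * exp (t * mixed a I (j # js) y / mixed a I js y)"
proof -
  let ?y = "\<lambda>i. complex_of_real (y i)"
  let ?P = "mixed_poly a I js j ?y"
  have roots: "Im z = 0 \<and> Re z < 0" if z: "poly ?P z = 0" for z
  proof -
    have *: "mixed a I js (\<lambda>i. ?y i + z * of_real (a i j)) = 0" using z by (simp add: poly_mixed_poly)
    have eq: "mixed a I js (\<lambda>i. c * (?y i + z * of_real (a i j))) = 0" for c
      unfolding mixed_smult[OF assms(1)] * by (rule mult_zero_right)
    \<comment> \<open>The multiplier \<open>c\<close> rotates \<open>y + z * a\<close> into the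
      right half-plane: \<open>- \<i>\<close> if \<open>Im z > 0\<close>, \<open>\<i>\<close> if
      \<open>Im z < 0\<close>, and \<open>1\<close> if \<open>Re z \<ge> 0\<close>.\<close>
    have nz: False if "\<And>i. i \<in> I \<Longrightarrow> Re (c * (?y i + z * of_real (a i j))) > 0" for c
      using eq[of c] mixed_nonzero[of I a js "\<lambda>i. c * (?y i + z * of_real (a i j))", OF assms(1,2) less_imp_le[OF assms(4)] that]
      by blast
    have "\<not> Im z > 0"
    proof
      assume "Im z > 0"
      thus False using assms(2) by (intro nz[of "- \<i>"]) simp
    qed
    moreover have "\<not> Im z < 0"
    proof
      assume "Im z < 0"
      thus False using assms(2) by (intro nz[of "\<i>"]) (simp add: mult_neg_pos)
    qed
    moreover have "\<not> Re z \<ge> 0"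
    proof
      assume "Re z \<ge> 0"
      thus False using less_imp_le[OF assms(2)] assms(3) by (intro nz[of 1]) (simp add: add_pos_nonneg)
    qed
    ultimately show ?thesis by linarith
  qed
  have "?P \<noteq> 0" using coeff_top_mixed_poly[of I a js j ?y] assms by auto
  then obtain r where r: "coeff ?P 1 = coeff ?P 0 * of_real r"
     "\<forall>t\<ge>0. \<exists>s. 0 \<le> s \<and> s \<le> exp (r * t) \<and> poly ?P (of_real t) = coeff ?P 0 * of_real s"
    using real_rooted_exp_bound[OF _ roots] by blast
  obtain s where s: "s \<le> exp (r * t)" "poly ?P (of_real t) = coeff ?P 0 * of_real s" using r(2) assms by blast
  have p0: "mixed a I js y > 0" using assms by (intro mixed_pos) auto
  have c0: "coeff ?P 0 = of_real (mixed a I js y)" by (simp add: coeff_0_mixed_poly mixed_of_real)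
  have c1: "coeff ?P 1 = of_real (mixed a I (j # js) y)"
    using coeff_1_mixed_poly[OF assms(1)] mixed_of_real by metis
  have "mixed a I (j # js) y = mixed a I js y * r"
    using r(1) unfolding c0 c1 of_real_mult[symmetric] of_real_eq_iff .
  hence r': "r = mixed a I (j # js) y / mixed a I js y" using p0 by simp
  have "poly ?P (of_real t) = of_real (mixed a I js (\<lambda>i. y i + t * a i j))"
    unfolding poly_mixed_poly mixed_of_real[symmetric] by simp
  hence "mixed a I js (\<lambda>i. y i + t * a i j) = mixed a I js y * s"
    using s(2) unfolding c0 by (simp only: of_real_mult[symmetric] of_real_eq_iff)
  also have "\<dots> \<le> mixed a I js y * exp (r * t)" using s p0 by simp
  finally show ?thesis by (simp add: r' mult.commute)
qed

lemma mixed_full: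
  assumes "finite I" "length js = card I"
  shows "mixed a I js y = of_real (wmatch a js I)"
proof -
  have "mixed a I js y = (\<Sum>T\<in>Pow I. if T = I then of_real (wmatch a js I) else 0)"
    unfolding mixed_def
  proof (rule sum.cong[OF refl])
    fix T assume T: "T \<in> Pow I"
    show "of_real (wmatch a js T) * (\<Prod>i\<in>I-T. y i) = (if T = I then of_real (wmatch a js I) else 0)"
    proof (cases "T = I")
      case False
      have "finite T" "card T \<noteq> length js"
        using T False assms card_subset_eq[of I T] by (auto intro: finite_subset)
      hence "wmatch a js T = 0" by (rule wmatch_eq_0)
      thus ?thesis using False by simp
    qed auto
  qed
  also have "\<dots> = of_real (wmatch a js I)" using assms by (subst sum.delta) auto
  finally show ?thesis .
qed

text \<open>Gurvits' capacity argument: the lower bound by a multiple of \<open>\<Prod>x\<close> survives each differentiation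
  at the price of a factor \<open>exp (- 1)\<close>.\<close>

lemma mixed_capacity:
  fixes x :: "'j \<Rightarrow> real" and y :: "'i \<Rightarrow> real"
  assumes "finite I" "finite J" "card J = card I" "\<And>i j. a i j > 0"
    and rows: "\<And>i. i \<in> I \<Longrightarrow> (\<Sum>j\<in>J. a i j) = 1" and cols: "\<And>j. j \<in> J \<Longrightarrow> (\<Sum>i\<in>I. a i j) = 1"
    and "distinct js" "set js \<subseteq> J" "\<And>j. j \<in> J \<Longrightarrow> x j > 0" "\<And>i. i \<in> I \<Longrightarrow> y i > 0"
    and "\<And>i. i \<in> I \<Longrightarrow> (\<Sum>j\<in>J - set js. x j * a i j) \<le> y i"
  shows "exp (- real (length js)) * (\<Prod>j\<in>J - set js. x j) \<le> mixed a I js y"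
  using assms(7-)
proof (induction js arbitrary: x y)
  case Nil
  \<comment> \<open>Weighted AM-GM, that is Jensen's inequality for \<open>exp\<close>; the weights
    in row \<open>i\<close> sum to one.\<close>
  have amgm: "exp (\<Sum>j\<in>J. a i j * ln (x j)) \<le> (\<Sum>j\<in>J. x j * a i j)" if i: "i \<in> I" for i
  proof -
    have "exp (\<Sum>j\<in>J. a i j *\<^sub>R ln (x j)) \<le> (\<Sum>j\<in>J. a i j * exp (ln (x j)))"
      using i rows[OF i] assms(2) less_imp_le[OF assms(4)]
      by (intro convex_on_sum[of _ UNIV]) (auto intro: exp_convex)
    also have "\<dots> = (\<Sum>j\<in>J. x j * a i j)" using Nil by (intro sum.cong) auto
    finally show ?thesis by simp
  qed
  have le: "exp (\<Sum>j\<in>J. a i j * ln (x j)) \<le> y i" if "i \<in> I" for i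
    using amgm[OF that] Nil(5)[OF that] by simp
  have "(\<Prod>j\<in>J. x j) = exp (\<Sum>j\<in>J. ln (x j))" using Nil assms(2) by (simp add: exp_sum)
  \<comment> \<open>Here the column sums enter: over all rows, each \<open>x j\<close> collects
    total exponent one.\<close>
  also have "(\<Sum>j\<in>J. ln (x j)) = (\<Sum>j\<in>J. \<Sum>i\<in>I. a i j * ln (x j))"
    using cols by (simp add: sum_distrib_right[symmetric])
  also have "\<dots> = (\<Sum>i\<in>I. \<Sum>j\<in>J. a i j * ln (x j))" by (rule sum.swap)
  also have "exp \<dots> = (\<Prod>i\<in>I. exp (\<Sum>j\<in>J. a i j * ln (x j)))" using assms(1) by (simp add: exp_sum)
  also have "\<dots> \<le> (\<Prod>i\<in>I. y i)" using le by (intro prod_mono) simp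
  finally show ?case using assms(1) by (simp add: mixed_Nil)
next
  case (Cons j js)
  have "length (j # js) = card (set (j # js))" using Cons.prems distinct_card by metis
  also have "\<dots> \<le> card I" using Cons.prems assms(2,3) card_mono by metis
  finally have len: "length js < card I" by simp
  define P0 where "P0 = mixed a I js y"
  define P1 where "P1 = mixed a I (j # js) y"
  have pos: "P0 > 0" "P1 > 0" unfolding P0_def P1_def using assms(1,4) Cons.prems len by (auto intro!: mixed_pos)
  \<comment> \<open>The induction hypothesis is applied with column \<open>j\<close> put back at
    weight \<open>t\<close>. This gives \<open>P1 >= (P1 / P0) * t * exp (- t * P1 / P0)\<close>
    times the remaining quantity; the chosen \<open>t\<close> makes the exponent \<open>-1\<close>,
    which maximises the bound.\<close>
  define t where "t = P0 / P1"
  have t: "t > 0" using pos by (simp add: t_def)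
  let ?J = "J - set (j # js)"
  have J: "J - set js = insert j ?J" using Cons.prems by auto
  have "exp (- real (length js)) * (\<Prod>l\<in>J - set js. (x(j := t)) l) \<le> mixed a I js (\<lambda>i. y i + t * a i j)"
  proof (rule Cons.IH)
    show "(\<Sum>l\<in>J - set js. (x(j := t)) l * a i l) \<le> y i + t * a i j" if "i \<in> I" for i
    proof -
      have "(\<Sum>l\<in>J - set js. (x(j := t)) l * a i l) = t * a i j + (\<Sum>l\<in>?J. x l * a i l)"
        unfolding J using assms(2) by (subst sum.insert) (auto intro!: sum.cong)
      thus ?thesis using Cons.prems(5)[OF that] by simp
    qed
  qed (use Cons.prems t assms(4) in \<open>auto intro!: add_pos_pos\<close>)
  also have "(\<Prod>l\<in>J - set js. (x(j := t)) l) = t * (\<Prod>l\<in>?J. x l)"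
    unfolding J using assms(2) by (subst prod.insert) (auto intro!: prod.cong)
  also have "mixed a I js (\<lambda>i. y i + t * a i j) \<le> P0 * exp (t * P1 / P0)"
    unfolding P0_def P1_def using assms(1,4) Cons.prems len t by (intro mixed_exp_bound) auto
  also have "t * P1 / P0 = 1" using pos by (simp add: t_def)
  finally have "exp (- real (length js)) * exp (- 1) * (t * (\<Prod>l\<in>?J. x l)) \<le> P0"
    by (simp add: exp_minus field_simps)
  hence "exp (- real (length (j # js))) * (t * (\<Prod>l\<in>?J. x l)) \<le> P0"
    by (simp add: exp_add[symmetric] algebra_simps)
  hence "exp (- real (length (j # js))) * (\<Prod>l\<in>?J. x l) \<le> P1"
    using pos by (simp add: t_def field_simps del: list.set)
  thus ?case by (simp add: P1_def)
qed

text \<open>\<open>mixed_capacity\<close> with all variables used up, so that the product over the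
  remaining columns is empty. It needs positive entries; hence \<open>a\<close> is mixed with the
  constant matrix \<open>1 / n\<close>, which preserves all line sums, and the share
  \<open>\<eta>\<close> of the latter goes to zero.\<close>

lemma wmatch_doubly_stochastic:
  assumes "finite I" "distinct js" "length js = card I" "\<And>i j. a i j \<ge> 0"
    and rows: "\<And>i. i \<in> I \<Longrightarrow> (\<Sum>j\<in>set js. a i j) = 1"
    and cols: "\<And>j. j \<in> set js \<Longrightarrow> (\<Sum>i\<in>I. a i j) = 1"
  shows "exp (- real (card I)) \<le> wmatch a js I"
proof (cases "I = {}")
  case True thus ?thesis using assms by simp
next
  case False
  define n where "n = card I"
  have n: "n > 0" using False assms by (simp add: n_def card_gt_0_iff)
  have cs: "card (set js) = n" using assms distinct_card n_def by metis
  define b where "b = (\<lambda>\<eta> i j. (1 - \<eta>) * a i j + \<eta> / n)"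
  have lim: "((\<lambda>\<eta>. wmatch (b \<eta>) ks T) \<longlongrightarrow> wmatch a ks T) (at_right 0)" for ks T
  proof (induction ks arbitrary: T)
    case (Cons j ks)
    have "((\<lambda>\<eta>. b \<eta> i j) \<longlongrightarrow> (1 - 0) * a i j + 0 / n) (at_right 0)" for i
      unfolding b_def using n by (intro tendsto_intros) auto
    thus ?case using Cons by (auto intro!: tendsto_sum tendsto_mult)
  qed auto
  have "eventually (\<lambda>\<eta>::real. 0 < \<eta> \<and> \<eta> < 1) (at_right 0)"
    unfolding eventually_at_right_field by (intro exI[of _ 1]) auto
  hence "eventually (\<lambda>\<eta>. exp (- real n) \<le> wmatch (b \<eta>) js I) (at_right 0)"
  proof eventually_elim
    case (elim \<eta>)
    have "exp (- real (length js)) * (\<Prod>j\<in>set js - set js. 1) \<le> mixed (b \<eta>) I js (\<lambda>_. 1)"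
    proof (rule mixed_capacity)
      show "b \<eta> i j > 0" for i j
        using elim n assms(4)[of i j] by (auto simp: b_def intro!: add_nonneg_pos)
      show "(\<Sum>j\<in>set js. b \<eta> i j) = 1" if "i \<in> I" for i
        using rows[OF that] n cs by (simp add: b_def sum.distrib sum_distrib_left[symmetric])
      show "(\<Sum>i\<in>I. b \<eta> i j) = 1" if "j \<in> set js" for j
        using cols[OF that] n by (simp add: b_def sum.distrib sum_distrib_left[symmetric] n_def)
    qed (use assms cs n_def in auto)
    thus ?case using assms by (simp add: mixed_full n_def)
  qed
  hence "exp (- real n) \<le> wmatch a js I"
    by (intro tendsto_lowerbound[OF lim]) auto
  thus ?thesis by (simp add: n_def)
qed

lemma wmatch_eq_card:
  assumes "distinct js" "finite T"
  shows "wmatch (\<lambda>i j. if i \<in> A j then 1 / m else 0) js T =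
    real (card {f \<in> matchings (set js) A. f ` set js = T}) / m ^ length js"
  using assms
proof (induction js arbitrary: T)
  case Nil
  have "{f \<in> matchings (set []) A. f ` set [] = T} = (if T = {} then {\<lambda>_. undefined} else {})"
    by (auto simp: matchings_def)
  thus ?case by simp
next
  case (Cons j js)
  let ?S = "set js"
  define M where "M = (\<lambda>T. {g \<in> matchings ?S A. g ` ?S = T})"
  have finM: "finite (M T)" if "finite T" for T
  proof (rule finite_subset)
    show "M T \<subseteq> PiE ?S (\<lambda>_. T)" by (auto simp: M_def matchings_def)
    show "finite (PiE ?S (\<lambda>_. T))" using that by (intro finite_PiE) auto
  qed
  have j: "j \<notin> ?S" using Cons.prems by simp
  have "bij_betw (\<lambda>f. (f j, restrict f ?S)) {f \<in> matchings (set (j # js)) A. f ` set (j # js) = T}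
      (SIGMA i:T \<inter> A j. M (T - {i}))"
  proof (rule bij_betwI[where g = "\<lambda>(i, g). g(j := i)"])
    show "(\<lambda>f. (f j, restrict f ?S)) \<in> {f \<in> matchings (set (j # js)) A. f ` set (j # js) = T}
        \<rightarrow> (SIGMA i:T \<inter> A j. M (T - {i}))"
    proof
      fix f assume f: "f \<in> {f \<in> matchings (set (j # js)) A. f ` set (j # js) = T}"
      hence inj: "inj_on f (insert j ?S)" and im: "f ` insert j ?S = T" and fA: "\<And>l. l \<in> insert j ?S \<Longrightarrow> f l \<in> A l"
        by (auto simp: matchings_def)
      have "f ` ?S = T - {f j}" using inj im j by (auto simp: inj_on_def)
      moreover have "restrict f ?S \<in> matchings ?S A"
        using inj fA unfolding matchings_def by (auto simp: inj_on_def)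
      moreover have "restrict f ?S ` ?S = f ` ?S" by (rule image_cong) auto
      ultimately show "(f j, restrict f ?S) \<in> (SIGMA i:T \<inter> A j. M (T - {i}))"
        using im fA[of j] by (auto simp: M_def)
    qed
    show "(\<lambda>(i, g). g(j := i)) \<in> (SIGMA i:T \<inter> A j. M (T - {i})) \<rightarrow>
        {f \<in> matchings (set (j # js)) A. f ` set (j # js) = T}"
    proof
      fix z assume "z \<in> (SIGMA i:T \<inter> A j. M (T - {i}))"
      then obtain i g where z: "z = (i, g)" "i \<in> T" "i \<in> A j" "g \<in> M (T - {i})" by auto
      have gU: "(g(j := i)) ` ?S = T - {i}" using z j by (auto simp: M_def)
      have "inj_on (g(j := i)) ?S" using z j
        by (auto simp: M_def matchings_def inj_on_def)
      hence "inj_on (g(j := i)) (insert j ?S)" using gU j by (simp add: inj_on_insert)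
      moreover have "g(j := i) \<in> PiE (insert j ?S) A" using z by (auto simp: M_def matchings_def PiE_def extensional_def)
      moreover have "(g(j := i)) ` insert j ?S = T" using gU z by auto
      ultimately show "(case z of (i, g) \<Rightarrow> g(j := i)) \<in> {f \<in> matchings (set (j # js)) A. f ` set (j # js) = T}"
        unfolding z(1) matchings_def list.set prod.case by blast
    qed
    show "(case (f j, restrict f ?S) of (i, g) \<Rightarrow> g(j := i)) = f"
      if "f \<in> {f \<in> matchings (set (j # js)) A. f ` set (j # js) = T}" for f
    proof
      fix l
      have "f \<in> PiE (insert j ?S) A" using that by (simp add: matchings_def)
      hence "l \<notin> insert j ?S \<Longrightarrow> f l = undefined" by (rule PiE_arb)
      thus "(case (f j, restrict f ?S) of (i, g) \<Rightarrow> g(j := i)) l = f l" by auto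
    qed
    show "((case z of (i, g) \<Rightarrow> g(j := i)) j, restrict (case z of (i, g) \<Rightarrow> g(j := i)) ?S) = z"
      if zM: "z \<in> (SIGMA i:T \<inter> A j. M (T - {i}))" for z
    proof -
      obtain i g where z: "z = (i, g)" "g \<in> PiE ?S A" using zM by (auto simp: M_def matchings_def)
      have "restrict (g(j := i)) ?S = restrict g ?S" using j by (auto simp: restrict_def)
      also have "\<dots> = g" using z(2) by (rule PiE_restrict)
      finally show ?thesis by (simp add: z(1))
    qed
  qed
  hence "card {f \<in> matchings (set (j # js)) A. f ` set (j # js) = T} = (\<Sum>i\<in>T \<inter> A j. card (M (T - {i})))"
    using Cons.prems finM by (simp add: bij_betw_same_card)
  moreover have "wmatch (\<lambda>i j. if i \<in> A j then 1 / m else 0) (j # js) T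
      = (\<Sum>i\<in>T \<inter> A j. 1 / m * wmatch (\<lambda>i j. if i \<in> A j then 1 / m else 0) js (T - {i}))"
    unfolding wmatch.simps sum.inter_restrict[OF Cons.prems(2)] by (intro sum.cong refl) simp
  moreover have "\<dots> = (\<Sum>i\<in>T \<inter> A j. 1 / m * (card (M (T - {i})) / m ^ length js))"
    using Cons by (intro sum.cong refl arg_cong[where f = "\<lambda>x. 1 / m * x"]) (auto simp: M_def)
  ultimately show ?case by (simp add: sum_divide_distrib[symmetric])
qed

text \<open>The adjacency matrix divided by \<open>m\<close> is doubly stochastic, and its permanent
  is the number of matchings divided by \<open>m ^ card C\<close>.\<close>

lemma regular_matchings_lower:
  assumes "finite C" "finite S" "card S = card C" "m > 0"
    and A: "\<And>c. c \<in> C \<Longrightarrow> A c \<subseteq> S" "\<And>c. c \<in> C \<Longrightarrow> card (A c) = m"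
    and deg: "\<And>s. s \<in> S \<Longrightarrow> card {c \<in> C. s \<in> A c} = m"
  shows "exp (card C * (ln m - 1)) \<le> card (matchings C A)"
proof -
  obtain js where js: "distinct js" "set js = C" using finite_distinct_list[OF assms(1)] by blast
  have len: "length js = card C" using js distinct_card by metis
  let ?a = "\<lambda>i j. if i \<in> A j then 1 / real m else 0"
  have "exp (- real (card S)) \<le> wmatch ?a js S"
  proof (rule wmatch_doubly_stochastic)
    show "(\<Sum>j\<in>set js. ?a i j) = 1" if "i \<in> S" for i
      using deg[OF that] assms(1,4) js by (simp add: sum.If_cases Int_def)
    show "(\<Sum>i\<in>S. ?a i j) = 1" if "j \<in> set js" for j
      using A[of j] that assms(2,4) js by (simp add: sum.If_cases Int_absorb1)
  qed (use assms js len in auto)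
  also have "\<dots> = real (card {f \<in> matchings C A. f ` C = S}) / m ^ card C"
    using wmatch_eq_card[OF js(1) assms(2), of A m] js len by simp
  also have "{f \<in> matchings C A. f ` C = S} = matchings C A"
  proof -
    have "f ` C = S" if "f \<in> matchings C A" for f
      using that A assms(1-3) by (intro card_subset_eq) (auto simp: matchings_def card_image)
    thus ?thesis by auto
  qed
  finally have "exp (- real (card C)) * m ^ card C \<le> card (matchings C A)"
    using assms(3,4) by (simp add: field_simps)
  moreover have "exp (card C * (ln m - 1)) = exp (- real (card C)) * m ^ card C"
    using assms(4) by (simp add: algebra_simps exp_diff exp_minus field_simps exp_of_nat_mult)
  ultimately show ?thesis by simp
qed

section \<open>Latin rectangles\<close>

text \<open>Stirling in the form \<open>r! <= e * r * (r / e) ^ r\<close>. In Bregman's exponent the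
  part \<open>ln r - 1\<close> is the main term shared with the lower bound; the rest is
  error.\<close>

lemma ln_fact_le:
  assumes "r > 0"
  shows "ln (fact r) / real r \<le> ln r - 1 + (ln r + 1) / r"
proof -
  have "ln (fact r) \<le> r * ln r - r + ln r + 1" if "r > 0" for r :: nat
    using that
  proof (induction r)
    case (Suc r)
    show ?case
    proof (cases "r = 0")
      case False
      have "ln (real r / real (Suc r)) \<le> real r / real (Suc r) - 1"
        using False by (intro ln_le_minus_one) auto
      hence "ln r - ln (Suc r) \<le> - 1 / real (Suc r)"
        using False by (simp add: ln_div field_simps)
      hence "real (Suc r) * (ln r - ln (Suc r)) \<le> real (Suc r) * (- 1 / real (Suc r))"
        by (intro mult_left_mono) auto
      hence "real (Suc r) * (ln r - ln (Suc r)) \<le> -1" by simp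
      moreover have "ln (fact (Suc r)) = ln (Suc r) + ln (fact r :: real)"
        using ln_mult[of "real (Suc r)" "fact r"] by simp
      ultimately show ?thesis using Suc.IH False by (simp add: algebra_simps)
    qed auto
  qed auto
  from this[OF assms] have "ln (fact r) / real r \<le> (r * ln r - r + ln r + 1) / r"
    using assms by (intro divide_right_mono) auto
  also have "\<dots> = ln r - 1 + (ln r + 1) / r" using assms by (simp add: field_simps)
  finally show ?thesis .
qed

text \<open>Bregman's bound for the free columns, whose sets have lost the symbols used on
  \<open>D\<close>, linearised by \<open>ln r <= ln m + (r - m) / m\<close>. With
  \<open>d = card D\<close>, the \<open>d\<close> fixed columns save \<open>d * (ln m - 1)\<close>
  and the lost symbols save at least \<open>d * (m - d) / m\<close>; together this is
  \<open>d * (ln m - d / m)\<close>, so each fixed cell costs almost a full factor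
  \<open>m\<close>.\<close>

lemma restricted_matchings_upper:
  fixes A :: "'c \<Rightarrow> 's set"
  assumes "finite C" "finite S" "card S = card C" "m > 0"
    and A: "\<And>c. c \<in> C \<Longrightarrow> A c \<subseteq> S" "\<And>c. c \<in> C \<Longrightarrow> card (A c) = m"
    and deg: "\<And>s. s \<in> S \<Longrightarrow> card {c \<in> C. s \<in> A c} = m"
    and D: "D \<subseteq> C" "inj_on h D" "h ` D \<subseteq> S" "2 * card D \<le> m"
  shows "card {f \<in> matchings C A. \<forall>c\<in>D. f c = h c}
    \<le> exp (card C * (ln m - 1) - card D * (ln m - card D / m) + 2 * card C * (ln (card C) + 1) / m)"
proof (cases "C = {}")
  case True
  hence "D = {}" using D(1) by blast
  thus ?thesis using True by (simp add: matchings_def)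
next
  case False
  define n d where "n = card C" and "d = card D"
  define B where "B = (\<lambda>c. A c - h ` D)"
  \<comment> \<open>The Stirling error \<open>(ln r + 1) / r\<close> of one column, using
    \<open>m / 2 <= r <= m <= n\<close>.\<close>
  define \<epsilon> where "\<epsilon> = 2 * (ln n + 1) / m"
  obtain c0 where c0: "c0 \<in> C" using False by blast
  have mn: "m \<le> n" using A[OF c0] assms(2,3) card_mono[of S "A c0"] by (simp add: n_def)
  have finA: "finite (A c)" if "c \<in> C" for c using A(1)[OF that] assms(2) finite_subset by blast
  have finD: "finite D" by (rule finite_subset[OF D(1) assms(1)])
  have hD: "card (h ` D) = d" using D by (simp add: card_image d_def)
  have dn: "d \<le> n" using D assms by (simp add: n_def d_def card_mono)
  have "card {f \<in> matchings C A. \<forall>c\<in>D. f c = h c} \<le> card (matchings (C - D) B)"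
  proof (rule card_inj_on_le[where f = "\<lambda>f. restrict f (C - D)"])
    show "inj_on (\<lambda>f. restrict f (C - D)) {f \<in> matchings C A. \<forall>c\<in>D. f c = h c}"
    proof (rule inj_onI)
      fix f g assume f: "f \<in> {f \<in> matchings C A. \<forall>c\<in>D. f c = h c}"
        and g: "g \<in> {f \<in> matchings C A. \<forall>c\<in>D. f c = h c}"
        and eq: "restrict f (C - D) = restrict g (C - D)"
      show "f = g"
      proof (rule PiE_ext)
        show "f \<in> PiE C A" "g \<in> PiE C A" using f g by (auto simp: matchings_def)
        show "f c = g c" if "c \<in> C" for c
          using that f g fun_cong[OF eq, of c] by (cases "c \<in> D") auto
      qed
    qed
    show "(\<lambda>f. restrict f (C - D)) ` {f \<in> matchings C A. \<forall>c\<in>D. f c = h c} \<subseteq> matchings (C - D) B"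
    proof
      fix g assume "g \<in> (\<lambda>f. restrict f (C - D)) ` {f \<in> matchings C A. \<forall>c\<in>D. f c = h c}"
      then obtain f where f: "f \<in> PiE C A" "inj_on f C" "\<And>c. c \<in> D \<Longrightarrow> f c = h c" "g = restrict f (C - D)"
        by (auto simp: matchings_def)
      have "f c \<notin> h ` D" if "c \<in> C - D" for c
      proof
        assume "f c \<in> h ` D"
        then obtain c' where "c' \<in> D" "f c = f c'" using f(3) by auto
        thus False using f(2) D(1) that by (auto dest!: inj_onD)
      qed
      hence "g \<in> PiE (C - D) B" using f by (auto simp: B_def)
      moreover have "inj_on g (C - D)" using f(2,4) by (auto simp: inj_on_def)
      ultimately show "g \<in> matchings (C - D) B" by (simp add: matchings_def)
    qed
    show "finite (matchings (C - D) B)" using finA assms(1) by (intro finite_matchings) (auto simp: B_def)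
  qed
  also have "real \<dots> \<le> exp (\<Sum>c\<in>C - D. ln (fact (card (B c))) / card (B c))"
  proof (rule bregman)
    show "card (S - h ` D) = card (C - D)"
      using hD D assms finD by (simp add: card_Diff_subset d_def)
  qed (use assms in \<open>auto simp: B_def\<close>)
  also have "(\<Sum>c\<in>C - D. ln (fact (card (B c))) / card (B c))
     \<le> (\<Sum>c\<in>C - D. ln m - 1 + (real (card (B c)) - m) / m + \<epsilon>)"
  proof (rule sum_mono)
    fix c assume c: "c \<in> C - D"
    define r where "r = card (B c)"
    have "r \<ge> m - d" using diff_card_le_card_Diff[of "h ` D" "A c"] finD hD A(2) c by (simp add: r_def B_def)
    hence r: "2 * r \<ge> m" "r > 0" using D(4) assms(4) by (auto simp: d_def)
    have rm: "r \<le> m" using A(2)[of c] finA[of c] c card_mono[of "A c" "B c"] by (simp add: r_def B_def)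
    have "ln (fact r) / r \<le> ln r - 1 + (ln r + 1) / r" by (rule ln_fact_le[OF r(2)])
    also have "(ln r + 1) / r \<le> (ln n + 1) / (real m / 2)"
      using r rm mn assms(4) by (intro frac_le add_mono) auto
    also have "\<dots> = \<epsilon>" by (simp add: \<epsilon>_def)
    also have "ln r = ln m + ln (r / m)" using r assms(4) by (simp add: ln_div)
    also have "ln (real r / m) \<le> real r / m - 1" using r assms(4) by (intro ln_le_minus_one) auto
    also have "real r / m - 1 = (real r - m) / m" using assms(4) by (simp add: field_simps)
    finally show "ln (fact (card (B c))) / card (B c) \<le> ln m - 1 + (real (card (B c)) - m) / m + \<epsilon>"
      by (simp add: r_def)
  qed
  also have "\<dots> = (\<Sum>c\<in>C - D. (ln m - 1 + \<epsilon>) - (real m - card (B c)) / m)"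
    by (intro sum.cong refl) (simp add: diff_divide_distrib)
  also have "\<dots> = card (C - D) * (ln m - 1 + \<epsilon>) - (\<Sum>c\<in>C - D. real m - card (B c)) / m"
    unfolding sum_subtractf[of "\<lambda>_. ln m - 1 + \<epsilon>"] sum_divide_distrib by simp
  also have "card (C - D) = n - d" using D finD by (simp add: card_Diff_subset n_def d_def)
  also have "real (n - d) * (ln m - 1 + \<epsilon>) - (\<Sum>c\<in>C - D. real m - card (B c)) / m
      = (n - d) * (ln m - 1) - (\<Sum>c\<in>C - D. real m - card (B c)) / m + (n - d) * \<epsilon>"
    by (simp add: algebra_simps)
  also have "\<dots> \<le> (n - d) * (ln m - 1) - d * (real m - d) / m + n * \<epsilon>"
  proof -
    \<comment> \<open>Double counting of the lost symbols: each of the \<open>d\<close> symbols used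
      on \<open>D\<close> lies in \<open>m\<close> of the sets \<open>A c\<close>, and at most
      \<open>d\<close> of these belong to columns in \<open>D\<close>.\<close>
    have "(\<Sum>c\<in>C - D. real m - card (B c)) = (\<Sum>c\<in>C - D. real (card (A c \<inter> h ` D)))"
    proof (rule sum.cong[OF refl])
      fix c assume c: "c \<in> C - D"
      have "card (B c) + card (A c \<inter> h ` D) = m"
        using card_Int_Diff[of "A c" "h ` D"] finA[of c] c A(2)[of c] by (simp add: B_def)
      thus "real m - card (B c) = card (A c \<inter> h ` D)" by simp
    qed
    also have "\<dots> = (\<Sum>c\<in>C - D. \<Sum>s\<in>h ` D. if s \<in> A c then 1 else 0)"
      using finD by (intro sum.cong refl) (simp add: sum.If_cases Int_commute Int_def)
    also have "\<dots> = (\<Sum>s\<in>h ` D. \<Sum>c\<in>C - D. if s \<in> A c then 1 else 0)" by (rule sum.swap)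
    also have "\<dots> \<ge> (\<Sum>s\<in>h ` D. real m - d)"
    proof (rule sum_mono)
      fix s assume s: "s \<in> h ` D"
      have "m - d \<le> card ({c \<in> C. s \<in> A c} - D)"
        using diff_card_le_card_Diff[of D "{c \<in> C. s \<in> A c}"] deg[of s] s D finD by (auto simp: d_def)
      also have "{c \<in> C. s \<in> A c} - D = (C - D) \<inter> {c. s \<in> A c}" by auto
      also have "real (card \<dots>) = (\<Sum>c\<in>C - D. if s \<in> A c then 1 else 0)"
        using assms(1) by (simp add: sum.If_cases)
      finally show "real m - d \<le> (\<Sum>c\<in>C - D. if s \<in> A c then 1 else 0)" by linarith
    qed
    finally have "d * (real m - d) \<le> (\<Sum>c\<in>C - D. real m - card (B c))" by (simp add: hD)
    hence "d * (real m - d) / m \<le> (\<Sum>c\<in>C - D. real m - card (B c)) / m"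
      using assms(4) by (intro divide_right_mono) auto
    moreover have "(n - d) * \<epsilon> \<le> n * \<epsilon>"
      using assms(4) mn by (intro mult_right_mono) (auto simp: \<epsilon>_def)
    ultimately show ?thesis by linarith
  qed
  also have "\<dots> = n * (ln m - 1) - d * (ln m - d / m) + 2 * n * (ln n + 1) / m"
    using assms(4) dn by (simp add: field_simps \<epsilon>_def of_nat_diff)
  finally show ?thesis by (simp add: n_def d_def)
qed

text \<open>Latin rectangles with an arbitrary set \<open>X\<close> of rows, so that the rows can be
  filled in any order; this is used to fill the rows of a corner before all others.\<close>

definition rectangles :: "nat \<Rightarrow> nat set \<Rightarrow> (nat \<times> nat \<Rightarrow> nat) set" where
  "rectangles n X = {R \<in> X \<times> {1..n} \<rightarrow>\<^sub>E {1..n}.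
     (\<forall>r\<in>X. inj_on (\<lambda>c. R (r, c)) {1..n}) \<and> (\<forall>c\<in>{1..n}. inj_on (\<lambda>r. R (r, c)) X)}"

lemma latin_squares_eq_rectangles: "latin_squares n = rectangles n {1..n}"
proof (intro set_eqI iffI)
  fix L assume L: "L \<in> latin_squares n"
  note L' = L[unfolded latin_squares_def mem_Collect_eq]
  note PiE = conjunct1[OF L'] and rowsL = conjunct1[OF conjunct2[OF L']] and colsL = conjunct2[OF conjunct2[OF L']]
  have rng: "L (r, c) \<in> {1..n}" if "r \<in> {1..n}" "c \<in> {1..n}" for r c by (rule PiE_mem[OF PiE SigmaI[OF that]])
  have "inj_on (\<lambda>c. L (r, c)) {1..n}" if "r \<in> {1..n}" for r
  proof (rule inj_onI)
    fix c c' assume c: "c \<in> {1..n}" "c' \<in> {1..n}" "L (r, c) = L (r, c')"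
    have "\<exists>!c. c \<in> {1..n} \<and> L (r, c) = L (r, c')"
      using rowsL that rng[OF that c(2)] by blast
    thus "c = c'" using c by (metis (no_types))
  qed
  moreover have "inj_on (\<lambda>r. L (r, c)) {1..n}" if "c \<in> {1..n}" for c
  proof (rule inj_onI)
    fix r r' assume r: "r \<in> {1..n}" "r' \<in> {1..n}" "L (r, c) = L (r', c)"
    have "\<exists>!r. r \<in> {1..n} \<and> L (r, c) = L (r', c)"
      using colsL that rng[OF r(2) that] by blast
    thus "r = r'" using r by (metis (no_types))
  qed
  ultimately show "L \<in> rectangles n {1..n}" using PiE by (simp add: rectangles_def)
next
  fix L assume L: "L \<in> rectangles n {1..n}"
  hence PiE: "L \<in> {1..n} \<times> {1..n} \<rightarrow>\<^sub>E {1..n}" by (simp add: rectangles_def)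
  have rng: "L (r, c) \<in> {1..n}" if "r \<in> {1..n}" "c \<in> {1..n}" for r c by (rule PiE_mem[OF PiE SigmaI[OF that]])
  have "\<exists>!c. c \<in> {1..n} \<and> L (r, c) = s" if rs: "r \<in> {1..n}" "s \<in> {1..n}" for r s
  proof -
    have inj: "inj_on (\<lambda>c. L (r, c)) {1..n}" using L rs by (simp add: rectangles_def)
    have "(\<lambda>c. L (r, c)) ` {1..n} = {1..n}" by (rule endo_inj_surj[OF finite_atLeastAtMost image_subsetI[OF rng[OF rs(1)]] inj])
    hence "s \<in> (\<lambda>c. L (r, c)) ` {1..n}" using rs by simp
    then obtain c where "c \<in> {1..n}" "L (r, c) = s" by blast
    thus ?thesis using inj by (intro ex1I[of _ c]) (auto dest: inj_onD)
  qed
  moreover have "\<exists>!r. r \<in> {1..n} \<and> L (r, c) = s" if cs: "c \<in> {1..n}" "s \<in> {1..n}" for c s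
  proof -
    have inj: "inj_on (\<lambda>r. L (r, c)) {1..n}" using L cs by (simp add: rectangles_def)
    have "(\<lambda>r. L (r, c)) ` {1..n} = {1..n}" by (rule endo_inj_surj[OF finite_atLeastAtMost image_subsetI[OF rng[OF _ cs(1)]] inj])
    hence "s \<in> (\<lambda>r. L (r, c)) ` {1..n}" using cs by simp
    then obtain r where "r \<in> {1..n}" "L (r, c) = s" by blast
    thus ?thesis using inj by (intro ex1I[of _ r]) (auto dest: inj_onD)
  qed
  ultimately show "L \<in> latin_squares n" using PiE by (simp add: latin_squares_def)
qed

lemma finite_rectangles: "finite X \<Longrightarrow> finite (rectangles n X)"
  unfolding rectangles_def by (rule finite_subset[of _ "X \<times> {1..n} \<rightarrow>\<^sub>E {1..n}"]) (auto intro!: finite_PiE)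

section \<open>Extending Latin rectangles row by row\<close>

definition available :: "nat \<Rightarrow> nat set \<Rightarrow> (nat \<times> nat \<Rightarrow> nat) \<Rightarrow> nat \<Rightarrow> nat set" where
  "available n X R c = {1..n} - (\<lambda>r. R (r, c)) ` X"

lemma card_available:
  assumes "R \<in> rectangles n X" "finite X" "c \<in> {1..n}"
  shows "card (available n X R c) = n - card X"
proof -
  have "(\<lambda>r. R (r, c)) ` X \<subseteq> {1..n}" using assms by (auto simp: rectangles_def PiE_def Pi_def)
  moreover have "card ((\<lambda>r. R (r, c)) ` X) = card X"
    using assms by (intro card_image) (simp add: rectangles_def)
  ultimately show ?thesis using assms(2) by (simp add: available_def card_Diff_subset)
qed

text \<open>The cells \<open>T\<close> containing \<open>s\<close> project bijectively to the rows
  \<open>X\<close> and injectively to the columns, so \<open>s\<close> is used up in exactly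
  \<open>card X\<close> columns. Together with \<open>card_available\<close> this makes the
  extension graph regular.\<close>

lemma card_available_columns:
  assumes R: "R \<in> rectangles n X" and X: "finite X" and s: "s \<in> {1..n}"
  shows "card {c \<in> {1..n}. s \<in> available n X R c} = n - card X"
proof -
  define T where "T = {z \<in> X \<times> {1..n}. R z = s}"
  have rng: "R (r, c) \<in> {1..n}" if "r \<in> X" "c \<in> {1..n}" for r c
    using R that by (auto simp: rectangles_def)
  have injr: "inj_on (\<lambda>c. R (r, c)) {1..n}" if "r \<in> X" for r using R that by (simp add: rectangles_def)
  have injc: "inj_on (\<lambda>r. R (r, c)) X" if "c \<in> {1..n}" for c using R that by (simp add: rectangles_def)
  have "fst ` T = X"
  proof
    show "X \<subseteq> fst ` T"
    proof
      fix r assume r: "r \<in> X"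
      have "(\<lambda>c. R (r, c)) ` {1..n} = {1..n}" by (rule endo_inj_surj[OF finite_atLeastAtMost image_subsetI[OF rng[OF r]] injr[OF r]])
      hence "s \<in> (\<lambda>c. R (r, c)) ` {1..n}" using s by simp
      then obtain c where "c \<in> {1..n}" "R (r, c) = s" by blast
      hence "(r, c) \<in> T" using r by (simp add: T_def)
      thus "r \<in> fst ` T" by force
    qed
  qed (auto simp: T_def)
  moreover have "inj_on fst T"
  proof (rule inj_onI)
    fix z w assume "z \<in> T" "w \<in> T" "fst z = fst w"
    thus "z = w" using inj_onD[OF injr[of "fst z"], of "snd z" "snd w"]
      by (cases z; cases w) (simp add: T_def)
  qed
  moreover have "inj_on snd T"
  proof (rule inj_onI)
    fix z w assume "z \<in> T" "w \<in> T" "snd z = snd w"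
    thus "z = w" using inj_onD[OF injc[of "snd z"], of "fst z" "fst w"]
      by (cases z; cases w) (simp add: T_def)
  qed
  ultimately have "card (snd ` T) = card X" using card_image[of fst T] card_image[of snd T] by simp
  moreover have "{c \<in> {1..n}. s \<in> available n X R c} = {1..n} - snd ` T"
  proof (intro set_eqI iffI)
    fix c assume "c \<in> {c \<in> {1..n}. s \<in> available n X R c}"
    thus "c \<in> {1..n} - snd ` T" by (auto simp: available_def T_def)
  next
    fix c assume c: "c \<in> {1..n} - snd ` T"
    have "s \<noteq> R (r, c)" if "r \<in> X" for r
    proof
      assume "s = R (r, c)"
      hence "(r, c) \<in> T" using that c by (simp add: T_def)
      thus False using c by force
    qed
    thus "c \<in> {c \<in> {1..n}. s \<in> available n X R c}" using c s by (auto simp: available_def)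
  qed
  moreover have "snd ` T \<subseteq> {1..n}" by (auto simp: T_def)
  moreover have "finite (snd ` T)" using X by (auto simp: T_def)
  ultimately show ?thesis by (simp add: card_Diff_subset)
qed

definition rectangles_agreeing ::
  "nat \<Rightarrow> nat set \<Rightarrow> (nat \<times> nat) set \<Rightarrow> (nat \<times> nat \<Rightarrow> nat) \<Rightarrow> (nat \<times> nat \<Rightarrow> nat) set" where
  "rectangles_agreeing n X P L0 = {R \<in> rectangles n X. \<forall>p\<in>P \<inter> X \<times> {1..n}. R p = L0 p}"

text \<open>A new row is a perfect matching from columns to available symbols. Both counts use this
  recursion, the lower bound with \<open>P = {}\<close>.\<close>

lemma card_rectangles_insert:
  assumes "finite X" "a \<notin> X"
  shows "card (rectangles_agreeing n (insert a X) P L0) = (\<Sum>R\<in>rectangles_agreeing n X P L0.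
     card {f \<in> matchings {1..n} (available n X R). \<forall>c\<in>{c \<in> {1..n}. (a, c) \<in> P}. f c = L0 (a, c)})"
proof -
  let ?N = "{1..n}"
  let ?M = "\<lambda>R. {f \<in> matchings ?N (available n X R). \<forall>c\<in>{c \<in> ?N. (a, c) \<in> P}. f c = L0 (a, c)}"
  have "bij_betw (\<lambda>R. (restrict R (X \<times> ?N), \<lambda>c\<in>?N. R (a, c))) (rectangles_agreeing n (insert a X) P L0)
     (SIGMA R:rectangles_agreeing n X P L0. ?M R)"
  proof (rule bij_betwI[where g = "\<lambda>(R, f). \<lambda>(r, c). if r = a then f c else R (r, c)"])
    show "(\<lambda>R. (restrict R (X \<times> ?N), \<lambda>c\<in>?N. R (a, c))) \<in> rectangles_agreeing n (insert a X) P L0 \<rightarrow>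
      (SIGMA R:rectangles_agreeing n X P L0. ?M R)"
    proof
      fix R assume "R \<in> rectangles_agreeing n (insert a X) P L0"
      hence Rn: "R \<in> insert a X \<times> ?N \<rightarrow>\<^sub>E ?N"
        and injr: "\<And>r. r \<in> insert a X \<Longrightarrow> inj_on (\<lambda>c. R (r, c)) ?N"
        and injc: "\<And>c. c \<in> ?N \<Longrightarrow> inj_on (\<lambda>r. R (r, c)) (insert a X)"
        and P: "\<And>r c. (r, c) \<in> P \<Longrightarrow> r \<in> insert a X \<Longrightarrow> c \<in> ?N \<Longrightarrow> R (r, c) = L0 (r, c)"
        unfolding rectangles_agreeing_def rectangles_def by blast+
      have rng: "R (r, c) \<in> ?N" if "r \<in> insert a X" "c \<in> ?N" for r c
        by (rule PiE_mem[OF Rn SigmaI[OF that]])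
      have "restrict R (X \<times> ?N) \<in> X \<times> ?N \<rightarrow>\<^sub>E ?N"
      proof (rule PiE_I)
        fix p assume "p \<in> X \<times> ?N"
        then obtain r c where "p = (r, c)" "r \<in> X" "c \<in> ?N" by blast
        thus "restrict R (X \<times> ?N) p \<in> ?N" using rng[of r c] by (simp del: atLeastAtMost_iff)
      qed (simp del: atLeastAtMost_iff)
      moreover have "inj_on (\<lambda>c. restrict R (X \<times> ?N) (r, c)) ?N" if "r \<in> X" for r
        using injr[of r] that by (subst inj_on_cong[where g = "\<lambda>c. R (r, c)"]) (simp_all del: atLeastAtMost_iff)
      moreover have "inj_on (\<lambda>r. restrict R (X \<times> ?N) (r, c)) X" if "c \<in> ?N" for c
        using inj_on_subset[OF injc[OF that] subset_insertI] that
        by (subst inj_on_cong[where g = "\<lambda>r. R (r, c)"]) (simp_all del: atLeastAtMost_iff)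
      moreover have "\<forall>p\<in>P \<inter> X \<times> ?N. restrict R (X \<times> ?N) p = L0 p"
      proof
        fix p assume "p \<in> P \<inter> X \<times> ?N"
        then obtain r c where "p = (r, c)" "(r, c) \<in> P" "r \<in> X" "c \<in> ?N" by blast
        thus "restrict R (X \<times> ?N) p = L0 p" using P[of r c] by (simp del: atLeastAtMost_iff)
      qed
      ultimately have 1: "restrict R (X \<times> ?N) \<in> rectangles_agreeing n X P L0"
        unfolding rectangles_agreeing_def rectangles_def by blast
      have "R (a, c) \<in> available n X (restrict R (X \<times> ?N)) c" if c: "c \<in> ?N" for c
      proof -
        have "R (a, c) \<noteq> R (r, c)" if "r \<in> X" for r
          using inj_onD[OF injc[OF c], of a r] that assms(2) by auto
        thus ?thesis using rng[OF insertI1 c] c unfolding available_def by (auto simp del: atLeastAtMost_iff)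
      qed
      hence "(\<lambda>c\<in>?N. R (a, c)) \<in> PiE ?N (available n X (restrict R (X \<times> ?N)))"
        by (intro restrict_PiE_iff[THEN iffD2] ballI)
      moreover have "inj_on (\<lambda>c\<in>?N. R (a, c)) ?N"
        using injr[OF insertI1] by (subst inj_on_cong[where g = "\<lambda>c. R (a, c)"]) (simp_all del: atLeastAtMost_iff)
      moreover have "\<forall>c\<in>{c \<in> ?N. (a, c) \<in> P}. (\<lambda>c\<in>?N. R (a, c)) c = L0 (a, c)"
        using P[of a] by (simp del: atLeastAtMost_iff)
      ultimately have 2: "(\<lambda>c\<in>?N. R (a, c)) \<in> ?M (restrict R (X \<times> ?N))"
        unfolding matchings_def by blast
      show "(restrict R (X \<times> ?N), \<lambda>c\<in>?N. R (a, c)) \<in> (SIGMA R:rectangles_agreeing n X P L0. ?M R)"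
        using 1 2 by blast
    qed
    show "(\<lambda>(R, f). \<lambda>(r, c). if r = a then f c else R (r, c)) \<in>
        (SIGMA R:rectangles_agreeing n X P L0. ?M R) \<rightarrow> rectangles_agreeing n (insert a X) P L0"
    proof
      fix z assume "z \<in> (SIGMA R:rectangles_agreeing n X P L0. ?M R)"
      then obtain R f where z: "z = (R, f)" and R: "R \<in> rectangles_agreeing n X P L0" and f: "f \<in> ?M R" by blast
      have Rn: "R \<in> X \<times> ?N \<rightarrow>\<^sub>E ?N" and injr: "\<And>r. r \<in> X \<Longrightarrow> inj_on (\<lambda>c. R (r, c)) ?N"
        and injc: "\<And>c. c \<in> ?N \<Longrightarrow> inj_on (\<lambda>r. R (r, c)) X"
        and RP: "\<And>r c. (r, c) \<in> P \<Longrightarrow> r \<in> X \<Longrightarrow> c \<in> ?N \<Longrightarrow> R (r, c) = L0 (r, c)"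
        using R by (auto simp: rectangles_agreeing_def rectangles_def)
      have fe: "f \<in> PiE ?N (available n X R)" and finj: "inj_on f ?N"
        and fP: "\<And>c. (a, c) \<in> P \<Longrightarrow> c \<in> ?N \<Longrightarrow> f c = L0 (a, c)"
        using f by (auto simp: matchings_def)
      have fav: "f c \<in> ?N" "\<And>r. r \<in> X \<Longrightarrow> R (r, c) \<noteq> f c" if "c \<in> ?N" for c
        using PiE_mem[OF fe that] unfolding available_def by (blast, force)
      define R' where "R' = (\<lambda>(r, c). if r = a then f c else R (r, c))"
      have "R' \<in> insert a X \<times> ?N \<rightarrow>\<^sub>E ?N"
      proof (rule PiE_I)
        show "R' p \<in> ?N" if pX: "p \<in> insert a X \<times> ?N" for p
        proof -
          obtain r c where p: "p = (r, c)" "r \<in> insert a X" "c \<in> ?N" using pX by blast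
          show ?thesis
          proof (cases "r = a")
            case True thus ?thesis using fav(1)[OF p(3)] p(1) by (simp add: R'_def)
          next
            case False
            hence "R (r, c) \<in> ?N" using p by (intro PiE_mem[OF Rn]) blast
            thus ?thesis using False p(1) by (simp add: R'_def)
          qed
        qed
        show "R' p = undefined" if "p \<notin> insert a X \<times> ?N" for p
          using that PiE_arb[OF fe, of "snd p"] PiE_arb[OF Rn, of p]
          by (cases p) (auto simp: R'_def simp del: atLeastAtMost_iff)
      qed
      moreover have "inj_on (\<lambda>c. R' (r, c)) ?N" if "r \<in> insert a X" for r
        using that injr finj by (cases "r = a") (auto simp: R'_def)
      moreover have "inj_on (\<lambda>r. R' (r, c)) (insert a X)" if c: "c \<in> ?N" for c
      proof -
        have "inj_on (\<lambda>r. R' (r, c)) X"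
          using injc[OF c] assms(2) by (subst inj_on_cong[where g = "\<lambda>r. R (r, c)"]) (auto simp: R'_def)
        moreover have "R' (a, c) \<notin> (\<lambda>r. R' (r, c)) ` X"
        proof
          assume "R' (a, c) \<in> (\<lambda>r. R' (r, c)) ` X"
          then obtain r where r: "r \<in> X" "R' (a, c) = R' (r, c)" by blast
          moreover have "r \<noteq> a" using r(1) assms(2) by blast
          ultimately have "R (r, c) = f c" by (simp add: R'_def)
          thus False using fav(2)[OF c r(1)] by blast
        qed
        ultimately show ?thesis using assms(2) by simp
      qed
      moreover have "\<forall>p\<in>P \<inter> insert a X \<times> ?N. R' p = L0 p"
        using fP RP by (auto simp: R'_def)
      ultimately have "R' \<in> rectangles_agreeing n (insert a X) P L0"
        by (simp add: rectangles_agreeing_def rectangles_def)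
      thus "(case z of (R, f) \<Rightarrow> \<lambda>(r, c). if r = a then f c else R (r, c)) \<in> rectangles_agreeing n (insert a X) P L0"
        by (simp add: z R'_def)
    qed
    show "(case (restrict R (X \<times> ?N), \<lambda>c\<in>?N. R (a, c)) of (R, f) \<Rightarrow> \<lambda>(r, c). if r = a then f c else R (r, c)) = R"
      if R: "R \<in> rectangles_agreeing n (insert a X) P L0" for R
    proof
      fix p :: "nat \<times> nat"
      have Rn: "R \<in> insert a X \<times> ?N \<rightarrow>\<^sub>E ?N" using R by (simp add: rectangles_agreeing_def rectangles_def)
      show "(case (restrict R (X \<times> ?N), \<lambda>c\<in>?N. R (a, c)) of (R, f) \<Rightarrow> \<lambda>(r, c). if r = a then f c else R (r, c)) p = R p"
        using PiE_arb[OF Rn, of p] by (cases p) auto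
    qed
    show "(restrict (case z of (R, f) \<Rightarrow> \<lambda>(r, c). if r = a then f c else R (r, c)) (X \<times> ?N),
           \<lambda>c\<in>?N. (case z of (R, f) \<Rightarrow> \<lambda>(r, c). if r = a then f c else R (r, c)) (a, c)) = z"
      if zM: "z \<in> (SIGMA R:rectangles_agreeing n X P L0. ?M R)" for z
    proof -
      obtain R f where z: "z = (R, f)" and R: "R \<in> X \<times> ?N \<rightarrow>\<^sub>E ?N" and f: "f \<in> PiE ?N (available n X R)"
        using zM by (auto simp: rectangles_agreeing_def rectangles_def matchings_def)
      have "restrict (\<lambda>(r, c). if r = a then f c else R (r, c)) (X \<times> ?N) = restrict R (X \<times> ?N)"
        using assms(2) by (auto simp: restrict_def)
      moreover have "restrict R (X \<times> ?N) = R" using R by (rule PiE_restrict)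
      moreover have "restrict f ?N = f" using f by (rule PiE_restrict)
      ultimately show ?thesis by (simp add: z)
    qed
  qed
  hence "card (rectangles_agreeing n (insert a X) P L0) = card (SIGMA R:rectangles_agreeing n X P L0. ?M R)"
    by (rule bij_betw_same_card)
  also have "\<dots> = (\<Sum>R\<in>rectangles_agreeing n X P L0. card (?M R))"
  proof (rule card_SigmaI)
    show "finite (rectangles_agreeing n X P L0)"
      unfolding rectangles_agreeing_def using finite_rectangles[OF assms(1)] by simp
    have "finite (matchings ?N (available n X R))" for R
      by (rule finite_matchings) (auto simp: available_def)
    thus "\<forall>R\<in>rectangles_agreeing n X P L0. finite (?M R)" by simp
  qed
  finally show ?thesis .
qed

lemma rectangles_agreeing_empty: "rectangles_agreeing n X {} L0 = rectangles n X"
  by (simp add: rectangles_agreeing_def)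

lemma card_rectangles_empty: "card (rectangles_agreeing n {} P L0) = 1"
  by (simp add: rectangles_agreeing_def rectangles_def)

lemma matchings_available_regular:
  assumes "R \<in> rectangles n X" "finite X"
  shows "\<And>c. c \<in> {1..n} \<Longrightarrow> available n X R c \<subseteq> {1..n}"
    "\<And>c. c \<in> {1..n} \<Longrightarrow> card (available n X R c) = n - card X"
    "\<And>s. s \<in> {1..n} \<Longrightarrow> card {c \<in> {1..n}. s \<in> available n X R c} = n - card X"
  using card_available[OF assms] card_available_columns[OF assms]
  by (auto simp: available_def simp del: atLeastAtMost_iff)

lemma card_rectangles_lower:
  assumes "X \<subseteq> {1..n}"
  shows "exp (\<Sum>j<card X. real n * (ln (real (n - j)) - 1)) \<le> card (rectangles n X)"
proof -
  have "finite X" using assms finite_subset by blast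
  thus ?thesis using assms
  proof (induction X)
    case empty
    show ?case using card_rectangles_empty[of n "{}" undefined] by (simp add: rectangles_agreeing_empty)
  next
    case (insert a X)
    let ?m = "n - card X"
    have "card (insert a X) \<le> card {1..n}" using insert by (intro card_mono) auto
    hence m: "?m > 0" using insert by simp
    have "exp (\<Sum>j<card (insert a X). real n * (ln (real (n - j)) - 1)) =
        exp (\<Sum>j<card X. real n * (ln (real (n - j)) - 1)) * exp (real n * (ln ?m - 1))"
      using insert by (simp add: exp_add)
    also have "\<dots> \<le> card (rectangles n X) * exp (real n * (ln ?m - 1))"
      using insert by (intro mult_right_mono) auto
    also have "\<dots> = (\<Sum>R\<in>rectangles n X. exp (real n * (ln ?m - 1)))" by simp
    also have "\<dots> \<le> (\<Sum>R\<in>rectangles n X. real (card (matchings {1..n} (available n X R))))"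
    proof (rule sum_mono)
      fix R assume R: "R \<in> rectangles n X"
      have "exp (card {1..n} * (ln ?m - 1)) \<le> card (matchings {1..n} (available n X R))"
        by (rule regular_matchings_lower[where S = "{1..n}"])
           (use matchings_available_regular[OF R insert.hyps(1)] m in \<open>simp_all del: atLeastAtMost_iff\<close>)
      thus "exp (real n * (ln ?m - 1)) \<le> card (matchings {1..n} (available n X R))" by simp
    qed
    also have "\<dots> = card (rectangles n (insert a X))"
      using card_rectangles_insert[OF insert.hyps, of n "{}" undefined]
      by (simp add: rectangles_agreeing_empty)
    finally show ?case .
  qed
qed

lemma card_rectangles_agreeing_step:
  assumes X: "finite X" "a \<notin> X" "insert a X \<subseteq> {1..n}" and L0: "L0 \<in> latin_squares n"
    and d: "d = card {c \<in> {1..n}. (a, c) \<in> P}" "2 * d \<le> n - card X"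
  shows "card (rectangles_agreeing n (insert a X) P L0) \<le> card (rectangles_agreeing n X P L0) *
    exp (real n * (ln (n - card X) - 1) - d * (ln (n - card X) - d / (n - card X)) + 2 * real n * (ln n + 1) / (n - card X))"
proof -
  let ?m = "n - card X" and ?D = "{c \<in> {1..n}. (a, c) \<in> P}"
  have "card (insert a X) \<le> card {1..n}" using X by (intro card_mono) auto
  hence m: "?m > 0" using X by simp
  have L0r: "L0 \<in> rectangles n {1..n}" using L0 by (simp add: latin_squares_eq_rectangles)
  have a: "a \<in> {1..n}" using X by simp
  have inj: "inj_on (\<lambda>c. L0 (a, c)) {1..n}" using L0r a unfolding rectangles_def by blast
  have L0n: "L0 \<in> {1..n} \<times> {1..n} \<rightarrow>\<^sub>E {1..n}" using L0r unfolding rectangles_def by blast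
  have rng: "L0 (a, c) \<in> {1..n}" if "c \<in> {1..n}" for c
    by (rule PiE_mem[OF L0n SigmaI[OF a that]])
  have "real (card (rectangles_agreeing n (insert a X) P L0)) = (\<Sum>R\<in>rectangles_agreeing n X P L0.
     real (card {f \<in> matchings {1..n} (available n X R). \<forall>c\<in>?D. f c = L0 (a, c)}))"
    by (subst card_rectangles_insert[OF X(1,2)]) simp
  also have "\<dots> \<le> (\<Sum>R\<in>rectangles_agreeing n X P L0. exp (card {1..n} * (ln ?m - 1) -
      card ?D * (ln ?m - card ?D / ?m) + 2 * card {1..n} * (ln (card {1..n}) + 1) / ?m))"
  proof (rule sum_mono)
    fix R assume "R \<in> rectangles_agreeing n X P L0"
    hence R: "R \<in> rectangles n X" by (simp add: rectangles_agreeing_def)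
    note reg = matchings_available_regular[OF R X(1)]
    show "real (card {f \<in> matchings {1..n} (available n X R). \<forall>c\<in>?D. f c = L0 (a, c)}) \<le>
      exp (card {1..n} * (ln ?m - 1) - card ?D * (ln ?m - card ?D / ?m) + 2 * card {1..n} * (ln (card {1..n}) + 1) / ?m)"
    proof (rule restricted_matchings_upper[where S = "{1..n}"])
      show "?D \<subseteq> {1..n}" by blast
      show "inj_on (\<lambda>c. L0 (a, c)) ?D" by (rule inj_on_subset[OF inj]) blast
      show "(\<lambda>c. L0 (a, c)) ` ?D \<subseteq> {1..n}" using rng by blast
      show "2 * card ?D \<le> ?m" using d by simp
    qed (use reg m in \<open>simp_all del: atLeastAtMost_iff\<close>)
  qed
  also have "\<dots> = card (rectangles_agreeing n X P L0) *
    exp (real n * (ln ?m - 1) - d * (ln ?m - d / ?m) + 2 * real n * (ln n + 1) / ?m)"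
    by (simp add: d)
  finally show ?thesis .
qed

text \<open>Summing the errors of all rows by this harmonic bound produces the second logarithm in
  \<open>n * (ln n)^2\<close>.\<close>

lemma sum_inverse_le_ln:
  assumes "n > 0"
  shows "(\<Sum>j<n. 1 / real (n - j)) \<le> ln n + 1"
proof -
  have "(\<Sum>j<n. 1 / real (n - j)) = (\<Sum>j<n. 1 / real (Suc j))"
    by (rule sum.reindex_bij_witness[where i = "\<lambda>j. n - 1 - j" and j = "\<lambda>j. n - 1 - j"]) auto
  also have "\<dots> \<le> ln n + 1" using assms
  proof (induction n rule: nat_induct_non_zero)
    case (Suc n)
    have "ln (real n / real (Suc n)) \<le> real n / real (Suc n) - 1"
      using Suc.hyps by (intro ln_le_minus_one) auto
    also have "\<dots> = - (1 / real (Suc n))" by (simp add: field_simps)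
    finally have "1 / real (Suc n) \<le> ln (Suc n) - ln n" using Suc.hyps by (simp add: ln_div del: of_nat_Suc)
    thus ?case using Suc.IH by (simp del: of_nat_Suc)
  qed auto
  finally show ?thesis .
qed

text \<open>The point of the restriction to a small corner is that there the degrees of \<^term>\<open>P\<close> are small
  compared to \<^term>\<open>n\<close>; for dense rows the cost per cell would be smaller than \<^term>\<open>ln n\<close> by a constant.\<close>

lemma card_latin_squares_agreeing:
  fixes \<gamma> :: real
  assumes "n > 0" "0 \<le> \<gamma>" "\<gamma> \<le> 1 / 4" and AB: "A \<subseteq> {1..n}" "B \<subseteq> {1..n}" "card A \<le> \<gamma> * n" "card B \<le> \<gamma> * n"
    and P: "P \<subseteq> A \<times> B" and L0: "L0 \<in> latin_squares n"
  shows "card {L \<in> latin_squares n. \<forall>p\<in>P. L p = L0 p} \<le>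
     card (latin_squares n) * exp (2 * real n * (ln n + 1)\<^sup>2 - card P * (ln n - 4 * \<gamma>))"
proof -
  define d where "d = (\<lambda>a. card {c \<in> {1..n}. (a, c) \<in> P})"
  \<comment> \<open>\<open>\<Lambda>\<close> is the exponent in
    \<open>card_rectangles_lower\<close>; \<open>Err\<close> accumulates what the upper bound loses
    against it.\<close>
  define \<Lambda> where "\<Lambda> = (\<lambda>k. \<Sum>j<k. real n * (ln (real (n - j)) - 1))"
  define Err where "Err = (\<lambda>k. \<Sum>j<k. 2 * real n * (ln n + 1) / real (n - j))"
  have fin: "finite A" "finite B" using AB finite_subset by blast+
  have dB: "d a \<le> card B" for a unfolding d_def using P fin by (intro card_mono) auto
  have d0: "d a = 0" if "a \<notin> A" for a using P that by (auto simp: d_def)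
  \<comment> \<open>The condition \<open>a \<in> A \<Longrightarrow> X \<subseteq> A\<close> says
    that the rows of \<open>A\<close> come before all others. Thus only few rows are present when a
    row with prescribed cells is added, and \<open>m\<close> is still at least
    \<open>(1 - \<gamma>) * n\<close>; for later rows \<open>d a = 0\<close>.\<close>
  have step: "card (rectangles_agreeing n (insert a X) P L0) \<le>
      exp (\<Lambda> (card (insert a X)) + Err (card (insert a X)) - (ln n - 4 * \<gamma>) * (\<Sum>r\<in>insert a X. d r))"
    if X: "finite X" "a \<notin> X" "insert a X \<subseteq> {1..n}" "a \<in> A \<Longrightarrow> X \<subseteq> A"
      and IH: "card (rectangles_agreeing n X P L0) \<le> exp (\<Lambda> (card X) + Err (card X) - (ln n - 4 * \<gamma>) * (\<Sum>r\<in>X. d r))"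
    for a X
  proof -
    define m where "m = n - card X"
    have "card (insert a X) \<le> card {1..n}" using X by (intro card_mono) auto
    hence m: "m > 0" "real m = n - real (card X)" using X by (auto simp: m_def)
    have mA: "m \<ge> (1 - \<gamma>) * n" if "a \<in> A"
    proof -
      have "card X \<le> card A" using X(4)[OF that] fin by (intro card_mono)
      thus ?thesis using AB(3) by (simp add: m algebra_simps)
    qed
    have dm: "2 * d a \<le> m"
    proof (cases "a \<in> A")
      case True
      have "real (2 * d a) \<le> 2 * (\<gamma> * n)" using dB[of a] AB(4) by simp
      also have "\<dots> \<le> (1 - \<gamma>) * n" using assms(1,3) by (simp add: algebra_simps)
      also have "\<dots> \<le> m" by (rule mA[OF True])
      finally show ?thesis by simp
    qed (simp add: d0)
    \<comment> \<open>The loss \<open>4 * \<gamma>\<close> per cell has two halves: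
      \<open>ln m >= ln n - 2 * \<gamma>\<close>, as few rows are filled, and
      \<open>d a / m <= 2 * \<gamma>\<close>, as the row has few prescribed cells.\<close>
    have key: "d a * (ln n - 4 * \<gamma>) \<le> d a * (ln m - d a / m)"
    proof (cases "a \<in> A")
      case True
      have "ln (1 - \<gamma>) \<ge> - \<gamma> - 2 * \<gamma>\<^sup>2" using assms by (intro ln_one_minus_pos_lower_bound) auto
      moreover have "2 * \<gamma>\<^sup>2 \<le> \<gamma>" using assms mult_right_mono[of \<gamma> "1/2" \<gamma>] by (simp add: power2_eq_square)
      ultimately have l1: "ln (1 - \<gamma>) \<ge> - 2 * \<gamma>" by linarith
      have "ln ((1 - \<gamma>) * n) \<le> ln m" using mA[OF True] assms m by (intro ln_mono) auto
      hence l2: "ln n - 2 * \<gamma> \<le> ln m" using l1 assms by (simp add: ln_mult)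
      have "d a \<le> \<gamma> * n" using dB[of a] AB(4) by linarith
      also have "\<dots> \<le> \<gamma> * (2 * ((1 - \<gamma>) * n))"
        using assms by (intro mult_left_mono) (auto simp: algebra_simps)
      also have "\<dots> \<le> \<gamma> * (2 * m)" using assms mA[OF True] by (intro mult_left_mono) auto
      finally have "d a / m \<le> 2 * \<gamma>" using m(1) by (simp add: pos_divide_le_eq mult_ac)
      hence "ln n - 4 * \<gamma> \<le> ln m - d a / m" using l2 by linarith
      thus ?thesis by (intro mult_left_mono) auto
    qed (simp add: d0)
    have "card (rectangles_agreeing n (insert a X) P L0) \<le> card (rectangles_agreeing n X P L0) *
        exp (real n * (ln m - 1) - d a * (ln m - d a / m) + 2 * real n * (ln n + 1) / m)"
      unfolding m_def using dm by (intro card_rectangles_agreeing_step X L0) (simp_all add: d_def m_def)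
    also have "\<dots> \<le> exp (\<Lambda> (card X) + Err (card X) - (ln n - 4 * \<gamma>) * (\<Sum>r\<in>X. d r)) *
        exp (real n * (ln m - 1) - d a * (ln n - 4 * \<gamma>) + 2 * real n * (ln n + 1) / m)"
      using IH key by (intro mult_mono) auto
    also have "\<dots> = exp (\<Lambda> (card (insert a X)) + Err (card (insert a X)) - (ln n - 4 * \<gamma>) * (\<Sum>r\<in>insert a X. d r))"
      using X(1,2) by (simp add: exp_add[symmetric] \<Lambda>_def Err_def m_def algebra_simps)
    finally show ?thesis .
  qed
  let ?bd = "\<lambda>X. card (rectangles_agreeing n X P L0) \<le> exp (\<Lambda> (card X) + Err (card X) - (ln n - 4 * \<gamma>) * (\<Sum>r\<in>X. d r))"
  have "?bd A" using fin(1) order_refl[of A]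
  proof (induction rule: finite_subset_induct')
    case empty
    show ?case by (simp add: card_rectangles_empty \<Lambda>_def Err_def)
  next
    case (insert a X)
    thus ?case using AB(1) by (intro step) auto
  qed
  have "?bd (A \<union> Y)" if "Y \<subseteq> {1..n} - A" "finite Y" for Y
    using that(2,1)
  proof (induction Y)
    case empty show ?case using \<open>?bd A\<close> by simp
  next
    case (insert a Y)
    have "?bd (insert a (A \<union> Y))" using insert AB(1) fin by (intro step) auto
    thus ?case by simp
  qed
  from this[of "{1..n} - A"] have "?bd (A \<union> ({1..n} - A))" by simp
  moreover have "A \<union> ({1..n} - A) = {1..n}" using AB by blast
  ultimately have "?bd {1..n}" by simp
  moreover have "(\<Sum>r\<in>{1..n}. real (d r)) = card P"
  proof -
    have PN: "P \<subseteq> {1..n} \<times> {1..n}" using P AB by blast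
    hence "P = (SIGMA r:{1..n}. {c \<in> {1..n}. (r, c) \<in> P})" by blast
    hence "card P = card (SIGMA r:{1..n}. {c \<in> {1..n}. (r, c) \<in> P})" by simp
    also have "\<dots> = (\<Sum>r\<in>{1..n}. d r)" unfolding d_def by (rule card_SigmaI) auto
    finally show ?thesis by simp
  qed
  moreover have "rectangles_agreeing n {1..n} P L0 = {L \<in> latin_squares n. \<forall>p\<in>P. L p = L0 p}"
  proof -
    have "P \<inter> {1..n} \<times> {1..n} = P" using P AB by blast
    thus ?thesis by (simp add: rectangles_agreeing_def latin_squares_eq_rectangles)
  qed
  ultimately have "card {L \<in> latin_squares n. \<forall>p\<in>P. L p = L0 p} \<le> exp (\<Lambda> n + Err n - (ln n - 4 * \<gamma>) * card P)"
    by simp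
  \<comment> \<open>The main term \<open>\<Lambda> n\<close> is kept apart, to be replaced by the
    number of Latin squares through the lower bound.\<close>
  also have "\<dots> \<le> exp (\<Lambda> n) * exp (2 * real n * (ln n + 1)\<^sup>2 - card P * (ln n - 4 * \<gamma>))"
  proof -
    have "Err n = 2 * real n * (ln n + 1) * (\<Sum>j<n. 1 / real (n - j))"
      by (simp add: Err_def sum_distrib_left)
    also have "\<dots> \<le> 2 * real n * (ln n + 1) * (ln n + 1)"
      using assms(1) by (intro mult_left_mono sum_inverse_le_ln) auto
    finally have "Err n \<le> 2 * real n * (ln n + 1)\<^sup>2" by (simp add: power2_eq_square mult_ac)
    thus ?thesis by (simp add: exp_add[symmetric] algebra_simps)
  qed
  also have "\<dots> \<le> card (latin_squares n) * exp (2 * real n * (ln n + 1)\<^sup>2 - card P * (ln n - 4 * \<gamma>))"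
    using card_rectangles_lower[of "{1..n}" n]
    by (intro mult_right_mono) (simp_all add: \<Lambda>_def latin_squares_eq_rectangles)
  finally show ?thesis .
qed

section \<open>Labeled copies in the binomial system\<close>

text \<open>Candidates for copies, irrespective of hyperedges. Rows and columns are confined but
  symbols are not, since the counting estimate only needs small row and column sets.
  \<open>B\<close> is a set of column indices in \<open>{1..n}\<close>, hence the shift.\<close>

definition placements :: "'a triple_system \<Rightarrow> nat \<Rightarrow> nat set \<Rightarrow> nat set \<Rightarrow> ('a \<Rightarrow> nat) set" where
  "placements H n A B = {f \<in> verts H \<rightarrow>\<^sub>E {1..n} \<union> {n+1..2*n} \<union> {2*n+1..3*n}. inj_on f (verts H) \<and>
     f ` Rcl H \<subseteq> A \<and> f ` Ccl H \<subseteq> (\<lambda>c. n + c) ` B \<and> f ` Scl H \<subseteq> {2*n+1..3*n}}"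

definition edge_images :: "'a triple_system \<Rightarrow> ('a \<Rightarrow> 'b) \<Rightarrow> 'b set set" where
  "edge_images H f = (\<lambda>e. f ` e) ` hedges H"

lemma finite_placements: "finite (verts H) \<Longrightarrow> finite (placements H n A B)"
  unfolding placements_def
  by (rule finite_subset[of _ "verts H \<rightarrow>\<^sub>E {1..n} \<union> {n+1..2*n} \<union> {2*n+1..3*n}"]) (auto intro!: finite_PiE)

lemma placements_mono: "A \<subseteq> A' \<Longrightarrow> B \<subseteq> B' \<Longrightarrow> placements H n A B \<subseteq> placements H n A' B'"
  unfolding placements_def by blast

lemma column_range: "(\<lambda>c. n + c) ` {1..n} = {n+1..2*n::nat}"
  by (simp add: image_add_atLeastAtMost mult_2)

lemma copies_order_system:
  "copies H (order_system n E) = {f \<in> placements H n {1..n} {1..n}. edge_images H f \<subseteq> E}"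
  unfolding copies_def placements_def edge_images_def column_range
  by (auto simp: order_system_def verts_def simp del: atLeastAtMost_iff)

lemma num_copies_order_system:
  assumes "finite (verts H)"
  shows "real (num_copies H (order_system n E)) =
    (\<Sum>f\<in>placements H n {1..n} {1..n}. if edge_images H f \<subseteq> E then 1 else 0)"
  unfolding num_copies_def copies_order_system
  using finite_placements[OF assms] by (simp add: sum.If_cases Int_def)

lemma finite_hedges: "colored_triple_system H \<Longrightarrow> finite (hedges H)"
  unfolding colored_triple_system_def by (rule finite_subset[of _ "Pow (verts H)"]) auto

lemma finite_edge_images: "colored_triple_system H \<Longrightarrow> finite (edge_images H f)"
  unfolding edge_images_def by (simp add: finite_hedges)

lemma card_edge_images:
  assumes "colored_triple_system H" "f \<in> placements H n A B"
  shows "card (edge_images H f) = card (hedges H)"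
  unfolding edge_images_def
proof (rule card_image, rule inj_onI)
  fix e e' assume e: "e \<in> hedges H" "e' \<in> hedges H" "f ` e = f ` e'"
  have "e \<subseteq> verts H" "e' \<subseteq> verts H" using assms e unfolding colored_triple_system_def by blast+
  moreover have "inj_on f (verts H)" using assms unfolding placements_def by blast
  ultimately show "e = e'" using e(3) by (simp add: inj_on_image_eq_iff)
qed

lemma edge_images_placement:
  assumes H: "colored_triple_system H" and f: "f \<in> placements H n A B" and e: "e' \<in> edge_images H f"
    and AB: "A \<subseteq> {1..n}" "B \<subseteq> {1..n}"
  shows "\<exists>r\<in>A. \<exists>c\<in>B. \<exists>s\<in>{1..n}. e' = {r, n + c, 2*n + s}"
proof -
  obtain e where e: "e \<in> hedges H" "e' = f ` e" using e unfolding edge_images_def by blast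
  have "card (e \<inter> Rcl H) = 1" "card (e \<inter> Ccl H) = 1" "card (e \<inter> Scl H) = 1" and ev: "e \<subseteq> verts H"
    using H e(1) unfolding colored_triple_system_def by blast+
  then obtain u v w where uvw: "e \<inter> Rcl H = {u}" "e \<inter> Ccl H = {v}" "e \<inter> Scl H = {w}"
    by (metis card_1_singletonE)
  have "e = (e \<inter> Rcl H) \<union> (e \<inter> Ccl H) \<union> (e \<inter> Scl H)" using ev unfolding verts_def by blast
  hence "e = {u, v, w}" unfolding uvw by blast
  hence "e' = {f u, f v, f w}" unfolding e(2) by simp
  moreover have "f u \<in> A" "f v \<in> (\<lambda>c. n + c) ` B" "f w \<in> {2*n+1..3*n}"
    using f uvw unfolding placements_def by blast+
  moreover from this(2) obtain c where "c \<in> B" "f v = n + c" by blast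
  moreover from \<open>f w \<in> {2*n+1..3*n}\<close> have "f w - 2 * n \<in> {1..n}" "f w = 2 * n + (f w - 2 * n)" by auto
  ultimately show ?thesis by metis
qed

lemma edge_images_subset_all_hedges:
  assumes "colored_triple_system H" "f \<in> placements H n {1..n} {1..n}"
  shows "edge_images H f \<subseteq> all_hedges n"
  using edge_images_placement[OF assms _ order_refl order_refl] unfolding all_hedges_def by blast

lemma prob_random_system_superset:
  assumes "n > 0" "D \<subseteq> all_hedges n"
  shows "measure_pmf.prob (random_system n) {G. D \<subseteq> hedges G} = (1 / real n) ^ card D"
proof -
  have fin: "finite D" using assms finite_all_hedges finite_subset by blast
  let ?B = "\<lambda>e. if e \<in> D then {True} else UNIV"
  have "(\<lambda>\<omega>. order_system n {e \<in> all_hedges n. \<omega> e}) -` {G. D \<subseteq> hedges G} = Pi (all_hedges n) ?B"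
    using assms(2) by (auto simp: order_system_def Pi_def)
  hence "measure_pmf.prob (random_system n) {G. D \<subseteq> hedges G} =
      (\<Prod>e\<in>all_hedges n. measure_pmf.prob (bernoulli_pmf (1 / real n)) (?B e))"
    by (simp add: random_system_def random_system_p_def measure_map_pmf measure_Pi_pmf_Pi[OF finite_all_hedges])
  also have "\<dots> = (\<Prod>e\<in>all_hedges n. if e \<in> D then 1 / real n else 1)"
    using assms(1) by (intro prod.cong refl) (auto simp: measure_pmf_single)
  also have "\<dots> = (1 / real n) ^ card D"
    using assms(2) finite_all_hedges by (simp add: prod.If_cases Int_absorb1)
  finally show ?thesis .
qed

lemma expectation_num_copies:
  fixes p :: "nat triple_system pmf"
  assumes "finite (verts H)" "\<And>G. G \<in> set_pmf p \<Longrightarrow> \<exists>E. G = order_system n E"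
  shows "measure_pmf.expectation p (\<lambda>G. real (num_copies H G)) =
    (\<Sum>f\<in>placements H n {1..n} {1..n}. measure_pmf.prob p {G. edge_images H f \<subseteq> hedges G})"
proof -
  have "measure_pmf.expectation p (\<lambda>G. real (num_copies H G)) =
      measure_pmf.expectation p (\<lambda>G. \<Sum>f\<in>placements H n {1..n} {1..n}. indicator {G. edge_images H f \<subseteq> hedges G} G)"
  proof (intro integral_cong_AE AE_pmfI)
    fix G assume "G \<in> set_pmf p"
    then obtain E where "G = order_system n E" using assms(2) by blast
    moreover have "hedges (order_system n E) = E" by (simp add: order_system_def)
    ultimately show "real (num_copies H G) =
        (\<Sum>f\<in>placements H n {1..n} {1..n}. indicator {G. edge_images H f \<subseteq> hedges G} G)"
      using num_copies_order_system[OF assms(1), of n E] by (simp add: indicator_def of_bool_def)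
  qed auto
  also have "\<dots> = (\<Sum>f\<in>placements H n {1..n} {1..n}.
      measure_pmf.expectation p (indicator {G. edge_images H f \<subseteq> hedges G}))"
    by (intro Bochner_Integration.integral_sum) (auto intro!: measure_pmf.integrable_const_bound[where B = 1])
  finally show ?thesis by simp
qed

lemma set_pmf_random_system: "G \<in> set_pmf (random_system n) \<Longrightarrow> \<exists>E. G = order_system n E"
  by (auto simp: random_system_def random_system_p_def)

lemma exp_copies_eq:
  assumes "colored_triple_system H" "n > 0"
  shows "exp_copies H n = card (placements H n {1..n} {1..n}) * (1 / real n) ^ card (hedges H)"
proof -
  have fin: "finite (verts H)" using assms by (simp add: colored_triple_system_def)
  have "exp_copies H n = (\<Sum>f\<in>placements H n {1..n} {1..n}.
      measure_pmf.prob (random_system n) {G. edge_images H f \<subseteq> hedges G})"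
    unfolding exp_copies_def by (rule expectation_num_copies[OF fin set_pmf_random_system])
  also have "\<dots> = (\<Sum>f\<in>placements H n {1..n} {1..n}. (1 / real n) ^ card (hedges H))"
    by (intro sum.cong refl)
      (simp add: prob_random_system_superset[OF assms(2) edge_images_subset_all_hedges[OF assms(1)]] card_edge_images[OF assms(1)])
  finally show ?thesis by simp
qed

text \<open>Given that the hyperedges of \<open>E\<close> are present, the others remain
  independent; so a placement only pays for its hyperedges outside \<open>E\<close>.\<close>

lemma cond_exp_copies_eq:
  assumes H: "colored_triple_system H" and n: "n > 0" and E: "colored_triple_system (order_system n E)"
  shows "cond_exp_copies H n (order_system n E) =
    (\<Sum>f\<in>placements H n {1..n} {1..n}. (1 / real n) ^ card (edge_images H f - E))"
proof -
  have fin: "finite (verts H)" using H by (simp add: colored_triple_system_def)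
  have Eall: "E \<subseteq> all_hedges n" using E by (rule hedges_subset_all_hedges)
  have finE: "finite E" using Eall finite_all_hedges finite_subset by blast
  have hE: "hedges (order_system n E) = E" by (simp add: order_system_def)
  let ?S = "{G. E \<subseteq> hedges G}"
  have ne: "set_pmf (random_system n) \<inter> ?S \<noteq> {}" using conditioning_event_possible[OF E] by (simp add: hE)
  have cond: "measure_pmf.prob (cond_pmf (random_system n) ?S) T =
      measure_pmf.prob (random_system n) (?S \<inter> T) / measure_pmf.prob (random_system n) ?S" for T
    unfolding cond_pmf.rep_eq[OF ne]
    by (rule measure_uniform_measure)
       (use emeasure_measure_pmf_not_zero[OF ne] in \<open>simp_all add: measure_pmf.emeasure_eq_measure\<close>)
  have "cond_exp_copies H n (order_system n E) = (\<Sum>f\<in>placements H n {1..n} {1..n}.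
      measure_pmf.prob (cond_pmf (random_system n) ?S) {G. edge_images H f \<subseteq> hedges G})"
    unfolding cond_exp_copies_def hE
    using set_pmf_random_system set_cond_pmf[OF ne] by (intro expectation_num_copies[OF fin]) blast
  also have "\<dots> = (\<Sum>f\<in>placements H n {1..n} {1..n}. (1 / real n) ^ card (edge_images H f - E))"
  proof (rule sum.cong[OF refl])
    fix f assume f: "f \<in> placements H n {1..n} {1..n}"
    let ?D = "edge_images H f"
    have D: "?D \<subseteq> all_hedges n" by (rule edge_images_subset_all_hedges[OF H f])
    have finD: "finite ?D" by (rule finite_edge_images[OF H])
    have eq: "?S \<inter> {G. ?D \<subseteq> hedges G} = {G. E \<union> (?D - E) \<subseteq> hedges G}" by blast
    have "E \<union> (?D - E) \<subseteq> all_hedges n" using Eall D by blast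
    hence "measure_pmf.prob (random_system n) (?S \<inter> {G. ?D \<subseteq> hedges G}) = (1 / real n) ^ card (E \<union> (?D - E))"
      unfolding eq by (rule prob_random_system_superset[OF n])
    also have "card (E \<union> (?D - E)) = card E + card (?D - E)"
      using finE finD by (intro card_Un_disjoint) auto
    finally show "measure_pmf.prob (cond_pmf (random_system n) ?S) {G. ?D \<subseteq> hedges G} = (1 / real n) ^ card (?D - E)"
      unfolding cond prob_random_system_superset[OF n Eall] using n by (simp add: power_add field_simps)
  qed
  finally show ?thesis .
qed

text \<open>The mass of the placements inside a corner is controlled by stability although stability only
  speaks about all placements, since conditioning increases the contribution of each placement.\<close>

lemma sum_placements_le_cond_exp:
  assumes H: "colored_triple_system H" and n: "n > 0" and E: "colored_triple_system (order_system n E)"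
    and AB: "A \<subseteq> {1..n}" "B \<subseteq> {1..n}"
  shows "(\<Sum>f\<in>placements H n A B. (1 / real n) ^ card (edge_images H f - E)) \<le>
    card (placements H n A B) * (1 / real n) ^ card (hedges H) +
    (cond_exp_copies H n (order_system n E) - exp_copies H n)"
proof -
  let ?h = "card (hedges H)" and ?P = "placements H n {1..n} {1..n}"
  let ?t = "\<lambda>f. (1 / real n) ^ card (edge_images H f - E) - (1 / real n) ^ ?h"
  have fin: "finite ?P" using H by (intro finite_placements) (simp add: colored_triple_system_def)
  have nonneg: "?t f \<ge> 0" if f: "f \<in> ?P" for f
  proof -
    have "card (edge_images H f - E) \<le> ?h"
      using card_mono[OF finite_edge_images[OF H, of f], of "edge_images H f - E"] card_edge_images[OF H f] by auto
    thus ?thesis using n power_decreasing[of "card (edge_images H f - E)" ?h "1 / real n"] by simp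
  qed
  have "(\<Sum>f\<in>placements H n A B. ?t f) \<le> (\<Sum>f\<in>?P. ?t f)"
    by (rule sum_mono2[OF fin placements_mono[OF AB]]) (use nonneg in blast)
  thus ?thesis unfolding cond_exp_copies_eq[OF H n E] exp_copies_eq[OF H n] by (simp add: sum_subtractf)
qed

section \<open>Moments of the number of copies in a corner\<close>

definition latin_edges :: "nat \<Rightarrow> (nat \<times> nat \<Rightarrow> nat) \<Rightarrow> nat set set" where
  "latin_edges n L = (\<lambda>(r, c). {r, n + c, 2*n + L (r, c)}) ` ({1..n} \<times> {1..n})"

lemma latin_edges_iff: "e \<in> latin_edges n L \<longleftrightarrow> (\<exists>r\<in>{1..n}. \<exists>c\<in>{1..n}. e = {r, n + c, 2*n + L (r, c)})"
  unfolding latin_edges_def by (simp add: image_iff Bex_def del: atLeastAtMost_iff)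

lemma latin_square_system_eq: "latin_square_system n L = order_system n (latin_edges n L)"
proof -
  have "{{r, n + c, 2*n + s} | r c s. r \<in> {1..n} \<and> c \<in> {1..n} \<and> L (r, c) = s} = latin_edges n L"
    by (intro set_eqI) (auto simp: latin_edges_iff Bex_def simp del: atLeastAtMost_iff)
  thus ?thesis by (simp add: latin_square_system_def)
qed

lemma hedge_Int:
  fixes n :: nat
  assumes "r \<in> {1..n}" "c \<in> {1..n}" "s \<in> {1..n}"
  shows "{r, n + c, 2*n + s} \<inter> {1..n} = {r}" "{r, n + c, 2*n + s} \<inter> {n+1..2*n} = {n + c}"
    "{r, n + c, 2*n + s} \<inter> {2*n+1..3*n} = {2*n + s}"
  using assms by auto

lemma hedge_inject:
  fixes n :: nat
  assumes "r \<in> {1..n}" "c \<in> {1..n}" "s \<in> {1..n}" "r' \<in> {1..n}" "c' \<in> {1..n}" "s' \<in> {1..n}"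
    and "{r, n + c, 2*n + s} = {r', n + c', 2*n + s'}"
  shows "r = r' \<and> c = c' \<and> s = s'"
  using hedge_Int[OF assms(1-3)] unfolding assms(7) hedge_Int[OF assms(4-6)] by simp

lemma latin_square_range: "L \<in> latin_squares n \<Longrightarrow> r \<in> {1..n} \<Longrightarrow> c \<in> {1..n} \<Longrightarrow> L (r, c) \<in> {1..n}"
  using PiE_mem[of L "{1..n} \<times> {1..n}" "\<lambda>_. {1..n}" "(r, c)"] unfolding latin_squares_def by blast

lemma latin_square_inj:
  assumes "L \<in> latin_squares n" "r \<in> {1..n}" "c \<in> {1..n}"
  shows "\<And>c'. c' \<in> {1..n} \<Longrightarrow> L (r, c) = L (r, c') \<Longrightarrow> c = c'"
    "\<And>r'. r' \<in> {1..n} \<Longrightarrow> L (r, c) = L (r', c) \<Longrightarrow> r = r'"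
proof -
  have L: "L \<in> rectangles n {1..n}" using assms by (simp add: latin_squares_eq_rectangles)
  have 1: "inj_on (\<lambda>c. L (r, c)) {1..n}" using L assms unfolding rectangles_def by blast
  have 2: "inj_on (\<lambda>r. L (r, c)) {1..n}" using L assms unfolding rectangles_def by blast
  show "c' \<in> {1..n} \<Longrightarrow> L (r, c) = L (r, c') \<Longrightarrow> c = c'" for c' using inj_onD[OF 1] assms by blast
  show "r' \<in> {1..n} \<Longrightarrow> L (r, c) = L (r', c) \<Longrightarrow> r = r'" for r' using inj_onD[OF 2] assms by blast
qed

text \<open>Distinct cells of a Latin square share at most one of row, column and symbol. This makes
  the union of copies inside one square an admissible set for the stability condition.\<close>

lemma latin_edges_subset:
  assumes L: "L \<in> latin_squares n" and Q: "Q \<subseteq> latin_edges n L"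
  shows "colored_triple_system (order_system n Q)" "latin (order_system n Q)"
proof -
  have form: "\<exists>r\<in>{1..n}. \<exists>c\<in>{1..n}. e = {r, n + c, 2*n + L (r, c)}" if "e \<in> Q" for e
    using subsetD[OF Q that] by (simp only: latin_edges_iff)
  have "e \<subseteq> {1..n} \<union> {n+1..2*n} \<union> {2*n+1..3*n} \<and> card e = 3 \<and> card (e \<inter> {1..n}) = 1 \<and>
      card (e \<inter> {n+1..2*n}) = 1 \<and> card (e \<inter> {2*n+1..3*n}) = 1" if "e \<in> Q" for e
  proof -
    obtain r c where rc: "r \<in> {1..n}" "c \<in> {1..n}" "e = {r, n + c, 2*n + L (r, c)}" using form[OF \<open>e \<in> Q\<close>] by blast
    note s = latin_square_range[OF L rc(1,2)]
    have "card e = 3" unfolding rc(3) using rc(1,2) s by simp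
    moreover have "e \<subseteq> {1..n} \<union> {n+1..2*n} \<union> {2*n+1..3*n}" unfolding rc(3) using rc(1,2) s by simp
    ultimately show ?thesis using hedge_Int[OF rc(1,2) s] by (simp add: rc(3))
  qed
  thus "colored_triple_system (order_system n Q)"
    unfolding colored_triple_system_def order_system_def verts_def by (simp del: atLeastAtMost_iff)
  have "card (e \<inter> e') \<le> 1" if e: "e \<in> Q" "e' \<in> Q" "e \<noteq> e'" for e e'
  proof -
    obtain r c where rc: "r \<in> {1..n}" "c \<in> {1..n}" "e = {r, n + c, 2*n + L (r, c)}" using form[OF e(1)] by blast
    obtain r' c' where rc': "r' \<in> {1..n}" "c' \<in> {1..n}" "e' = {r', n + c', 2*n + L (r', c')}" using form[OF e(2)] by blast
    note s = latin_square_range[OF L rc(1,2)] latin_square_range[OF L rc'(1,2)]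
    have "\<exists>x. e \<inter> e' \<subseteq> {x}"
    proof (cases "r = r'")
      case True
      hence "c \<noteq> c'" using e(3) rc(3) rc'(3) by blast
      moreover from this have "L (r, c) \<noteq> L (r', c')" using latin_square_inj(1)[OF L rc(1,2) rc'(2)] True by blast
      ultimately have "e \<inter> e' \<subseteq> {r}" unfolding rc(3) rc'(3) using rc rc' s by auto
      thus ?thesis ..
    next
      case r: False
      show ?thesis
      proof (cases "c = c'")
        case True
        hence "L (r, c) \<noteq> L (r', c')" using latin_square_inj(2)[OF L rc(1,2) rc'(1)] r by blast
        hence "e \<inter> e' \<subseteq> {n + c}" unfolding rc(3) rc'(3) using rc rc' s r by auto
        thus ?thesis ..
      next
        case False
        hence "e \<inter> e' \<subseteq> {2 * n + L (r, c)}" unfolding rc(3) rc'(3) using rc rc' s r by auto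
        thus ?thesis ..
      qed
    qed
    then obtain x where "e \<inter> e' \<subseteq> {x}" ..
    thus ?thesis using card_mono[of "{x}" "e \<inter> e'"] by simp
  qed
  thus "latin (order_system n Q)" unfolding latin_def order_system_def by simp
qed

text \<open>A hyperedge of \<open>L0\<close> is determined by its cell, so containing
  \<open>Q\<close> means agreeing with \<open>L0\<close> on as many cells as \<open>Q\<close> has
  hyperedges. The main cost \<open>ln n\<close> per cell becomes the power of \<open>1 / n\<close>
  that also occurs in the binomial model.\<close>

lemma card_latin_squares_containing:
  fixes \<gamma> :: real
  assumes n: "n > 0" and \<gamma>: "0 \<le> \<gamma>" "\<gamma> \<le> 1 / 4"
    and AB: "A \<subseteq> {1..n}" "B \<subseteq> {1..n}" "card A \<le> \<gamma> * n" "card B \<le> \<gamma> * n"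
    and L0: "L0 \<in> latin_squares n" and Q: "Q \<subseteq> latin_edges n L0"
    and QAB: "\<And>e. e \<in> Q \<Longrightarrow> \<exists>r\<in>A. \<exists>c\<in>B. \<exists>s\<in>{1..n}. e = {r, n + c, 2*n + s}"
  shows "card {L \<in> latin_squares n. Q \<subseteq> latin_edges n L} \<le>
    card (latin_squares n) * exp (2 * real n * (ln n + 1)\<^sup>2 + 4 * \<gamma> * card Q) * (1 / real n) ^ card Q"
proof -
  define enc where "enc = (\<lambda>L (r, c). {r, n + c, 2*n + L (r, c :: nat)})"
  have enc_inj: "r = r' \<and> c = c' \<and> L (r, c) = L' (r', c')"
    if "enc L (r, c) = enc L' (r', c')" "L \<in> latin_squares n" "L' \<in> latin_squares n"
       "r \<in> {1..n}" "c \<in> {1..n}" "r' \<in> {1..n}" "c' \<in> {1..n}" for L L' r c r' c'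
    using hedge_inject[of r n c "L (r, c)" r' c' "L' (r', c')"] that latin_square_range
    unfolding enc_def prod.case by blast
  define P where "P = {p \<in> A \<times> B. enc L0 p \<in> Q}"
  have inj: "inj_on (enc L0) P"
  proof (rule inj_onI)
    fix p p' assume p: "p \<in> P" "p' \<in> P" "enc L0 p = enc L0 p'"
    obtain r c r' c' where "p = (r, c)" "p' = (r', c')" by (cases p; cases p')
    thus "p = p'" using p enc_inj[of L0 r c L0 r' c'] L0 AB(1,2) unfolding P_def by blast
  qed
  have "Q \<subseteq> enc L0 ` P"
  proof
    fix e assume e: "e \<in> Q"
    obtain r c s where rcs: "r \<in> A" "c \<in> B" "s \<in> {1..n}" "e = {r, n + c, 2*n + s}" using QAB[OF e] by blast
    obtain r' c' where rc': "r' \<in> {1..n}" "c' \<in> {1..n}" "e = {r', n + c', 2*n + L0 (r', c')}"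
      using subsetD[OF Q e] by (auto simp only: latin_edges_iff)
    have "r = r' \<and> c = c' \<and> s = L0 (r', c')"
      by (rule hedge_inject[of r n c s r' c' "L0 (r', c')"])
        (use rcs rc' AB latin_square_range[OF L0 rc'(1,2)] in blast)+
    hence "e = enc L0 (r, c)" using rc'(3) by (simp add: enc_def)
    thus "e \<in> enc L0 ` P" using e rcs unfolding P_def by blast
  qed
  hence "enc L0 ` P = Q" unfolding P_def by blast
  hence cPQ: "card P = card Q" using card_image[OF inj] by simp
  have "{L \<in> latin_squares n. Q \<subseteq> latin_edges n L} \<subseteq> {L \<in> latin_squares n. \<forall>p\<in>P. L p = L0 p}"
  proof (intro subsetI CollectI conjI ballI)
    fix L p assume L: "L \<in> {L \<in> latin_squares n. Q \<subseteq> latin_edges n L}" and p: "p \<in> P"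
    obtain r c where rc: "p = (r, c)" "r \<in> {1..n}" "c \<in> {1..n}" using p AB(1,2) unfolding P_def by blast
    have "enc L0 (r, c) \<in> latin_edges n L" using p L rc unfolding P_def by blast
    then obtain r' c' where rc': "r' \<in> {1..n}" "c' \<in> {1..n}" "enc L0 (r, c) = enc L (r', c')"
      by (auto simp only: latin_edges_iff enc_def prod.case)
    thus "L p = L0 p" using enc_inj[OF rc'(3) L0 _ rc(2,3) rc'(1,2)] L rc(1) by auto
  qed blast
  hence "card {L \<in> latin_squares n. Q \<subseteq> latin_edges n L} \<le> card {L \<in> latin_squares n. \<forall>p\<in>P. L p = L0 p}"
    using finite_latin_squares[of n] by (intro card_mono) auto
  also have "real \<dots> \<le> card (latin_squares n) * exp (2 * real n * (ln n + 1)\<^sup>2 - card P * (ln n - 4 * \<gamma>))"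
    by (rule card_latin_squares_agreeing[OF n \<gamma> AB _ L0]) (auto simp: P_def)
  also have "exp (2 * real n * (ln n + 1)\<^sup>2 - card P * (ln n - 4 * \<gamma>)) =
      exp ((2 * real n * (ln n + 1)\<^sup>2 + 4 * \<gamma> * card Q) + real (card Q) * (- ln n))"
    unfolding cPQ by (simp add: algebra_simps)
  also have "\<dots> = exp (2 * real n * (ln n + 1)\<^sup>2 + 4 * \<gamma> * card Q) * (1 / real n) ^ card Q"
    unfolding exp_add exp_of_nat_mult using n by (simp add: exp_minus inverse_eq_divide)
  finally show ?thesis by (simp add: mult.assoc)
qed

lemma lists_Suc_image:
  "{xs. set xs \<subseteq> A \<and> length xs = Suc k} = (\<lambda>(x, xs). x # xs) ` (A \<times> {xs. set xs \<subseteq> A \<and> length xs = k})"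
  by (auto simp: image_iff length_Suc_conv)

text \<open>With the tail \<open>fs\<close> fixed, the weight of the union splits into that of the
  union of the tail and \<open>q\<close> to the number of new elements of \<open>U f\<close>.
  Summing over the head \<open>f\<close> costs at most \<open>M\<close>, since the union of the tail
  is feasible and has at most \<open>k * h\<close> elements.\<close>

lemma sum_lists_union_weight:
  fixes U :: "'f \<Rightarrow> 'e set" and q M :: real
  assumes fin: "finite \<Phi>" "\<And>f. finite (U f)" and h: "\<And>f. f \<in> \<Phi> \<Longrightarrow> card (U f) \<le> h" and q: "q \<ge> 0" "M \<ge> 0"
    and down: "\<And>Q Q'. feasible Q \<Longrightarrow> Q' \<subseteq> Q \<Longrightarrow> feasible Q'"
    and M: "\<And>Q. feasible Q \<Longrightarrow> finite Q \<Longrightarrow> card Q \<le> t \<Longrightarrow> (\<Sum>f\<in>\<Phi>. q ^ card (U f - Q)) \<le> M"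
    and t: "k * h \<le> t"
  shows "(\<Sum>fs | set fs \<subseteq> \<Phi> \<and> length fs = k. if feasible (\<Union>(U ` set fs)) then q ^ card (\<Union>(U ` set fs)) else 0) \<le> M ^ k"
  using t
proof (induction k)
  case 0
  have "{fs. set fs \<subseteq> \<Phi> \<and> length fs = 0} = {[]}" by auto
  hence "(\<Sum>fs | set fs \<subseteq> \<Phi> \<and> length fs = 0. if feasible (\<Union>(U ` set fs)) then q ^ card (\<Union>(U ` set fs)) else 0)
      = (if feasible {} then 1 else 0)" by (simp only: sum.insert[OF finite.emptyI]) simp
  thus ?case by simp
next
  case (Suc k)
  let ?Ls = "{fs. set fs \<subseteq> \<Phi> \<and> length fs = k}" and ?un = "\<lambda>fs. \<Union>(U ` set fs)"
  let ?w = "\<lambda>fs. if feasible (?un fs) then q ^ card (?un fs) else 0"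
  have cardun: "card (?un fs) \<le> k * h" if "fs \<in> ?Ls" for fs
  proof -
    have "card (?un fs) \<le> (\<Sum>f\<in>set fs. card (U f))" by (rule card_UN_le) simp
    also have "\<dots> \<le> (\<Sum>f\<in>set fs. h)" using that h by (intro sum_mono) blast
    also have "\<dots> = card (set fs) * h" by simp
    also have "\<dots> \<le> k * h" using that card_length[of fs] by (intro mult_right_mono) auto
    finally show ?thesis .
  qed
  have finL: "finite ?Ls" using finite_lists_length_eq[OF fin(1)] .
  have inj: "inj_on (\<lambda>(x, xs). x # xs) (\<Phi> \<times> ?Ls)" by (auto simp: inj_on_def)
  have "(\<Sum>fs | set fs \<subseteq> \<Phi> \<and> length fs = Suc k. ?w fs) = (\<Sum>(f, fs)\<in>\<Phi> \<times> ?Ls. ?w (f # fs))"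
    unfolding lists_Suc_image by (subst sum.reindex[OF inj]) (simp add: case_prod_unfold)
  also have "\<dots> = (\<Sum>fs\<in>?Ls. \<Sum>f\<in>\<Phi>. ?w (f # fs))"
    using fin(1) finL by (subst sum.cartesian_product[symmetric]) (rule sum.swap)
  also have "\<dots> \<le> (\<Sum>fs\<in>?Ls. M * ?w fs)"
  proof (rule sum_mono)
    fix fs assume fs: "fs \<in> ?Ls"
    have finun: "finite (?un fs)" using fin(2) by simp
    show "(\<Sum>f\<in>\<Phi>. ?w (f # fs)) \<le> M * ?w fs"
    proof (cases "feasible (?un fs)")
      case True
      have "?w (f # fs) \<le> q ^ card (?un fs) * q ^ card (U f - ?un fs)" for f
      proof -
        have "?un (f # fs) = ?un fs \<union> (U f - ?un fs)" by auto
        hence "card (?un (f # fs)) = card (?un fs) + card (U f - ?un fs)"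
          using finun fin(2)[of f] card_Un_disjoint[of "?un fs" "U f - ?un fs"] by auto
        thus ?thesis using q(1) by (simp add: power_add)
      qed
      hence "(\<Sum>f\<in>\<Phi>. ?w (f # fs)) \<le> (\<Sum>f\<in>\<Phi>. q ^ card (?un fs) * q ^ card (U f - ?un fs))"
        by (intro sum_mono) blast
      also have "\<dots> = q ^ card (?un fs) * (\<Sum>f\<in>\<Phi>. q ^ card (U f - ?un fs))" by (simp add: sum_distrib_left)
      also have "\<dots> \<le> q ^ card (?un fs) * M"
        using q(1) cardun[OF fs] Suc.prems by (intro mult_left_mono M True finun) auto
      finally show ?thesis using True by (simp add: mult.commute)
    next
      case False
      \<comment> \<open>Feasibility is hereditary, so an infeasible tail contributes nothing for any
        head.\<close>
      have "\<not> feasible (?un (f # fs))" for f using False down[of "?un (f # fs)" "?un fs"] by auto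
      thus ?thesis using False by simp
    qed
  qed
  also have "\<dots> = M * (\<Sum>fs\<in>?Ls. ?w fs)" by (simp add: sum_distrib_left)
  also have "\<dots> \<le> M * M ^ k" using Suc q by (intro mult_left_mono) auto
  finally show ?case by simp
qed

text \<open>A \<open>k\<close>-th power counts lists of \<open>k\<close> copies in the square. The
  copies may overlap or repeat, which is why everything is weighted by the union of their
  hyperedges.\<close>

lemma moment_bound:
  fixes \<gamma> M :: real
  assumes H: "colored_triple_system H" and n: "n > 0" and \<gamma>: "0 \<le> \<gamma>" "\<gamma> \<le> 1 / 4"
    and AB: "A \<subseteq> {1..n}" "B \<subseteq> {1..n}" "card A \<le> \<gamma> * n" "card B \<le> \<gamma> * n"
    and M: "M \<ge> 0" "\<And>E. colored_triple_system (order_system n E) \<Longrightarrow> latin (order_system n E) \<Longrightarrow> card E \<le> t \<Longrightarrow>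
      (\<Sum>f\<in>placements H n A B. (1 / real n) ^ card (edge_images H f - E)) \<le> M"
    and t: "k * card (hedges H) \<le> t"
  shows "(\<Sum>L\<in>latin_squares n. real (card {f \<in> placements H n A B. edge_images H f \<subseteq> latin_edges n L}) ^ k) \<le>
    card (latin_squares n) * exp (2 * real n * (ln n + 1)\<^sup>2 + 4 * \<gamma> * (k * card (hedges H))) * M ^ k"
proof -
  define \<Phi> where "\<Phi> = placements H n A B"
  define h where "h = card (hedges H)"
  let ?U = "edge_images H" and ?LS = "latin_squares n"
  let ?Ls = "{fs. set fs \<subseteq> \<Phi> \<and> length fs = k}" and ?un = "\<lambda>fs. \<Union>(?U ` set fs)"
  \<comment> \<open>Being contained in some Latin square serves twice: it provides the
    \<open>L0\<close> for the counting estimate, and it makes the union a Latin system, to which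
    \<open>M\<close> applies.\<close>
  define feasible where "feasible = (\<lambda>Q. \<exists>L\<in>?LS. Q \<subseteq> latin_edges n L)"
  have fin\<Phi>: "finite \<Phi>" using H unfolding \<Phi>_def by (intro finite_placements) (simp add: colored_triple_system_def)
  have finU: "finite (?U f)" for f using finite_edge_images[OF H] .
  have finL: "finite ?Ls" using finite_lists_length_eq[OF fin\<Phi>] .
  have finLS: "finite ?LS" by (rule finite_latin_squares)
  have cardU: "card (?U f) = h" if "f \<in> \<Phi>" for f
    using card_edge_images[OF H] that unfolding \<Phi>_def h_def by blast
  have cardun: "card (?un fs) \<le> k * h" if "fs \<in> ?Ls" for fs
  proof -
    have "card (?un fs) \<le> (\<Sum>f\<in>set fs. card (?U f))" by (rule card_UN_le) simp
    also have "\<dots> = (\<Sum>f\<in>set fs. h)" using that cardU by (intro sum.cong) auto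
    also have "\<dots> = card (set fs) * h" by simp
    also have "\<dots> \<le> k * h" using that card_length[of fs] by (intro mult_right_mono) auto
    finally show ?thesis .
  qed
  have "real (card {f \<in> \<Phi>. ?U f \<subseteq> latin_edges n L}) ^ k =
      (\<Sum>fs\<in>?Ls. if ?un fs \<subseteq> latin_edges n L then 1 else 0)" for L
  proof -
    have "{fs. set fs \<subseteq> {f \<in> \<Phi>. ?U f \<subseteq> latin_edges n L} \<and> length fs = k} = {fs \<in> ?Ls. ?un fs \<subseteq> latin_edges n L}"
      by auto
    hence "card {f \<in> \<Phi>. ?U f \<subseteq> latin_edges n L} ^ k = card {fs \<in> ?Ls. ?un fs \<subseteq> latin_edges n L}"
      using card_lists_length_eq[of "{f \<in> \<Phi>. ?U f \<subseteq> latin_edges n L}" k] fin\<Phi> by simp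
    hence "real (card {f \<in> \<Phi>. ?U f \<subseteq> latin_edges n L}) ^ k = real (card {fs \<in> ?Ls. ?un fs \<subseteq> latin_edges n L})"
      by (simp flip: of_nat_power)
    also have "\<dots> = (\<Sum>fs\<in>?Ls. if ?un fs \<subseteq> latin_edges n L then 1 else 0)"
      using finL by (simp add: sum.If_cases Int_def)
    finally show ?thesis .
  qed
  hence "(\<Sum>L\<in>?LS. real (card {f \<in> \<Phi>. ?U f \<subseteq> latin_edges n L}) ^ k) =
      (\<Sum>L\<in>?LS. \<Sum>fs\<in>?Ls. if ?un fs \<subseteq> latin_edges n L then 1 else 0)" by simp
  also have "\<dots> = (\<Sum>fs\<in>?Ls. \<Sum>L\<in>?LS. if ?un fs \<subseteq> latin_edges n L then 1 else 0)" by (rule sum.swap)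
  also have "\<dots> = (\<Sum>fs\<in>?Ls. real (card {L \<in> ?LS. ?un fs \<subseteq> latin_edges n L}))"
    using finLS by (simp add: sum.If_cases Int_def)
  also have "\<dots> \<le> (\<Sum>fs\<in>?Ls. card ?LS * exp (2 * real n * (ln n + 1)\<^sup>2 + 4 * \<gamma> * (k * h)) *
      (if feasible (?un fs) then (1 / real n) ^ card (?un fs) else 0))"
  proof (rule sum_mono)
    fix fs assume fs: "fs \<in> ?Ls"
    show "real (card {L \<in> ?LS. ?un fs \<subseteq> latin_edges n L}) \<le>
      card ?LS * exp (2 * real n * (ln n + 1)\<^sup>2 + 4 * \<gamma> * (k * h)) *
      (if feasible (?un fs) then (1 / real n) ^ card (?un fs) else 0)"
    proof (cases "feasible (?un fs)")
      case True
      then obtain L0 where L0: "L0 \<in> ?LS" "?un fs \<subseteq> latin_edges n L0" unfolding feasible_def by blast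
      have "real (card {L \<in> ?LS. ?un fs \<subseteq> latin_edges n L}) \<le>
          card ?LS * exp (2 * real n * (ln n + 1)\<^sup>2 + 4 * \<gamma> * card (?un fs)) * (1 / real n) ^ card (?un fs)"
      proof (rule card_latin_squares_containing[OF n \<gamma> AB L0])
        fix e assume "e \<in> ?un fs"
        then obtain f where "f \<in> \<Phi>" "e \<in> ?U f" using fs by blast
        thus "\<exists>r\<in>A. \<exists>c\<in>B. \<exists>s\<in>{1..n}. e = {r, n + c, 2*n + s}"
          using edge_images_placement[OF H _ _ AB(1,2)] unfolding \<Phi>_def by blast
      qed
      also have "\<dots> \<le> card ?LS * exp (2 * real n * (ln n + 1)\<^sup>2 + 4 * \<gamma> * (k * h)) * (1 / real n) ^ card (?un fs)"
      proof -
        have "real (card (?un fs)) \<le> real (k * h)" using cardun[OF fs] of_nat_le_iff by blast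
        hence "\<gamma> * real (card (?un fs)) \<le> \<gamma> * real (k * h)" using \<gamma>(1) by (rule mult_left_mono)
        thus ?thesis by (intro mult_right_mono mult_left_mono) auto
      qed
      finally show ?thesis using True by simp
    next
      case False
      hence "{L \<in> ?LS. ?un fs \<subseteq> latin_edges n L} = {}" unfolding feasible_def by blast
      thus ?thesis using False by (simp only: if_False card.empty of_nat_0 mult_zero_right order_refl)
    qed
  qed
  also have "\<dots> = card ?LS * exp (2 * real n * (ln n + 1)\<^sup>2 + 4 * \<gamma> * (k * h)) *
      (\<Sum>fs\<in>?Ls. if feasible (?un fs) then (1 / real n) ^ card (?un fs) else 0)"
    by (simp add: sum_distrib_left)
  also have "\<dots> \<le> card ?LS * exp (2 * real n * (ln n + 1)\<^sup>2 + 4 * \<gamma> * (k * h)) * M ^ k"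
  proof (rule mult_left_mono)
    show "(\<Sum>fs\<in>?Ls. if feasible (?un fs) then (1 / real n) ^ card (?un fs) else 0) \<le> M ^ k"
    proof (rule sum_lists_union_weight[where h = h and t = t])
      show "feasible Q'" if "feasible Q" "Q' \<subseteq> Q" for Q Q' using that unfolding feasible_def by blast
      show "(\<Sum>f\<in>\<Phi>. (1 / real n) ^ card (?U f - Q)) \<le> M" if Q: "feasible Q" "card Q \<le> t" for Q
      proof -
        obtain L where L: "L \<in> ?LS" "Q \<subseteq> latin_edges n L" using Q(1) unfolding feasible_def by blast
        show ?thesis unfolding \<Phi>_def by (rule M(2)[OF latin_edges_subset[OF L] Q(2)])
      qed
    qed (use fin\<Phi> finU cardU M(1) t in \<open>simp_all add: h_def\<close>)
  qed auto
  finally show ?thesis by (simp add: \<Phi>_def h_def)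
qed

section \<open>The upper tail\<close>

lemma placementsD:
  assumes "f \<in> placements H n A B"
  shows "f \<in> verts H \<rightarrow>\<^sub>E {1..n} \<union> {n+1..2*n} \<union> {2*n+1..3*n}" "inj_on f (verts H)"
    "f ` Rcl H \<subseteq> A" "f ` Ccl H \<subseteq> (\<lambda>c. n + c) ` B" "f ` Scl H \<subseteq> {2*n+1..3*n}"
  using assms unfolding placements_def mem_Collect_eq by blast+

section \<open>Averaging over corners\<close>

definition corners :: "nat \<Rightarrow> nat \<Rightarrow> nat set set" where
  "corners n g = {A. A \<subseteq> {1..n} \<and> card A = g}"

lemma finite_corners: "finite (corners n g)"
  unfolding corners_def by (rule finite_subset[of _ "Pow {1..n}"]) auto

lemma card_corners: "card (corners n g) = n choose g"
  unfolding corners_def using n_subsets[of "{1..n}" g] by simp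

lemma card_corners_superset:
  assumes "R \<subseteq> {1..n}" "card R \<le> g"
  shows "card {A \<in> corners n g. R \<subseteq> A} = (n - card R) choose (g - card R)"
proof -
  have finR: "finite R" using assms finite_subset by blast
  have "bij_betw (\<lambda>A. A - R) {A \<in> corners n g. R \<subseteq> A} {S. S \<subseteq> {1..n} - R \<and> card S = g - card R}"
  proof (rule bij_betwI[where g = "\<lambda>S. S \<union> R"])
    show "(\<lambda>A. A - R) \<in> {A \<in> corners n g. R \<subseteq> A} \<rightarrow> {S. S \<subseteq> {1..n} - R \<and> card S = g - card R}"
      using finR by (auto simp: corners_def card_Diff_subset)
    show "(\<lambda>S. S \<union> R) \<in> {S. S \<subseteq> {1..n} - R \<and> card S = g - card R} \<rightarrow> {A \<in> corners n g. R \<subseteq> A}"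
    proof
      fix S assume S: "S \<in> {S. S \<subseteq> {1..n} - R \<and> card S = g - card R}"
      hence "finite S" "S \<inter> R = {}" using finite_subset[of S "{1..n} - R"] by blast+
      hence "card (S \<union> R) = g" using S finR assms(2) by (simp add: card_Un_disjoint)
      thus "S \<union> R \<in> {A \<in> corners n g. R \<subseteq> A}" using S assms(1) by (auto simp: corners_def)
    qed
  qed auto
  hence "card {A \<in> corners n g. R \<subseteq> A} = card {S. S \<subseteq> {1..n} - R \<and> card S = g - card R}"
    by (rule bij_betw_same_card)
  also have "\<dots> = card ({1..n} - R) choose (g - card R)" by (rule n_subsets) simp
  also have "card ({1..n} - R) = n - card R" using finR assms(1) by (simp add: card_Diff_subset)
  finally show ?thesis .
qed

text \<open>By injectivity a placement uses exactly \<open>card (Rcl H)\<close> rows and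
  \<open>card (Ccl H)\<close> columns, so all placements lie in the same number of corners. The
  predicate \<open>\<psi>\<close> is left open because this is applied both to the copies in a given
  square and to all placements.\<close>

lemma sum_corners_placements:
  assumes H: "colored_triple_system H" and g: "card (Rcl H) \<le> g" "card (Ccl H) \<le> g"
  shows "(\<Sum>A\<in>corners n g. \<Sum>B\<in>corners n g. card {f \<in> placements H n A B. \<psi> f}) =
    card {f \<in> placements H n {1..n} {1..n}. \<psi> f} *
    (((n - card (Rcl H)) choose (g - card (Rcl H))) * ((n - card (Ccl H)) choose (g - card (Ccl H))))"
proof -
  define F where "F = {f \<in> placements H n {1..n} {1..n}. \<psi> f}"
  \<comment> \<open>The column indices used by \<open>f\<close>, shifted back to
    \<open>{1..n}\<close>.\<close>
  define Cf where "Cf = (\<lambda>f :: 'a \<Rightarrow> nat. (\<lambda>x. x - n) ` f ` Ccl H)"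
  let ?cR = "(n - card (Rcl H)) choose (g - card (Rcl H))" and ?cC = "(n - card (Ccl H)) choose (g - card (Ccl H))"
  have finF: "finite F" unfolding F_def using finite_placements[of H n] H by (simp add: colored_triple_system_def)
  have col: "f ` Ccl H \<subseteq> (\<lambda>c. n + c) ` B \<longleftrightarrow> Cf f \<subseteq> B"
    if f: "f ` Ccl H \<subseteq> (\<lambda>c. n + c) ` {1..n}" for f B
  proof
    assume "f ` Ccl H \<subseteq> (\<lambda>c. n + c) ` B"
    thus "Cf f \<subseteq> B" unfolding Cf_def by auto
  next
    assume C: "Cf f \<subseteq> B"
    show "f ` Ccl H \<subseteq> (\<lambda>c. n + c) ` B"
    proof
      fix x assume x: "x \<in> f ` Ccl H"
      hence "x - n \<in> B" using C unfolding Cf_def by blast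
      moreover have "x = n + (x - n)" using x f by auto
      ultimately show "x \<in> (\<lambda>c. n + c) ` B" by blast
    qed
  qed
  have F: "f ` Rcl H \<subseteq> {1..n}" "card (f ` Rcl H) = card (Rcl H)" "Cf f \<subseteq> {1..n}" "card (Cf f) = card (Ccl H)"
    if f: "f \<in> F" for f
  proof -
    have inj: "inj_on f (verts H)" and fR: "f ` Rcl H \<subseteq> {1..n}" and fC: "f ` Ccl H \<subseteq> (\<lambda>c. n + c) ` {1..n}"
      using f unfolding F_def placements_def by blast+
    show "f ` Rcl H \<subseteq> {1..n}" by (rule fR)
    show "card (f ` Rcl H) = card (Rcl H)"
      by (rule card_image, rule inj_on_subset[OF inj]) (auto simp: verts_def)
    show "Cf f \<subseteq> {1..n}" using col[OF fC] fC by blast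
    have "card (Cf f) = card (f ` Ccl H)"
      unfolding Cf_def by (rule card_image, rule inj_on_subset[of _ "(\<lambda>c. n + c) ` {1..n}"])
        (use fC in \<open>auto simp: inj_on_def\<close>)
    also have "\<dots> = card (Ccl H)"
      by (rule card_image, rule inj_on_subset[OF inj]) (auto simp: verts_def)
    finally show "card (Cf f) = card (Ccl H)" .
  qed
  have "card {f \<in> placements H n A B. \<psi> f} = (\<Sum>f\<in>F. of_bool (f ` Rcl H \<subseteq> A) * of_bool (Cf f \<subseteq> B))"
    if AB: "A \<in> corners n g" "B \<in> corners n g" for A B
  proof -
    have ABn: "A \<subseteq> {1..n}" "B \<subseteq> {1..n}" using AB unfolding corners_def by blast+
    have "{f \<in> placements H n A B. \<psi> f} = {f \<in> F. f ` Rcl H \<subseteq> A \<and> Cf f \<subseteq> B}"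
    proof (intro set_eqI iffI)
      fix f assume f: "f \<in> {f \<in> placements H n A B. \<psi> f}"
      hence fF: "f \<in> F" using placements_mono[OF ABn, of H n] unfolding F_def by blast
      hence "f ` Ccl H \<subseteq> (\<lambda>c. n + c) ` {1..n}" unfolding F_def placements_def by blast
      moreover have "f ` Rcl H \<subseteq> A" "f ` Ccl H \<subseteq> (\<lambda>c. n + c) ` B" using f unfolding placements_def by blast+
      ultimately show "f \<in> {f \<in> F. f ` Rcl H \<subseteq> A \<and> Cf f \<subseteq> B}" using fF by (simp add: col)
    next
      fix f assume f: "f \<in> {f \<in> F. f ` Rcl H \<subseteq> A \<and> Cf f \<subseteq> B}"
      hence "f ` Ccl H \<subseteq> (\<lambda>c. n + c) ` {1..n}" unfolding F_def placements_def by blast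
      hence "f ` Ccl H \<subseteq> (\<lambda>c. n + c) ` B" using f by (simp add: col)
      thus "f \<in> {f \<in> placements H n A B. \<psi> f}" using f unfolding F_def placements_def mem_Collect_eq by simp
    qed
    moreover have "(\<Sum>f\<in>F. of_bool (f ` Rcl H \<subseteq> A) * of_bool (Cf f \<subseteq> B)) =
        (\<Sum>f\<in>F. if f ` Rcl H \<subseteq> A \<and> Cf f \<subseteq> B then 1 else (0::nat))"
      by (intro sum.cong refl) simp
    ultimately show ?thesis using finF by (simp add: sum.If_cases Int_def)
  qed
  hence "(\<Sum>A\<in>corners n g. \<Sum>B\<in>corners n g. card {f \<in> placements H n A B. \<psi> f}) =
      (\<Sum>A\<in>corners n g. \<Sum>B\<in>corners n g. \<Sum>f\<in>F. of_bool (f ` Rcl H \<subseteq> A) * of_bool (Cf f \<subseteq> B))"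
    by (intro sum.cong refl) blast
  also have "\<dots> = (\<Sum>A\<in>corners n g. \<Sum>f\<in>F. \<Sum>B\<in>corners n g. of_bool (f ` Rcl H \<subseteq> A) * of_bool (Cf f \<subseteq> B))"
    by (intro sum.cong refl sum.swap)
  also have "\<dots> = (\<Sum>f\<in>F. \<Sum>A\<in>corners n g. \<Sum>B\<in>corners n g. of_bool (f ` Rcl H \<subseteq> A) * of_bool (Cf f \<subseteq> B))"
    by (rule sum.swap)
  also have "\<dots> = (\<Sum>f\<in>F. (\<Sum>A\<in>corners n g. of_bool (f ` Rcl H \<subseteq> A)) * (\<Sum>B\<in>corners n g. of_bool (Cf f \<subseteq> B)))"
    by (intro sum.cong refl sum_product[symmetric])
  also have "\<dots> = (\<Sum>f\<in>F. ?cR * ?cC)"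
  proof (rule sum.cong[OF refl])
    fix f assume f: "f \<in> F"
    have *: "(\<Sum>A\<in>corners n g. of_bool (R \<subseteq> A)) = card {A \<in> corners n g. R \<subseteq> A}" for R
      using finite_corners[of n g] by (simp add: of_bool_def sum.If_cases Int_def)
    show "(\<Sum>A\<in>corners n g. of_bool (f ` Rcl H \<subseteq> A)) * (\<Sum>B\<in>corners n g. of_bool (Cf f \<subseteq> B)) = ?cR * ?cC"
      unfolding * using F[OF f] g card_corners_superset[of "f ` Rcl H" n g] card_corners_superset[of "Cf f" n g] by simp
  qed
  finally show ?thesis by (simp add: F_def)
qed

text \<open>Relabeling rows and columns maps one corner into another. Applied in both directions, it
  shows that all corners of the same size contain equally many placements.\<close>

lemma card_placements_le:
  assumes H: "finite (verts H)" and A: "A \<subseteq> {1..n}" "A' \<subseteq> {1..n}" "card A = card A'"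
    and B: "B \<subseteq> {1..n}" "B' \<subseteq> {1..n}" "card B = card B'"
  shows "card (placements H n A B) \<le> card (placements H n A' B')"
proof -
  have fin: "finite A" "finite A'" "finite B" "finite B'" using A B finite_subset by blast+
  obtain p q where p: "bij_betw p A A'" and q: "bij_betw q B B'"
    using finite_same_card_bij[OF fin(1,2) A(3)] finite_same_card_bij[OF fin(3,4) B(3)] by blast
  \<comment> \<open>Outside \<open>A\<close> and \<open>B\<close> the values of \<open>p\<close> and
    \<open>q\<close> are arbitrary; \<open>\<pi>\<close> is claimed to be injective only on
    \<open>?U\<close>, where the placements live.\<close>
  define \<pi> where "\<pi> = (\<lambda>x. if x \<in> {1..n} then p x else if x \<in> {n+1..2*n} then n + q (x - n) else x)"
  let ?U = "A \<union> (\<lambda>c. n + c) ` B \<union> {2*n+1..3*n}"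
  have pA: "\<pi> x = p x" "p x \<in> A'" if "x \<in> A" for x using that A p by (auto simp: \<pi>_def bij_betw_def)
  have pB: "\<pi> (n + c) = n + q c" "q c \<in> B'" if "c \<in> B" for c using that B q by (auto simp: \<pi>_def bij_betw_def)
  have pS: "\<pi> x = x" if "x \<in> {2*n+1..3*n}" for x using that by (auto simp: \<pi>_def)
  have inj1: "inj_on \<pi> A" using p pA by (auto simp: inj_on_def bij_betw_def)
  have inj2: "inj_on \<pi> ((\<lambda>c. n + c) ` B)" using q pB by (auto simp: inj_on_def bij_betw_def)
  have inj3: "inj_on \<pi> {2*n+1..3*n}" using pS by (auto simp: inj_on_def)
  have im1: "\<pi> ` A \<subseteq> A'" using pA by auto
  have im2: "\<pi> ` (\<lambda>c. n + c) ` B \<subseteq> (\<lambda>c. n + c) ` B'" using pB by auto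
  have im3: "\<pi> ` {2*n+1..3*n} \<subseteq> {2*n+1..3*n}" using pS by auto
  have B'n: "(\<lambda>c. n + c) ` B' \<subseteq> {n+1..2*n}" unfolding column_range[symmetric] by (rule image_mono[OF B(2)])
  have disj: "A' \<inter> (\<lambda>c. n + c) ` B' = {}" "(A' \<union> (\<lambda>c. n + c) ` B') \<inter> {2*n+1..3*n} = {}"
    using A(2) B'n by fastforce+
  have inj12: "inj_on \<pi> (A \<union> (\<lambda>c. n + c) ` B)"
  proof -
    have "\<pi> ` A \<inter> \<pi> ` (\<lambda>c. n + c) ` B = {}" using im1 im2 disj(1) by blast
    hence "\<pi> ` (A - (\<lambda>c. n + c) ` B) \<inter> \<pi> ` ((\<lambda>c. n + c) ` B - A) = {}" by blast
    thus ?thesis using inj1 inj2 by (simp add: inj_on_Un)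
  qed
  have inj: "inj_on \<pi> ?U"
  proof -
    have "\<pi> ` (A \<union> (\<lambda>c. n + c) ` B) \<inter> \<pi> ` {2*n+1..3*n} = {}" using im1 im2 im3 disj(2) by blast
    hence "\<pi> ` ((A \<union> (\<lambda>c. n + c) ` B) - {2*n+1..3*n}) \<inter> \<pi> ` ({2*n+1..3*n} - (A \<union> (\<lambda>c. n + c) ` B)) = {}" by blast
    thus ?thesis using inj12 inj3 unfolding inj_on_Un[of \<pi> "A \<union> (\<lambda>c. n + c) ` B"] by blast
  qed
  have fU: "f ` verts H \<subseteq> ?U" if f: "f \<in> placements H n A B" for f
    unfolding verts_def image_Un by (rule Un_mono[OF Un_mono[OF placementsD(3,4)[OF f]] placementsD(5)[OF f]])
  show ?thesis
  proof (rule card_inj_on_le[where f = "\<lambda>f. restrict (\<pi> \<circ> f) (verts H)"])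
    show "inj_on (\<lambda>f. restrict (\<pi> \<circ> f) (verts H)) (placements H n A B)"
    proof (rule inj_onI)
      fix f f' assume f: "f \<in> placements H n A B" "f' \<in> placements H n A B"
        and eq: "restrict (\<pi> \<circ> f) (verts H) = restrict (\<pi> \<circ> f') (verts H)"
      show "f = f'"
      proof (rule PiE_ext)
        show "f \<in> verts H \<rightarrow>\<^sub>E {1..n} \<union> {n+1..2*n} \<union> {2*n+1..3*n}" "f' \<in> verts H \<rightarrow>\<^sub>E {1..n} \<union> {n+1..2*n} \<union> {2*n+1..3*n}"
          by (rule placementsD(1)[OF f(1)], rule placementsD(1)[OF f(2)])
        show "f v = f' v" if v: "v \<in> verts H" for v
        proof (rule inj_onD[OF inj])
          show "\<pi> (f v) = \<pi> (f' v)" using fun_cong[OF eq, of v] v by simp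
          show "f v \<in> ?U" "f' v \<in> ?U" by (rule subsetD[OF fU[OF f(1)] imageI[OF v]], rule subsetD[OF fU[OF f(2)] imageI[OF v]])
        qed
      qed
    qed
    show "(\<lambda>f. restrict (\<pi> \<circ> f) (verts H)) ` placements H n A B \<subseteq> placements H n A' B'"
    proof (rule image_subsetI)
      fix f assume f: "f \<in> placements H n A B"
      let ?f = "restrict (\<pi> \<circ> f) (verts H)"
      have sub: "Rcl H \<subseteq> verts H" "Ccl H \<subseteq> verts H" "Scl H \<subseteq> verts H" by (auto simp: verts_def)
      have im: "?f ` X = \<pi> ` f ` X" if "X \<subseteq> verts H" for X
      proof -
        have "?f ` X = (\<lambda>v. \<pi> (f v)) ` X" using that by (intro image_cong) auto
        thus ?thesis by (simp add: image_image)
      qed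
      note fp = placementsD(2-5)[OF f]
      have R: "?f ` Rcl H \<subseteq> A'" using im[OF sub(1)] fp(2) im1 by blast
      have C: "?f ` Ccl H \<subseteq> (\<lambda>c. n + c) ` B'" using im[OF sub(2)] fp(3) im2 by blast
      have S: "?f ` Scl H \<subseteq> {2*n+1..3*n}" using im[OF sub(3)] fp(4) im3 by blast
      have "?f v \<in> {1..n} \<union> {n+1..2*n} \<union> {2*n+1..3*n}" if "v \<in> verts H" for v
      proof -
        have "?f ` verts H \<subseteq> {1..n} \<union> {n+1..2*n} \<union> {2*n+1..3*n}"
        proof -
          have V: "?f ` verts H = ?f ` Rcl H \<union> ?f ` Ccl H \<union> ?f ` Scl H"
            by (simp only: image_Un[symmetric] verts_def)
          show ?thesis unfolding V by (intro Un_mono order_trans[OF R A(2)] order_trans[OF C B'n] S)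
        qed
        thus ?thesis using that by blast
      qed
      hence "?f \<in> verts H \<rightarrow>\<^sub>E {1..n} \<union> {n+1..2*n} \<union> {2*n+1..3*n}" by (intro PiE_I) auto
      moreover have "inj_on ?f (verts H)"
        using comp_inj_on[OF fp(1) inj_on_subset[OF inj fU[OF f]]] by simp
      ultimately show "?f \<in> placements H n A' B'" using R C S unfolding placements_def mem_Collect_eq by (intro conjI)
    qed
    show "finite (placements H n A' B')" by (rule finite_placements[OF H])
  qed
qed

text \<open>Jensen's inequality; even powers are convex on the whole line and odd ones on the
  nonnegative half-line, hence the two cases.\<close>

lemma power_mean_le:
  fixes y :: "'i \<Rightarrow> real"
  assumes "finite I" "I \<noteq> {}" "\<And>i. i \<in> I \<Longrightarrow> y i \<ge> 0"
  shows "((\<Sum>i\<in>I. y i) / card I) ^ k \<le> (\<Sum>i\<in>I. y i ^ k) / card I"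
proof -
  have c: "card I > 0" using assms by (simp add: card_gt_0_iff)
  have "(\<Sum>i\<in>I. (1 / card I) *\<^sub>R y i) ^ k \<le> (\<Sum>i\<in>I. (1 / card I) * y i ^ k)"
  proof (cases "even k")
    case True
    thus ?thesis using assms c by (intro convex_on_sum[OF _ _ convex_power_even[OF True]]) auto
  next
    case False
    thus ?thesis using assms c by (intro convex_on_sum[OF _ _ convex_power_odd[OF False]]) auto
  qed
  thus ?thesis by (simp add: sum_divide_distrib)
qed

text \<open>The right-hand side is the probability that a random \<open>g\<close>-set contains a
  given \<open>r\<close>-set. It equals the product of \<open>(g - i) / (n - i)\<close> over
  \<open>i < r\<close>, and every factor is at least \<open>(g - r) / n\<close>.\<close>

lemma choose_ratio_lower:
  assumes "r \<le> g" "g \<le> n" "n > 0"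
  shows "((real g - r) / n) ^ r \<le> real ((n - r) choose (g - r)) / real (n choose g)"
proof -
  have e1: "real (g choose r) = (\<Prod>i<r. (real g - i) / (real r - i))"
    using assms by (subst binomial_altdef_of_nat) (auto intro!: prod.cong simp: of_nat_diff)
  have e2: "real (n choose r) = (\<Prod>i<r. (real n - i) / (real r - i))"
    using assms by (subst binomial_altdef_of_nat) (auto intro!: prod.cong simp: of_nat_diff)
  have e3: "(\<Prod>i<r. (real g - r) / n * ((real n - i) / (real r - i))) \<le> (\<Prod>i<r. (real g - i) / (real r - i))"
  proof (rule prod_mono, intro conjI)
    fix i assume i: "i \<in> {..<r}"
    hence pos: "real n - i \<ge> 0" "real n - i \<le> n" "real r - i > 0" "real g - r \<ge> 0" using assms by auto
    show "0 \<le> (real g - r) / n * ((real n - i) / (real r - i))" using pos by simp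
    have "(real g - r) * (real n - i) \<le> (real g - i) * n"
      using pos i by (intro mult_mono) auto
    hence "(real g - r) / n * (real n - i) \<le> real g - i" using assms(3) by (simp add: field_simps)
    hence "(real g - r) / n * (real n - i) / (real r - i) \<le> (real g - i) / (real r - i)"
      using pos(3) by (intro divide_right_mono) auto
    thus "(real g - r) / n * ((real n - i) / (real r - i)) \<le> (real g - i) / (real r - i)" by simp
  qed
  have pd: "(\<Prod>i<r. a * b i) = a ^ r * (\<Prod>i<r. b i)" for a :: real and b
    by (simp add: prod.distrib)
  have "((real g - r) / n) ^ r * real (n choose r) \<le> real (g choose r)"
    using e3 unfolding e1 e2 pd .
  moreover have "(n choose g) * (g choose r) = (n choose r) * ((n - r) choose (g - r))"
    using assms by (intro choose_mult)
  hence "real (n choose g) * real (g choose r) = real (n choose r) * real ((n - r) choose (g - r))"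
    by (metis of_nat_mult)
  moreover have pos: "real (n choose g) > 0" "real (n choose r) > 0" using assms by auto
  ultimately have "real (n choose r) * (((real g - r) / n) ^ r * real (n choose g)) \<le> real (n choose r) * real ((n - r) choose (g - r))"
    using mult_left_mono[of "((real g - r) / n) ^ r * real (n choose r)" "real (g choose r)" "real (n choose g)"]
    by (simp add: mult_ac)
  hence "((real g - r) / n) ^ r * real (n choose g) \<le> real ((n - r) choose (g - r))"
    using pos(2) by (simp only: mult_le_cancel_left_pos)
  thus ?thesis using pos(1) by (simp add: pos_le_divide_eq)
qed

text \<open>Let \<open>N k\<close> be a threshold from which
  \<open>F n (e k * s n) > 1 - e k\<close>. The index \<open>J n\<close>, the largest
  \<open>k <= n\<close> with \<open>N k <= n\<close>, tends to infinity slowly enough for the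
  estimate with \<open>e (J n)\<close> to hold at \<open>n\<close>.\<close>

lemma smallo_diagonal:
  fixes F :: "nat \<Rightarrow> real \<Rightarrow> real" and s :: "nat \<Rightarrow> real"
  assumes le1: "\<And>n x. F n x \<le> 1" and s: "\<And>n. s n \<ge> 0"
    and lim: "\<And>\<epsilon>. \<epsilon> > 0 \<Longrightarrow> (\<lambda>n. F n (\<epsilon> * s n)) \<longlonglongrightarrow> 1"
  shows "\<exists>g \<in> o(s). (\<lambda>n. F n (g n)) \<longlonglongrightarrow> 1"
proof -
  define e where "e = (\<lambda>k::nat. 1 / real (Suc k))"
  have e: "e k > 0" for k by (simp add: e_def)
  have "\<exists>N. \<forall>n\<ge>N. F n (e k * s n) > 1 - e k" for k
    using order_tendstoD(1)[OF lim[OF e], of "1 - e k" k] e[of k] by (simp add: eventually_sequentially)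
  then obtain N where N: "\<And>k n. n \<ge> N k \<Longrightarrow> F n (e k * s n) > 1 - e k" by metis
  \<comment> \<open>The inserted \<open>0\<close> keeps the maximum defined for small
    \<open>n\<close>; from \<open>N 0\<close> on it satisfies the threshold condition
    itself.\<close>
  define J where "J = (\<lambda>n. Max (insert 0 {k. k \<le> n \<and> N k \<le> n}))"
  have fin: "finite {k. k \<le> n \<and> N k \<le> n}" for n by simp
  have Jge: "J n \<ge> k" if "n \<ge> k" "n \<ge> N k" for n k
    unfolding J_def using that fin by (intro Max_ge) auto
  have JN: "N (J n) \<le> n" if "n \<ge> N 0" for n
  proof -
    have "J n \<in> insert 0 {k. k \<le> n \<and> N k \<le> n}" unfolding J_def using fin by (intro Max_in) auto
    thus ?thesis using that by auto
  qed
  have ev: "eventually (\<lambda>n. e (J n) \<le> c) sequentially" if c: "c > 0" for c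
  proof -
    obtain k where k: "e k < c" using c reals_Archimedean[OF c] unfolding e_def inverse_eq_divide by blast
    have "eventually (\<lambda>n. n \<ge> max k (N k)) sequentially" by (rule eventually_ge_at_top)
    thus ?thesis
    proof eventually_elim
      case (elim n)
      hence "e (J n) \<le> e k" using Jge[of k n] unfolding e_def by (intro divide_left_mono) auto
      thus ?case using k by simp
    qed
  qed
  let ?g = "\<lambda>n. e (J n) * s n"
  have g1: "?g \<in> o(s)"
  proof (rule landau_o.smallI)
    fix c :: real assume "c > 0"
    show "eventually (\<lambda>n. norm (?g n) \<le> c * norm (s n)) sequentially"
      using ev[OF \<open>c > 0\<close>]
    proof eventually_elim
      case (elim n)
      thus ?case using s[of n] e[of "J n"] by (simp add: mult_right_mono abs_mult)
    qed
  qed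
  have g2: "(\<lambda>n. F n (?g n)) \<longlonglongrightarrow> 1"
  proof (rule order_tendstoI)
    fix a :: real assume a: "a < 1"
    have "eventually (\<lambda>n. e (J n) \<le> 1 - a) sequentially" using a by (intro ev) simp
    moreover have "eventually (\<lambda>n. n \<ge> N 0) sequentially" by (rule eventually_ge_at_top)
    ultimately show "eventually (\<lambda>n. a < F n (?g n)) sequentially"
    proof eventually_elim
      case (elim n)
      thus ?case using N[OF JN[of n]] by fastforce
    qed
  next
    fix a :: real assume "a > 1"
    thus "eventually (\<lambda>n. F n (?g n) < a) sequentially"
      using le1 by (intro always_eventually allI) (meson le_less_trans)
  qed
  show ?thesis by (intro bexI[of _ ?g] g1 g2)
qed

text \<open>Here \<open>w\<close> is the probability that a given copy lies in a random corner, so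
  \<open>w\<close> times the number of copies in a square is the average over the corners, and
  \<open>w * exp_copies H n\<close> is the binomial mean in each corner. The stability error
  \<open>\<epsilon>\<close> enters in full, without the factor \<open>w\<close>.\<close>

lemma card_latin_squares_many_copies:
  fixes \<gamma> \<epsilon> a w :: real
  assumes H: "colored_triple_system H" and n: "n > 0" and \<gamma>: "0 \<le> \<gamma>" "\<gamma> \<le> 1 / 4"
    and g: "real g \<le> \<gamma> * n" "g \<le> n" "card (Rcl H) \<le> g" "card (Ccl H) \<le> g"
    and stab: "\<And>E. colored_triple_system (order_system n E) \<Longrightarrow> latin (order_system n E) \<Longrightarrow> card E \<le> t \<Longrightarrow>
      cond_exp_copies H n (order_system n E) - exp_copies H n \<le> \<epsilon>"
    and k: "k * card (hedges H) \<le> t" and a: "a \<ge> 0" and \<epsilon>: "\<epsilon> \<ge> 0"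
    and w: "w = real ((n - card (Rcl H)) choose (g - card (Rcl H))) / (n choose g) *
      (real ((n - card (Ccl H)) choose (g - card (Ccl H))) / (n choose g))"
  shows "card {L \<in> latin_squares n. a < real (num_copies H (latin_square_system n L))} * (w * a) ^ k \<le>
    card (latin_squares n) * exp (2 * real n * (ln n + 1)\<^sup>2 + 4 * \<gamma> * (k * card (hedges H))) * (w * exp_copies H n + \<epsilon>) ^ k"
proof -
  let ?G = "corners n g" and ?LS = "latin_squares n" and ?h = "card (hedges H)"
  define cc where "cc = ((n - card (Rcl H)) choose (g - card (Rcl H))) * ((n - card (Ccl H)) choose (g - card (Ccl H)))"
  define N where "N = real (n choose g)"
  define Y where "Y = (\<lambda>(A, B) L. real (card {f \<in> placements H n A B. edge_images H f \<subseteq> latin_edges n L}))"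
  define X where "X = (\<lambda>L. real (num_copies H (latin_square_system n L)))"
  define bound where "bound = card ?LS * exp (2 * real n * (ln n + 1)\<^sup>2 + 4 * \<gamma> * (k * ?h)) * (w * exp_copies H n + \<epsilon>) ^ k"
  have finV: "finite (verts H)" using H by (simp add: colored_triple_system_def)
  have N: "N > 0" using g(2) by (simp add: N_def)
  have w': "w = cc / N\<^sup>2" by (simp add: w cc_def N_def power2_eq_square)
  have w0: "w \<ge> 0" by (simp add: w')
  have finG: "finite (?G \<times> ?G)" using finite_corners by simp
  have cG: "real (card (?G \<times> ?G)) = N\<^sup>2"
    by (simp add: card_cartesian_product card_corners N_def power2_eq_square)
  have neG: "?G \<times> ?G \<noteq> {}" using cG N by auto
  have X: "w * X L = (\<Sum>p\<in>?G \<times> ?G. Y p L) / card (?G \<times> ?G)" for L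
  proof -
    have "X L * cc = (\<Sum>A\<in>?G. \<Sum>B\<in>?G. Y (A, B) L)"
      using arg_cong[OF sum_corners_placements[OF H g(3,4), of n "\<lambda>f. edge_images H f \<subseteq> latin_edges n L"], of real]
      unfolding X_def Y_def num_copies_def latin_square_system_eq copies_order_system cc_def prod.case of_nat_sum
      by (simp only: of_nat_mult)
    also have "\<dots> = (\<Sum>p\<in>?G \<times> ?G. Y p L)"
      by (subst sum.cartesian_product) (simp add: case_prod_unfold)
    finally show ?thesis unfolding cG w' using N by (simp add: field_simps)
  qed
  have moment: "(\<Sum>L\<in>?LS. Y p L ^ k) \<le> bound" if p: "p \<in> ?G \<times> ?G" for p
  proof -
    obtain A B where AB: "p = (A, B)" "A \<in> ?G" "B \<in> ?G" using p by blast
    have A: "A \<subseteq> {1..n}" "card A = g" and B: "B \<subseteq> {1..n}" "card B = g" using AB unfolding corners_def by blast+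
    \<comment> \<open>All corners contain equally many placements, so double counting gives each of
      them exactly the fraction \<open>w\<close> of the total.\<close>
    have "card (placements H n A' B') = card (placements H n A B)" if "A' \<in> ?G" "B' \<in> ?G" for A' B'
    proof -
      have A': "A' \<subseteq> {1..n}" "card A' = g" and B': "B' \<subseteq> {1..n}" "card B' = g" using that unfolding corners_def by blast+
      show ?thesis
        using card_placements_le[OF finV A(1) A'(1) _ B(1) B'(1)] card_placements_le[OF finV A'(1) A(1) _ B'(1) B(1)] A A' B B'
        by (intro antisym) simp_all
    qed
    hence "(\<Sum>A'\<in>?G. \<Sum>B'\<in>?G. card (placements H n A' B')) = (\<Sum>A'\<in>?G. \<Sum>B'\<in>?G. card (placements H n A B))"
      by (intro sum.cong refl) blast
    also have "\<dots> = (n choose g)\<^sup>2 * card (placements H n A B)"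
      by (simp add: card_corners power2_eq_square mult.assoc)
    finally have "(n choose g)\<^sup>2 * card (placements H n A B) = card (placements H n {1..n} {1..n}) * cc"
      using sum_corners_placements[OF H g(3,4), of n "\<lambda>_. True"] by (simp add: cc_def)
    hence "real ((n choose g)\<^sup>2 * card (placements H n A B)) = real (card (placements H n {1..n} {1..n}) * cc)"
      by (rule arg_cong)
    hence "card (placements H n A B) = w * card (placements H n {1..n} {1..n})"
      using N by (simp add: w' N_def field_simps)
    hence mass: "card (placements H n A B) * (1 / real n) ^ ?h = w * exp_copies H n"
      by (simp add: exp_copies_eq[OF H n])
    have M: "(\<Sum>f\<in>placements H n A B. (1 / real n) ^ card (edge_images H f - E)) \<le> w * exp_copies H n + \<epsilon>"
      if E: "colored_triple_system (order_system n E)" "latin (order_system n E)" "card E \<le> t" for E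
      using sum_placements_le_cond_exp[OF H n E(1) A(1) B(1)] stab[OF E] unfolding mass by linarith
    have M0: "w * exp_copies H n + \<epsilon> \<ge> 0" using w0 \<epsilon> by (simp add: exp_copies_eq[OF H n])
    show ?thesis unfolding bound_def Y_def AB(1) prod.case
      using moment_bound[OF H n \<gamma> A(1) B(1) _ _ M0 M k] A(2) B(2) g(1) by simp
  qed
  \<comment> \<open>Markov's inequality for the \<open>k\<close>-th power, in counting form.\<close>
  have "card {L \<in> ?LS. a < X L} * (w * a) ^ k = (\<Sum>L\<in>{L \<in> ?LS. a < X L}. (w * a) ^ k)" by simp
  also have "\<dots> \<le> (\<Sum>L\<in>{L \<in> ?LS. a < X L}. (w * X L) ^ k)"
    using w0 a by (intro sum_mono power_mono mult_left_mono) auto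
  also have "\<dots> \<le> (\<Sum>L\<in>?LS. (w * X L) ^ k)"
    using w0 finite_latin_squares[of n] by (intro sum_mono2) (auto simp: X_def)
  also have "\<dots> \<le> (\<Sum>L\<in>?LS. (\<Sum>p\<in>?G \<times> ?G. Y p L ^ k) / card (?G \<times> ?G))"
    unfolding X by (intro sum_mono power_mean_le finG neG) (auto simp: Y_def)
  also have "\<dots> = (\<Sum>p\<in>?G \<times> ?G. \<Sum>L\<in>?LS. Y p L ^ k) / card (?G \<times> ?G)"
    unfolding sum_divide_distrib[symmetric] by (subst sum.swap) (rule refl)
  also have "\<dots> \<le> (\<Sum>p\<in>?G \<times> ?G. bound) / card (?G \<times> ?G)"
    by (intro divide_right_mono sum_mono moment) auto
  also have "\<dots> = bound" using cG N by simp
  finally show ?thesis unfolding bound_def X_def .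
qed

section \<open>Choice of constants and conclusion\<close>

lemma prob_random_latin_square:
  "measure_pmf.prob (random_latin_square n) {Q. \<phi> Q} =
    1 - card {L \<in> latin_squares n. \<not> \<phi> (latin_square_system n L)} / card (latin_squares n)"
proof -
  let ?LS = "latin_squares n" and ?bad = "{L \<in> latin_squares n. \<not> \<phi> (latin_square_system n L)}"
  have c: "card ?LS > 0" using finite_latin_squares latin_squares_nonempty by (simp add: card_gt_0_iff)
  have "?LS \<inter> latin_square_system n -` {Q. \<phi> Q} = ?LS - ?bad" by blast
  moreover have "card (?LS - ?bad) = card ?LS - card ?bad"
    using finite_latin_squares[of n] by (intro card_Diff_subset) auto
  moreover have "card ?bad \<le> card ?LS" using finite_latin_squares[of n] by (intro card_mono) auto
  ultimately show ?thesis
    using c finite_latin_squares latin_squares_nonempty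
    by (simp add: random_latin_square_def measure_pmf_of_set of_nat_diff diff_divide_distrib)
qed

lemma random_latin_square_upper_tail:
  fixes H :: "'a triple_system" and \<alpha> \<epsilon> :: real
  assumes H: "colored_triple_system H" and stable: "alpha_stable \<alpha> H" and \<epsilon>: "\<epsilon> > 0"
  shows "(\<lambda>n. measure_pmf.prob (random_latin_square n)
    {Q. real (num_copies H Q) \<le> exp_copies H n + \<epsilon> * real n powr \<alpha>}) \<longlonglongrightarrow> 1"
proof -
  define h r c where "h = card (hedges H)" and "r = card (Rcl H)" and "c = card (Ccl H)"
  from stable have "exp_copies H \<in> O(\<lambda>n. real n powr \<alpha>)" by (simp add: alpha_stable_def)
  then obtain M where M: "M > 0" "\<forall>\<^sub>F n in sequentially. norm (exp_copies H n) \<le> M * norm (real n powr \<alpha>)"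
    by (rule landau_o.bigE)
  from stable obtain t :: "nat \<Rightarrow> nat" where t: "(\<lambda>n. real (t n)) \<in> \<omega>(\<lambda>n. real n * (ln (real n))\<^sup>2)"
    and stab: "\<And>\<delta>. \<delta> > 0 \<Longrightarrow> \<forall>\<^sub>F n in sequentially. \<forall>E.
           colored_triple_system (order_system n E) \<and> latin (order_system n E) \<and> card E \<le> t n \<longrightarrow>
           \<bar>cond_exp_copies H n (order_system n E) - exp_copies H n\<bar> \<le> \<delta> * real n powr \<alpha>"
    unfolding alpha_stable_def by blast
  \<comment> \<open>Half of the excess is given up to the stability error. The ratio of mean plus
    half the excess to mean plus the whole excess is largest when the mean reaches its bound
    \<open>M * n powr \<alpha>\<close>, and is then \<open>\<rho>\<close>.\<close>
  define \<rho> where "\<rho> = (M + \<epsilon> / 2) / (M + \<epsilon>)"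
  have \<rho>: "0 < \<rho>" "\<rho> < 1" using M(1) \<epsilon> by (auto simp: \<rho>_def field_simps)
  define \<mu> where "\<mu> = - ln \<rho>"
  have \<mu>: "\<mu> > 0" using \<rho> by (simp add: \<mu>_def)
  \<comment> \<open>Small enough that the loss \<open>exp (4 * \<gamma> * k * h)\<close> uses up at
    most half of the gain \<open>\<rho> ^ k = exp (- k * \<mu>)\<close>.\<close>
  define \<gamma> where "\<gamma> = min (1 / 4) (\<mu> / (8 * (real h + 1)))"
  have \<gamma>: "0 < \<gamma>" "\<gamma> \<le> 1 / 4" using \<mu> unfolding \<gamma>_def by simp (rule min.cobounded1)
  have \<gamma>h: "4 * \<gamma> * h \<le> \<mu> / 2"
  proof -
    have "4 * \<gamma> * h \<le> 4 * \<gamma> * (real h + 1)" using \<gamma> by simp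
    also have "\<dots> \<le> 4 * (\<mu> / (8 * (real h + 1))) * (real h + 1)"
      by (intro mult_right_mono mult_left_mono) (auto simp: \<gamma>_def)
    also have "\<dots> = \<mu> / 2" by (simp add: field_simps)
    finally show ?thesis .
  qed
  \<comment> \<open>A lower bound for the fraction \<open>w\<close> that does not depend on
    \<open>n\<close>. With it \<open>\<delta>\<close> can be fixed so that the unscaled stability
    error is at most \<open>w\<close> times half the excess.\<close>
  define w0 where "w0 = (\<gamma> / 2) ^ r * (\<gamma> / 2) ^ c"
  have w0: "w0 > 0" using \<gamma> by (simp add: w0_def)
  define \<delta> where "\<delta> = w0 * \<epsilon> / 2"
  have \<delta>: "\<delta> > 0" using w0 \<epsilon> by (simp add: \<delta>_def)
  define C where "C = 20 * (real h + 1) / \<mu>"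
  have C: "C > 0" using \<mu> by (simp add: C_def)
  define bad where "bad = (\<lambda>n. card {L \<in> latin_squares n.
      \<not> real (num_copies H (latin_square_system n L)) \<le> exp_copies H n + \<epsilon> * real n powr \<alpha>} / real (card (latin_squares n)))"
  have "\<forall>\<^sub>F n in sequentially. bad n \<le> exp (\<mu> / 2 - real n)"
  proof -
    have "\<forall>\<^sub>F n in sequentially. C * norm (real n * (ln (real n))\<^sup>2) \<le> norm (real (t n))"
      using landau_omega.smallD[OF t C] by simp
    moreover have "\<forall>\<^sub>F n in sequentially. ln (real n) \<ge> 1" by real_asymp
    \<comment> \<open>Large enough that rounding \<open>\<gamma> * n\<close> down to
      \<open>g\<close> and subtracting \<open>r\<close> or \<open>c\<close> leaves at least
      \<open>\<gamma> * n / 2\<close>.\<close>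
    moreover have "\<forall>\<^sub>F n in sequentially. real n \<ge> 2 * (1 + real r + real c) / \<gamma>" by real_asymp
    ultimately show ?thesis using M(2) stab[OF \<delta>] eventually_gt_at_top[of 0]
    proof eventually_elim
      case (elim n)
      define g where "g = nat \<lfloor>\<gamma> * n\<rfloor>"
      \<comment> \<open>Dividing by \<open>h + 1\<close> covers the case without hyperedges and
        ensures \<open>k * h <= t n\<close>.\<close>
      define k where "k = t n div (h + 1)"
      define s where "s = real n powr \<alpha>"
      define ex where "ex = exp_copies H n"
      define w where "w = real ((n - r) choose (g - r)) / (n choose g) * (real ((n - c) choose (g - c)) / (n choose g))"
      have n: "n > 0" using elim by simp
      have s: "s > 0" using n by (simp add: s_def)
      have ex: "0 \<le> ex" "ex \<le> M * s"
        using elim(4) s by (simp_all add: ex_def s_def exp_copies_eq[OF H n])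
      have g1: "real g \<le> \<gamma> * n" using \<gamma> by (simp add: g_def)
      have g2: "real g \<ge> \<gamma> * n - 1" unfolding g_def using \<gamma> by linarith
      have gn: "g \<le> n"
      proof -
        have "\<gamma> * n \<le> 1 * real n" using \<gamma> by (intro mult_right_mono) auto
        thus ?thesis using g1 by simp
      qed
      have "2 * (1 + real r + real c) \<le> \<gamma> * n" using elim(3) \<gamma> by (simp add: pos_divide_le_eq mult.commute)
      hence big: "2 + 2 * real r + 2 * real c \<le> \<gamma> * n" by (simp add: algebra_simps)
      have nn: "real r \<ge> 0" "real c \<ge> 0" by simp_all
      have "real r \<le> real g" using g2 big nn by linarith
      moreover have "real c \<le> real g" using g2 big nn by linarith
      ultimately have rg: "r \<le> g" "c \<le> g" by simp_all
      have ratio: "(\<gamma> / 2) ^ x \<le> real ((n - x) choose (g - x)) / (n choose g)" if x: "x \<le> g" "x = r \<or> x = c" for x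
      proof -
        have "real x \<le> real r + real c" using x(2) nn by auto
        hence "\<gamma> * n \<le> 2 * real g - 2 * real x" using g2 big nn by linarith
        hence "\<gamma> / 2 * n \<le> real g - x" by simp
        hence "\<gamma> / 2 \<le> (real g - x) / n" using n by (simp add: pos_le_divide_eq)
        hence "(\<gamma> / 2) ^ x \<le> ((real g - x) / n) ^ x" using \<gamma> by (intro power_mono) auto
        also have "\<dots> \<le> real ((n - x) choose (g - x)) / (n choose g)" by (rule choose_ratio_lower[OF x(1) gn n])
        finally show ?thesis .
      qed
      have ww0: "w \<ge> w0" unfolding w_def w0_def using ratio[OF rg(1)] ratio[OF rg(2)] \<gamma> by (intro mult_mono) auto
      hence wpos: "w > 0" using w0 by linarith
      define a where "a = ex + \<epsilon> * s"
      have a: "a > 0" using ex s \<epsilon> by (simp add: a_def add_nonneg_pos)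
      have kh: "k * h \<le> t n"
      proof -
        have "k * h \<le> k * (h + 1)" by simp
        also have "\<dots> \<le> t n" unfolding k_def by (rule div_times_less_eq_dividend)
        finally show ?thesis .
      qed
      have tail: "card {L \<in> latin_squares n. a < real (num_copies H (latin_square_system n L))} * (w * a) ^ k \<le>
          card (latin_squares n) * exp (2 * real n * (ln n + 1)\<^sup>2 + 4 * \<gamma> * (k * h)) * (w * ex + \<delta> * s) ^ k"
        unfolding ex_def h_def
      proof (rule card_latin_squares_many_copies[where t = "t n" and g = g])
        show "cond_exp_copies H n (order_system n E) - exp_copies H n \<le> \<delta> * s"
          if "colored_triple_system (order_system n E)" "latin (order_system n E)" "card E \<le> t n" for E
          using elim(5) that unfolding s_def by (meson abs_le_D1)
      qed (use H n \<gamma> g1 gn rg kh a \<delta> s in \<open>simp_all add: w_def r_def c_def h_def\<close>)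
      have "w * ex + \<delta> * s \<le> w * (\<rho> * a)"
      proof -
        have "\<delta> * s \<le> w * (\<epsilon> / 2 * s)"
          using ww0 \<epsilon> s unfolding \<delta>_def by (simp add: mult_right_mono)
        hence "w * ex + \<delta> * s \<le> w * (ex + \<epsilon> / 2 * s)" by (simp add: distrib_left)
        also have "\<dots> \<le> w * (\<rho> * a)"
        proof (rule mult_left_mono)
          have "ex * \<epsilon> \<le> M * s * \<epsilon>" using ex(2) \<epsilon> by (intro mult_right_mono) auto
          moreover have "(M + \<epsilon> / 2) * a - (ex + \<epsilon> / 2 * s) * (M + \<epsilon>) = (M * s * \<epsilon> - ex * \<epsilon>) / 2"
            by (simp add: a_def field_simps)
          ultimately have "0 \<le> (M + \<epsilon> / 2) * a - (ex + \<epsilon> / 2 * s) * (M + \<epsilon>)"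
            by (simp only: zero_le_divide_iff diff_ge_0_iff_ge zero_le_numeral simp_thms)
          hence "(ex + \<epsilon> / 2 * s) * (M + \<epsilon>) \<le> (M + \<epsilon> / 2) * a" by (simp only: diff_ge_0_iff_ge)
          thus "ex + \<epsilon> / 2 * s \<le> \<rho> * a" using M(1) \<epsilon> by (simp add: \<rho>_def pos_le_divide_eq)
        qed (use wpos in simp)
        finally show ?thesis .
      qed
      hence "(w * ex + \<delta> * s) ^ k \<le> (w * (\<rho> * a)) ^ k"
        using wpos ex \<delta> s by (intro power_mono) auto
      also have "\<dots> = \<rho> ^ k * (w * a) ^ k" by (simp add: power_mult_distrib)
      finally have "card (latin_squares n) * exp (2 * real n * (ln n + 1)\<^sup>2 + 4 * \<gamma> * (k * h)) * (w * ex + \<delta> * s) ^ k \<le>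
          card (latin_squares n) * exp (2 * real n * (ln n + 1)\<^sup>2 + 4 * \<gamma> * (k * h)) * (\<rho> ^ k * (w * a) ^ k)"
        by (intro mult_left_mono) auto
      with tail have "card {L \<in> latin_squares n. a < real (num_copies H (latin_square_system n L))} * (w * a) ^ k \<le>
          (card (latin_squares n) * exp (2 * real n * (ln n + 1)\<^sup>2 + 4 * \<gamma> * (k * h)) * \<rho> ^ k) * (w * a) ^ k"
        by (simp add: mult_ac)
      hence "card {L \<in> latin_squares n. a < real (num_copies H (latin_square_system n L))} \<le>
          card (latin_squares n) * exp (2 * real n * (ln n + 1)\<^sup>2 + 4 * \<gamma> * (k * h)) * \<rho> ^ k"
        using wpos a by (simp only: mult_le_cancel_right_pos zero_less_power mult_pos_pos)
      moreover have "card (latin_squares n) > 0"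
        using finite_latin_squares latin_squares_nonempty by (simp add: card_gt_0_iff)
      ultimately have "bad n \<le> exp (2 * real n * (ln n + 1)\<^sup>2 + 4 * \<gamma> * (k * h)) * \<rho> ^ k"
        unfolding bad_def a_def ex_def s_def by (simp add: not_le pos_divide_le_eq mult_ac)
      also have "\<rho> ^ k = exp (- (k * \<mu>))" using \<rho> by (simp add: \<mu>_def exp_of_nat_mult)
      also have "exp (2 * real n * (ln n + 1)\<^sup>2 + 4 * \<gamma> * (k * h)) * exp (- (k * \<mu>)) \<le> exp (\<mu> / 2 - n)"
        unfolding exp_add[symmetric] exp_le_cancel_iff
      proof -
        define l where "l = ln (real n)"
        have l: "l \<ge> 1" using elim(2) by (simp add: l_def)
        have l2: "l\<^sup>2 \<ge> 1" using l by simp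
        have "4 * \<gamma> * real (k * h) \<le> k * (\<mu> / 2)"
          using mult_left_mono[OF \<gamma>h, of "real k"] by (simp add: mult_ac)
        moreover have "2 * real n * (l + 1)\<^sup>2 \<le> 8 * (n * l\<^sup>2)"
        proof -
          have "(l + 1)\<^sup>2 \<le> (2 * l)\<^sup>2" using l by (intro power_mono) auto
          thus ?thesis using mult_left_mono[of "(l + 1)\<^sup>2" "(2 * l)\<^sup>2" "2 * real n"] by (simp add: power_mult_distrib mult_ac)
        qed
        \<comment> \<open>The constant in \<open>C\<close> is chosen for this: half of the gain pays
          the counting error of at most \<open>8 * n * l^2\<close> and leaves enough for
          \<open>exp (- n)\<close>. The additive \<open>\<mu> / 2\<close> comes from rounding in
          \<open>k\<close>.\<close>
        moreover have "10 * (n * l\<^sup>2) \<le> \<mu> / 2 * (k + 1)"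
        proof -
          have "C * (n * l\<^sup>2) \<le> t n" using elim(1) by (simp add: l_def)
          also have "real (t n) \<le> real ((k + 1) * (h + 1))"
          proof -
            have "t n < (k + 1) * (h + 1)" unfolding k_def using dividend_less_div_times[of "h + 1" "t n"] by (simp add: algebra_simps)
            thus ?thesis by (intro of_nat_mono) simp
          qed
          finally have "20 * (n * l\<^sup>2) * (real h + 1) \<le> \<mu> * (k + 1) * (real h + 1)"
            using \<mu> by (simp add: C_def field_simps)
          hence "20 * (n * l\<^sup>2) \<le> \<mu> * (k + 1)" by (rule mult_right_le_imp_le) simp
          thus ?thesis by simp
        qed
        moreover have "real n \<le> n * l\<^sup>2" using mult_left_mono[OF l2, of "real n"] by simp
        moreover have "\<mu> / 2 * (k + 1) = k * (\<mu> / 2) + \<mu> / 2" "k * \<mu> = 2 * (k * (\<mu> / 2))"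
          by (simp_all add: algebra_simps)
        ultimately show "2 * real n * (ln n + 1)\<^sup>2 + 4 * \<gamma> * (k * h) + - (k * \<mu>) \<le> \<mu> / 2 - n"
          unfolding l_def[symmetric] by linarith
      qed
      finally show ?case .
    qed
  qed
  moreover have "(\<lambda>n. exp (\<mu> / 2 - real n)) \<longlonglongrightarrow> 0" by real_asymp
  moreover have "\<forall>\<^sub>F n in sequentially. 0 \<le> bad n" by (simp add: bad_def)
  ultimately have "bad \<longlonglongrightarrow> 0" using tendsto_sandwich[of "\<lambda>_. 0" bad sequentially] by auto
  hence "(\<lambda>n. 1 - bad n) \<longlonglongrightarrow> 1 - 0" by (intro tendsto_intros)
  thus ?thesis by (simp add: prob_random_latin_square bad_def)
qed

theorem theorem7p2:
  fixes H :: "'a triple_system" and \<alpha> :: real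
  assumes "colored_triple_system H" and "latin H" and "alpha_stable \<alpha> H"
  shows "\<exists>g :: nat \<Rightarrow> real. g \<in> o(\<lambda>n. real n powr \<alpha>) \<and>
    (\<lambda>n. measure_pmf.prob (random_latin_square n)
            {Q. real (num_copies H Q) \<le> exp_copies H n + g n}) \<longlonglongrightarrow> 1"
  using smallo_diagonal[of "\<lambda>n x. measure_pmf.prob (random_latin_square n) {Q. real (num_copies H Q) \<le> exp_copies H n + x}"
      "\<lambda>n. real n powr \<alpha>"] random_latin_square_upper_tail[OF assms(1,3)]
  by auto

end
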